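(* Let $\alpha\in(0,1)$, $\beta>0$, $a>0$, $\gamma_0=\frac{5\alpha+1}{2\alpha(2\alpha+1)}$, $\gamma\in(\gamma_0,\frac1\alpha)$ be fixed, and let $t_{a,\gamma}=e^{aN^\gamma}$. Let $(X(t))_{t\ge 0}$ be the Glauber dynamics for $\pi_{\beta,\mathbf J}$ with $X(0)\sim\mathrm{Unif}(\Sigma_N)$. With $\mathbb P_{\mathbf J}$-probability $1-o(1)$, for any fixed $s>1$, $$d_{TV}\big(\mathrm{Law}(C_N(t_{a,\gamma},st_{a,\gamma})),\ q^{(N)}_{a,\gamma}\big)=o(1),$$ where $C_N(t,st)=\frac1N\sum_{v=1}^N X_v(t)X_v(st)$ and $q^{(N)}_{a,\gamma}$ is the law (given $\mathbf J$) of $\langle\sigma,\sigma'\rangle_N=\frac1N\sum_{v=1}^N\sigma_v\sigma'_v$, where, for a $t_{a,\gamma}$-metastable well $\mathcal C_i$ chosen uniformly at random among all $t_{a,\gamma}$-metastable wells, $\sigma,\sigma'$ are independent samples from $\pi_{\beta,\mathbf J}(\cdot\mid\mathcal C_i)$.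
   Context: Model. For each $N$, $\mathbf J=(J_{ij})_{1\le i<j\le N}$, $J_{ji}=J_{ij}$, are i.i.d. with density $\frac{\alpha}{2N}|x|^{-(1+\alpha)}\mathbf 1\{|x|\ge N^{-1/\alpha}\}$; $\mathbb P_{\mathbf J}$ is the law of $\mathbf J$. $\Sigma_N=\{\pm1\}^N$, $H(\sigma)=\sum_{i<j}J_{ij}\sigma_i\sigma_j$, and $\pi_{\beta,\mathbf J}(\sigma)\propto e^{\beta H(\sigma)}$. $o(1)$ is as $N\to\infty$ with the other parameters fixed. Glauber dynamics. Continuous-time chain on $\Sigma_N$: each site has a rate-1 Poisson clock; when the clock at $v$ rings, $\sigma_v$ is resampled from $\pi_{\beta,\mathbf J}(\sigma_v\in\cdot\mid(\sigma_w)_{w\ne v})$, other spins unchanged. Wells. Let $E_{a,\gamma}=\{(i,j):|J_{ij}|\ge\frac{a}{2\beta}N^\gamma\}$ and $K=|E_{a,\gamma}|$; with $\mathbb P_{\mathbf J}$-probability $1-o(1)$ the edges in $E_{a,\gamma}$ are vertex-disjoint, and one works on this event. Let $\mathsf{Sat}(\sigma)=\{(i,j):\sigma_i\sigma_j=\mathrm{sign}(J_{ij})\}$. The set $\{\sigma:\mathsf{Sat}(\sigma)\supset E_{a,\gamma}\}$ splits into $2^K$ connected components of the hypercube (one for each choice of satisfying assignment on every edge of $E_{a,\gamma}$); these are the $t_{a,\gamma}$-metastable wells $\mathcal C_i$. *)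

theory Defs
  imports "HOL-Probability.Probability"
begin

section \<open>Levy spin glass\<close>

definition pairs :: "nat \<Rightarrow> (nat \<times> nat) set" where
  "pairs N = {(i, j). 1 \<le> i \<and> i < j \<and> j \<le> N}"

text \<open>A coupling configuration \<^term>\<open>J\<close> is only ever evaluated on pairs \<open>i < j\<close>, so the symmetric
  extension \<open>J_ji = J_ij\<close> carries no information and is omitted.\<close>

definition coupling_density :: "real \<Rightarrow> nat \<Rightarrow> real \<Rightarrow> real" where
  "coupling_density \<alpha> N x =
     \<alpha> / (2 * real N) * \<bar>x\<bar> powr (- (1 + \<alpha>)) * indicator {x. \<bar>x\<bar> \<ge> real N powr (- 1 / \<alpha>)} x"

definition disorder :: "real \<Rightarrow> nat \<Rightarrow> (nat \<times> nat \<Rightarrow> real) measure" where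
  "disorder \<alpha> N = (\<Pi>\<^sub>M e\<in>pairs N. density lborel (\<lambda>x. ennreal (coupling_density \<alpha> N x)))"

definition spins :: "nat \<Rightarrow> (nat \<Rightarrow> real) set" where
  "spins N = (\<Pi>\<^sub>E v\<in>{1..N}. {-1, 1})"

text \<open>The Gibbs weight is \<open>exp (\<beta> H)\<close>, with a plus sign.\<close>

definition hamiltonian :: "nat \<Rightarrow> (nat \<times> nat \<Rightarrow> real) \<Rightarrow> (nat \<Rightarrow> real) \<Rightarrow> real" where
  "hamiltonian N J \<sigma> = (\<Sum>(i, j)\<in>pairs N. J (i, j) * \<sigma> i * \<sigma> j)"

definition gibbs :: "real \<Rightarrow> nat \<Rightarrow> (nat \<times> nat \<Rightarrow> real) \<Rightarrow> (nat \<Rightarrow> real) pmf" where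
  "gibbs \<beta> N J = embed_pmf (\<lambda>\<sigma>.
     if \<sigma> \<in> spins N
     then exp (\<beta> * hamiltonian N J \<sigma>) / (\<Sum>\<tau>\<in>spins N. exp (\<beta> * hamiltonian N J \<tau>))
     else 0)"

lemma finite_spins: "finite (spins N)"
  unfolding spins_def by (intro finite_PiE) auto

lemma spins_nonempty: "spins N \<noteq> {}"
  by (auto simp: spins_def PiE_eq_empty_iff)

lemma pmf_gibbs:
  "pmf (gibbs \<beta> N J) \<sigma> =
     (if \<sigma> \<in> spins N
      then exp (\<beta> * hamiltonian N J \<sigma>) / (\<Sum>\<tau>\<in>spins N. exp (\<beta> * hamiltonian N J \<tau>))
      else 0)"
proof -
  define w where "w = (\<lambda>\<tau>. exp (\<beta> * hamiltonian N J \<tau>))"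
  define Z where "Z = (\<Sum>\<tau>\<in>spins N. w \<tau>)"
  have Z: "Z > 0"
    unfolding Z_def w_def by (intro sum_pos finite_spins spins_nonempty) auto
  have "(\<integral>\<^sup>+ \<tau>. ennreal (if \<tau> \<in> spins N then w \<tau> / Z else 0) \<partial>count_space UNIV)
      = (\<Sum>\<tau>\<in>spins N. ennreal (w \<tau> / Z))"
    by (subst nn_integral_count_space'[where A = "spins N"])
       (auto simp: finite_spins intro!: sum.cong)
  also have "\<dots> = ennreal (\<Sum>\<tau>\<in>spins N. w \<tau> / Z)"
    using Z by (intro sum_ennreal) (auto simp: w_def)
  also have "\<dots> = 1"
    using Z by (simp add: Z_def flip: sum_divide_distrib)
  finally have "pmf (embed_pmf (\<lambda>\<tau>. if \<tau> \<in> spins N then w \<tau> / Z else 0)) \<sigma> =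
      (if \<sigma> \<in> spins N then w \<sigma> / Z else 0)"
    using Z by (intro pmf_embed_pmf) (auto simp: w_def)
  then show ?thesis
    unfolding gibbs_def Z_def w_def .
qed

section \<open>Glauber dynamics\<close>

text \<open>The spin at \<open>v\<close> is redrawn from its conditional law under the Gibbs measure given the other
  spins, by means of a uniform variable \<open>u\<close>.\<close>

definition resample ::
  "real \<Rightarrow> nat \<Rightarrow> (nat \<times> nat \<Rightarrow> real) \<Rightarrow> nat \<Rightarrow> real \<Rightarrow> (nat \<Rightarrow> real) \<Rightarrow> nat \<Rightarrow> real" where
  "resample \<beta> N J v u \<sigma> =
     \<sigma>(v := if u \<le> measure_pmf.prob
                   (cond_pmf (gibbs \<beta> N J) {\<tau>. \<forall>w\<in>{1..N} - {v}. \<tau> w = \<sigma> w}) {\<tau>. \<tau> v = 1}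
            then 1 else - 1)"

text \<open>The randomness of the dynamics consists of independent components
  \<^item> \<open>\<sigma>\<^sub>0\<close>, the initial configuration, uniform on the hypercube;
  \<^item> \<open>\<xi> (v, k)\<close>, the gap before ring number \<open>k\<close> (counted from 0) of the clock at \<open>v\<close>; i.i.d. standard
    exponential gaps make each clock a rate-1 Poisson process;
  \<^item> \<open>U (v, k)\<close>, the uniform variable used for the resampling at that ring.\<close>

type_synonym driving =
  "(nat \<Rightarrow> real) \<times> (nat \<times> nat \<Rightarrow> real) \<times> (nat \<times> nat \<Rightarrow> real)"

definition driving_measure :: "nat \<Rightarrow> driving measure" where
  "driving_measure N =
     uniform_count_measure (spins N) \<Otimes>\<^sub>M
     (\<Pi>\<^sub>M vk\<in>{1..N} \<times> UNIV. density lborel (\<lambda>x. ennreal (exponential_density 1 x))) \<Otimes>\<^sub>M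
     (\<Pi>\<^sub>M vk\<in>{1..N} \<times> UNIV. uniform_measure lborel {0..1})"

definition ring_time :: "(nat \<times> nat \<Rightarrow> real) \<Rightarrow> nat \<times> nat \<Rightarrow> real" where
  "ring_time \<xi> = (\<lambda>(v, k). \<Sum>l\<le>k. \<xi> (v, l))"

text \<open>\<open>X(t)\<close>: perform the resamplings of all rings up to time \<open>t\<close> in chronological order.  Almost
  surely there are finitely many of them and their times are distinct.\<close>

definition glauber ::
  "real \<Rightarrow> nat \<Rightarrow> (nat \<times> nat \<Rightarrow> real) \<Rightarrow> driving \<Rightarrow> real \<Rightarrow> nat \<Rightarrow> real" where
  "glauber \<beta> N J = (\<lambda>(\<sigma>\<^sub>0, \<xi>, U) t.
     fold (\<lambda>(v, k). resample \<beta> N J v (U (v, k)))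
       (sorted_key_list_of_set (ring_time \<xi>) {vk \<in> {1..N} \<times> UNIV. ring_time \<xi> vk \<le> t})
       \<sigma>\<^sub>0)"

definition overlap :: "nat \<Rightarrow> (nat \<Rightarrow> real) \<Rightarrow> (nat \<Rightarrow> real) \<Rightarrow> real" where
  "overlap N \<sigma> \<sigma>' = 1 / real N * (\<Sum>v\<in>{1..N}. \<sigma> v * \<sigma>' v)"

definition correlation_law ::
  "real \<Rightarrow> nat \<Rightarrow> (nat \<times> nat \<Rightarrow> real) \<Rightarrow> real \<Rightarrow> real \<Rightarrow> real measure" where
  "correlation_law \<beta> N J t t' =
     distr (driving_measure N) borel (\<lambda>\<omega>. overlap N (glauber \<beta> N J \<omega> t) (glauber \<beta> N J \<omega> t'))"

section \<open>Metastable wells\<close>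

definition time_scale :: "real \<Rightarrow> real \<Rightarrow> nat \<Rightarrow> real" where
  "time_scale a \<gamma> N = exp (a * real N powr \<gamma>)"

definition heavy_edges ::
  "real \<Rightarrow> real \<Rightarrow> real \<Rightarrow> nat \<Rightarrow> (nat \<times> nat \<Rightarrow> real) \<Rightarrow> (nat \<times> nat) set" where
  "heavy_edges \<beta> a \<gamma> N J = {(i, j) \<in> pairs N. \<bar>J (i, j)\<bar> \<ge> a / (2 * \<beta>) * real N powr \<gamma>}"

definition vertex_disjoint :: "(nat \<times> nat) set \<Rightarrow> bool" where
  "vertex_disjoint E \<longleftrightarrow>
     (\<forall>(i, j)\<in>E. \<forall>(k, l)\<in>E. (i, j) \<noteq> (k, l) \<longrightarrow> {i, j} \<inter> {k, l} = {})"

definition satisfied :: "nat \<Rightarrow> (nat \<times> nat \<Rightarrow> real) \<Rightarrow> (nat \<Rightarrow> real) \<Rightarrow> (nat \<times> nat) set" where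
  "satisfied N J \<sigma> = {(i, j) \<in> pairs N. \<sigma> i * \<sigma> j = sgn (J (i, j))}"

definition hypercube_components :: "nat \<Rightarrow> (nat \<Rightarrow> real) set \<Rightarrow> (nat \<Rightarrow> real) set set" where
  "hypercube_components N S =
     S // {(\<sigma>, \<tau>). \<sigma> \<in> S \<and> \<tau> \<in> S \<and> card {v \<in> {1..N}. \<sigma> v \<noteq> \<tau> v} = 1}\<^sup>*"

definition wells ::
  "real \<Rightarrow> real \<Rightarrow> real \<Rightarrow> nat \<Rightarrow> (nat \<times> nat \<Rightarrow> real) \<Rightarrow> (nat \<Rightarrow> real) set set" where
  "wells \<beta> a \<gamma> N J =
     hypercube_components N {\<sigma> \<in> spins N. heavy_edges \<beta> a \<gamma> N J \<subseteq> satisfied N J \<sigma>}"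

definition well_overlap_law ::
  "real \<Rightarrow> real \<Rightarrow> real \<Rightarrow> nat \<Rightarrow> (nat \<times> nat \<Rightarrow> real) \<Rightarrow> real measure" where
  "well_overlap_law \<beta> a \<gamma> N J =
     distr
       (measure_pmf
         (bind_pmf (pmf_of_set (wells \<beta> a \<gamma> N J))
           (\<lambda>C. pair_pmf (cond_pmf (gibbs \<beta> N J) C) (cond_pmf (gibbs \<beta> N J) C))))
       borel (\<lambda>(\<sigma>, \<sigma>'). overlap N \<sigma> \<sigma>')"

text \<open>Intended for probability measures with the same sigma-algebra.\<close>

definition tv_dist :: "'a measure \<Rightarrow> 'a measure \<Rightarrow> real" where
  "tv_dist \<mu> \<nu> = (SUP B\<in>sets \<mu>. \<bar>measure \<mu> B - measure \<nu> B\<bar>)"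

end

theory Submission imports Defs "HOL-Real_Asymp.Real_Asymp" begin

text \<open>Once the clocks are given, the order of the updates is deterministic, so the joint law of
  \<open>X t\<close> and \<open>X (s t)\<close> is a product of heat bath projections averaged over the clocks. The heavy
  couplings are satisfied after the first sweep and, with high probability, none of them is violated
  at a later update before time \<open>s t\<close>. The well that is reached is therefore a function of the
  initial configuration, and by gauge symmetry it is uniform.

  Within a well, the medium couplings are vertex-disjoint and give a product measure. All remaining
  couplings together sum to at most \<open>N\<close> to a power \<open>\<kappa>\<close>, so they change its Poincare constant by a
  factor \<open>exp (O(N powr \<kappa>))\<close>. This loss is absorbed because, for some \<open>g > \<kappa>\<close>, no coupling lies within
  \<open>N powr g\<close> of the threshold: the medium couplings relax in a time shorter than the time scale by the
  factor \<open>exp (- 2 \<beta> N powr g)\<close>, and the heavy ones hold longer by the inverse factor. A Poincare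
  inequality makes every sweep of heat bath projections contract the variance, hence both
  configurations are nearly independent samples from the well.\<close>

section \<open>Sweeps of projections\<close>

text \<open>Once the clocks are fixed, the chain is a time-inhomogeneous product of updates, so the
  spectral theory of one reversible generator does not apply to it. What remains is that every
  update is a conditional expectation, hence an orthogonal projection: the norm lost during a sweep
  controls the residual of each single update, and the Poincare inequality turns this into a
  definite relative loss per sweep.

  Two devices keep this argument clean. First, the true updates are replaced by
  \<open>settled_bath\<close>, where heavy edges are satisfied by decree. Inside a well this
  dynamics is exactly reversible for the conditional Gibbs measure, so no leakage has to be tracked
  in mean square. Second, a mean square bound is made pointwise at the price of the inverse of the
  smallest Gibbs weight in the well, the exponential of a power of N. This is affordable because
  exp(h), up to powers of N, relaxation times pass, with h = 2 \<beta> (N^g - N^\<kappa>), and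
  exp(h) outgrows every power of N. For the same reason all polynomial factors in the Poincare
  constant are lost freely.\<close>

definition sq_norm :: "'a set \<Rightarrow> ('a \<Rightarrow> real) \<Rightarrow> ('a \<Rightarrow> real) \<Rightarrow> real" where
  "sq_norm C w f = (\<Sum>x\<in>C. w x * (f x)\<^sup>2)"

lemma square_add_le:
  fixes a b t :: real
  assumes "t > 0"
  shows "(a + b)\<^sup>2 \<le> (1 + 1 / t) * a\<^sup>2 + (1 + t) * b\<^sup>2"
proof -
  have "(1 + 1 / t) * a\<^sup>2 + (1 + t) * b\<^sup>2 - (a + b)\<^sup>2 = (a - t * b)\<^sup>2 / t"
    using assms by (simp add: field_simps power2_eq_square)
  moreover have "(a - t * b)\<^sup>2 / t \<ge> 0" using assms by simp
  ultimately show ?thesis by linarith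
qed

lemma sq_norm_nonneg: "(\<And>x. x \<in> C \<Longrightarrow> w x \<ge> 0) \<Longrightarrow> sq_norm C w f \<ge> 0"
  unfolding sq_norm_def by (intro sum_nonneg) auto

lemma sq_norm_add_le:
  assumes "t > 0" "\<And>x. x \<in> C \<Longrightarrow> w x \<ge> 0" "\<And>x. x \<in> C \<Longrightarrow> h x = f x + g x"
  shows "sq_norm C w h \<le> (1 + 1 / t) * sq_norm C w f + (1 + t) * sq_norm C w g"
proof -
  have "sq_norm C w h \<le> (\<Sum>x\<in>C. w x * ((1 + 1 / t) * (f x)\<^sup>2 + (1 + t) * (g x)\<^sup>2))"
    unfolding sq_norm_def
    by (intro sum_mono mult_left_mono) (use assms square_add_le in auto)
  also have "\<dots> = (1 + 1 / t) * sq_norm C w f + (1 + t) * sq_norm C w g"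
    unfolding sq_norm_def sum_distrib_left by (simp add: sum.distrib[symmetric] algebra_simps)
  finally show ?thesis .
qed

text \<open>The induction step of Cauchy--Schwarz for a sum of \<open>n + 1\<close> increments: with
  \<open>t = n\<close> in \<open>square_add_le\<close>, the bound \<open>n * A\<close> for the first
  \<open>n\<close> increments becomes \<open>(n + 1) * A\<close>, and the last increment enters with
  the same factor. The case \<open>n = 0\<close> is separate because of
  \<open>1 / n\<close>.\<close>

lemma telescoped_bound_step:
  fixes n A B X Y Z :: real
  assumes "n \<ge> 0" "A \<ge> 0" "X \<le> n * A" "n = 0 \<Longrightarrow> Z \<le> Y"
    and "n > 0 \<Longrightarrow> Z \<le> (1 + 1 / n) * X + (1 + n) * Y" "Y \<le> B"
  shows "Z \<le> (n + 1) * (A + B)"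
proof (cases "n = 0")
  case True
  then show ?thesis using assms by auto
next
  case False
  then have n: "n > 0" using assms by simp
  have "(1 + 1 / n) * X \<le> (1 + 1 / n) * (n * A)"
    using n assms by (intro mult_left_mono) auto
  also have "\<dots> = (n + 1) * A" using n by (simp add: field_simps)
  finally have "(1 + 1 / n) * X \<le> (n + 1) * A" .
  moreover have "(1 + n) * Y \<le> (1 + n) * B" using n assms by (intro mult_left_mono) auto
  ultimately show ?thesis using assms(5)[OF n] by (simp add: algebra_simps)
qed

text \<open>An orthogonal projection enters only through Pythagoras and compatibility with
  differences. The identity qualifies as well, which lets frozen sites take part in a sweep.\<close>

locale projections =
  fixes C :: "'a set" and w :: "'a \<Rightarrow> real" and V :: "'v set"
    and T :: "'v \<Rightarrow> ('a \<Rightarrow> real) \<Rightarrow> 'a \<Rightarrow> real"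
  assumes finite_V: "finite V"
    and w_nonneg: "\<And>x. x \<in> C \<Longrightarrow> w x \<ge> 0"
    and pythagoras: "\<And>v f. v \<in> V \<Longrightarrow>
      sq_norm C w f = sq_norm C w (T v f) + sq_norm C w (\<lambda>x. f x - T v f x)"
    and T_diff: "\<And>v f g x. v \<in> V \<Longrightarrow> x \<in> C \<Longrightarrow> T v (\<lambda>y. f y - g y) x = T v f x - T v g x"
begin

abbreviation "sq \<equiv> sq_norm C w"

lemma sq_nonneg: "sq f \<ge> 0"
  using sq_norm_nonneg w_nonneg by blast

lemma sq_residual_le: "v \<in> V \<Longrightarrow> sq (\<lambda>x. f x - T v f x) \<le> sq f"
  using pythagoras[of v f] sq_nonneg[of "T v f"] by linarith

lemma sq_foldr_le: "set l \<subseteq> V \<Longrightarrow> sq (foldr T l f) \<le> sq f"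
proof (induction l)
  case (Cons v l)
  then have "sq (T v (foldr T l f)) \<le> sq (foldr T l f)"
    using pythagoras[of v "foldr T l f"] sq_nonneg by (metis le_add_same_cancel1 list.set_intros(1) subsetD)
  then show ?case using Cons by auto
qed simp

text \<open>By Pythagoras the squared length of each increment is exactly the norm lost at that
  step, and these losses telescope. Cauchy--Schwarz over the increments contributes the factor
  \<open>length l\<close>.\<close>

lemma sq_diff_foldr_le:
  "set l \<subseteq> V \<Longrightarrow> sq (\<lambda>x. f x - foldr T l f x) \<le> real (length l) * (sq f - sq (foldr T l f))"
proof (induction l)
  case Nil
  then show ?case by (simp add: sq_norm_def)
next
  case (Cons v l)
  define g where "g = foldr T l f"
  have IH: "sq (\<lambda>x. f x - g x) \<le> real (length l) * (sq f - sq g)"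
    using Cons unfolding g_def by auto
  have v: "v \<in> V" and l: "set l \<subseteq> V" using Cons.prems by auto
  have Y: "sq (\<lambda>x. g x - T v g x) = sq g - sq (T v g)"
    using pythagoras[OF v, of g] by simp
  have "sq (\<lambda>x. f x - T v g x) \<le> (real (length l) + 1) * ((sq f - sq g) + (sq g - sq (T v g)))"
  proof (rule telescoped_bound_step[where X = "sq (\<lambda>x. f x - g x)" and Y = "sq (\<lambda>x. g x - T v g x)"])
    show "0 \<le> sq f - sq g" using sq_foldr_le[OF l, of f] g_def by simp
    show "sq (\<lambda>x. f x - T v g x) \<le> sq (\<lambda>x. g x - T v g x)" if "real (length l) = 0"
      using that by (simp add: g_def)
    show "sq (\<lambda>x. f x - T v g x) \<le> (1 + 1 / real (length l)) * sq (\<lambda>x. f x - g x)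
        + (1 + real (length l)) * sq (\<lambda>x. g x - T v g x)" if "0 < real (length l)"
      using that by (intro sq_norm_add_le) (auto simp: w_nonneg)
  qed (use IH Y in auto)
  then show ?case by (simp add: g_def algebra_simps)
qed

text \<open>Let \<open>g\<close> be the function just before the projection at \<open>v\<close>
  acts. The residual of \<open>f\<close> is the residual of \<open>f - g\<close> plus that of
  \<open>g\<close>: the former is at most the displacement from \<open>f\<close> to
  \<open>g\<close>, paid for by the losses so far, and the latter is the loss of the step itself.
  Since \<open>foldr\<close> works from the right, the steps before \<open>v\<close> are those of
  \<open>l2\<close>.\<close>

lemma sq_residual_le_loss:
  assumes "set l \<subseteq> V" "v \<in> set l"
  shows "sq (\<lambda>x. f x - T v f x) \<le> real (length l) * (sq f - sq (foldr T l f))"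
proof -
  obtain l1 l2 where l: "l = l1 @ v # l2" using assms(2) by (meson split_list)
  have v: "v \<in> V" and l1: "set l1 \<subseteq> V" and l2: "set l2 \<subseteq> V" using assms l by auto
  define g where "g = foldr T l2 f"
  have Y: "sq (\<lambda>x. g x - T v g x) = sq g - sq (T v g)"
    using pythagoras[OF v, of g] by simp
  have gf: "sq g \<le> sq f" using sq_foldr_le[OF l2, of f] g_def by simp
  have X: "sq (\<lambda>x. f x - g x - T v (\<lambda>x. f x - g x) x) \<le> real (length l2) * (sq f - sq g)"
    using sq_residual_le[OF v, of "\<lambda>x. f x - g x"] sq_diff_foldr_le[OF l2, of f] g_def by simp
  have "sq (\<lambda>x. f x - T v f x) \<le> (real (length l2) + 1) * ((sq f - sq g) + (sq g - sq (T v g)))"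
  proof (rule telescoped_bound_step[where X = "sq (\<lambda>x. f x - g x - T v (\<lambda>x. f x - g x) x)"
        and Y = "sq (\<lambda>x. g x - T v g x)"])
    show "sq (\<lambda>x. f x - T v f x) \<le> sq (\<lambda>x. g x - T v g x)" if "real (length l2) = 0"
      using that by (simp add: g_def)
    show "sq (\<lambda>x. f x - T v f x) \<le> (1 + 1 / real (length l2)) *
        sq (\<lambda>x. f x - g x - T v (\<lambda>x. f x - g x) x)
        + (1 + real (length l2)) * sq (\<lambda>x. g x - T v g x)" if "0 < real (length l2)"
      using that by (intro sq_norm_add_le) (auto simp: w_nonneg T_diff v)
  qed (use X Y gf in auto)
  also have "\<dots> = (real (length l2) + 1) * (sq f - sq (T v g))" by simp
  also have "\<dots> \<le> (real (length l2) + 1) * (sq f - sq (foldr T l f))"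
    using sq_foldr_le[OF l1, of "T v g"] by (intro mult_left_mono) (auto simp: l g_def)
  also have "\<dots> \<le> real (length l) * (sq f - sq (foldr T l f))"
    using sq_foldr_le[OF assms(1), of f] by (intro mult_right_mono) (auto simp: l)
  finally show ?thesis .
qed

text \<open>The factor for one sweep of length \<open>n\<close> is \<open>1 - c / n\<close>; the tangent line
  \<open>1 / n \<ge> 2 / B - n / B\<^sup>2\<close> makes the product of these factors depend on the total length only.\<close>

lemma sq_foldr_blocks_le:
  assumes poincare: "\<And>g. P g \<Longrightarrow> sq g \<le> K * (\<Sum>v\<in>V. sq (\<lambda>x. g x - T v g x))"
    and P: "\<And>v g. v \<in> V \<Longrightarrow> P g \<Longrightarrow> P (T v g)" "P f"
    and "K > 0" "B > 0" "V \<noteq> {}"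
    and "\<And>l. l \<in> set ls \<Longrightarrow> set l = V"
  shows "sq (foldr T (concat ls) f) \<le>
    exp (- (2 * real (length ls) / B - real (length (concat ls)) / B\<^sup>2) / (K * real (card V))) * sq f
    \<and> P (foldr T (concat ls) f)"
  using assms(7)
proof (induction ls)
  case Nil
  then show ?case using P by simp
next
  case (Cons l ls)
  define g where "g = foldr T (concat ls) f"
  define c where "c = K * real (card V)"
  define n where "n = real (length l)"
  have card: "real (card V) > 0" using assms(6) finite_V by (simp add: card_gt_0_iff)
  have c: "c > 0" using card assms(4) by (simp add: c_def)
  have l: "set l = V" using Cons by auto
  then have n: "n > 0" using assms(6) by (auto simp: n_def)
  have IH: "sq g \<le> exp (- (2 * real (length ls) / B - real (length (concat ls)) / B\<^sup>2) / c) * sq f" "P g"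
    using Cons unfolding g_def c_def by auto
  have Pl: "P (foldr T l' g)" if "set l' \<subseteq> V" for l'
    using that IH(2) P(1) by (induction l') auto
  have "sq g \<le> K * (\<Sum>v\<in>V. n * (sq g - sq (foldr T l g)))"
    unfolding n_def
    by (rule order.trans[OF poincare[OF IH(2)]], intro mult_left_mono sum_mono sq_residual_le_loss)
       (use l assms(4) in auto)
  also have "\<dots> = c * n * (sq g - sq (foldr T l g))" by (simp add: c_def)
  finally have "sq (foldr T l g) \<le> (1 - 1 / (c * n)) * sq g"
    using c n by (simp add: field_simps)
  also have "\<dots> \<le> exp (- ((2 / B - n / B\<^sup>2) / c)) * sq g"
  proof (intro mult_right_mono sq_nonneg)
    have "2 / B - n / B\<^sup>2 \<le> 1 / n"
    proof -
      have "1 / n - (2 / B - n / B\<^sup>2) = (B - n)\<^sup>2 / (n * B\<^sup>2)"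
        using n \<open>B > 0\<close> by (simp add: field_simps power2_eq_square)
      moreover have "(B - n)\<^sup>2 / (n * B\<^sup>2) \<ge> 0" using n by simp
      ultimately show ?thesis by linarith
    qed
    then have "(2 / B - n / B\<^sup>2) / c \<le> (1 / n) / c"
      using c by (intro divide_right_mono) auto
    then have "1 - 1 / (c * n) \<le> 1 + (- ((2 / B - n / B\<^sup>2) / c))"
      by (simp add: mult.commute)
    also have "\<dots> \<le> exp (- ((2 / B - n / B\<^sup>2) / c))" by (rule exp_ge_add_one_self)
    finally show "1 - 1 / (c * n) \<le> exp (- ((2 / B - n / B\<^sup>2) / c))" .
  qed
  also have "\<dots> \<le> exp (- ((2 / B - n / B\<^sup>2) / c)) *
      (exp (- (2 * real (length ls) / B - real (length (concat ls)) / B\<^sup>2) / c) * sq f)"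
    using IH(1) by (intro mult_left_mono) auto
  also have "\<dots> = exp (- (2 * real (length (l # ls)) / B - real (length (concat (l # ls))) / B\<^sup>2) / c) * sq f"
    unfolding mult.assoc[symmetric] exp_add[symmetric] using c \<open>B > 0\<close>
    by (simp add: n_def field_simps)
  finally show ?case using Pl[of l] l by (simp add: g_def c_def)
qed

end

section \<open>Heat bath on subcubes\<close>

definition flip :: "nat \<Rightarrow> (nat \<Rightarrow> real) \<Rightarrow> nat \<Rightarrow> real" where
  "flip v \<sigma> = \<sigma>(v := - \<sigma> v)"

definition subcube :: "nat \<Rightarrow> nat set \<Rightarrow> (nat \<Rightarrow> real) \<Rightarrow> (nat \<Rightarrow> real) set" where
  "subcube N V \<omega> = {\<sigma> \<in> spins N. \<forall>v\<in>{1..N} - V. \<sigma> v = \<omega> v}"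

text \<open>The conditional expectation of \<open>f\<close> given all spins other than the one at
  \<open>v\<close>, for the measure proportional to \<open>w\<close>; hence an orthogonal projection
  for the inner product weighted by \<open>w\<close>.\<close>

definition heat_bath ::
  "((nat \<Rightarrow> real) \<Rightarrow> real) \<Rightarrow> nat \<Rightarrow> ((nat \<Rightarrow> real) \<Rightarrow> real) \<Rightarrow> (nat \<Rightarrow> real) \<Rightarrow> real" where
  "heat_bath w v f \<sigma> =
     (w (\<sigma>(v := 1)) * f (\<sigma>(v := 1)) + w (\<sigma>(v := -1)) * f (\<sigma>(v := -1))) /
     (w (\<sigma>(v := 1)) + w (\<sigma>(v := -1)))"

text \<open>If \<tau> is an independent copy of \<sigma> and the weight factorises over
  \<open>S\<close> and its complement, this is \<sigma> with the spins in \<open>S\<close>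
  redrawn.\<close>

definition hybrid :: "nat set \<Rightarrow> (nat \<Rightarrow> real) \<Rightarrow> (nat \<Rightarrow> real) \<Rightarrow> nat \<Rightarrow> real" where
  "hybrid S \<sigma> \<tau> = (\<lambda>v. if v \<in> S then \<tau> v else \<sigma> v)"

lemma spins_values: "\<sigma> \<in> spins N \<Longrightarrow> v \<in> {1..N} \<Longrightarrow> \<sigma> v = -1 \<or> \<sigma> v = 1"
  unfolding spins_def by (metis PiE_mem insertE singletonD)

lemma spins_square: "\<sigma> \<in> spins N \<Longrightarrow> v \<in> {1..N} \<Longrightarrow> \<sigma> v * \<sigma> v = 1"
  using spins_values[of \<sigma> N v] by auto

lemma spins_upd: "\<sigma> \<in> spins N \<Longrightarrow> v \<in> {1..N} \<Longrightarrow> x \<in> {-1, 1} \<Longrightarrow> \<sigma>(v := x) \<in> spins N"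
  unfolding spins_def by (auto simp: PiE_iff extensional_def)

lemma spins_ext: "\<sigma> \<in> spins N \<Longrightarrow> \<tau> \<in> spins N \<Longrightarrow> (\<And>v. v \<in> {1..N} \<Longrightarrow> \<sigma> v = \<tau> v) \<Longrightarrow> \<sigma> = \<tau>"
  unfolding spins_def by (rule PiE_ext)

lemma finite_subcube [simp]: "finite (subcube N V \<omega>)"
  unfolding subcube_def using finite_spins by auto

lemma subcube_upd:
  "V \<subseteq> {1..N} \<Longrightarrow> \<sigma> \<in> subcube N V \<omega> \<Longrightarrow> v \<in> V \<Longrightarrow> x \<in> {-1, 1} \<Longrightarrow> \<sigma>(v := x) \<in> subcube N V \<omega>"
  unfolding subcube_def using spins_upd[of \<sigma> N v x] by auto

lemma flip_flip [simp]: "flip v (flip v \<sigma>) = \<sigma>"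
  by (auto simp: flip_def)

lemma flip_in_subcube:
  "V \<subseteq> {1..N} \<Longrightarrow> \<sigma> \<in> subcube N V \<omega> \<Longrightarrow> v \<in> V \<Longrightarrow> flip v \<sigma> \<in> subcube N V \<omega>"
  using spins_values[of \<sigma> N v] unfolding flip_def
  by (intro subcube_upd) (auto simp: subcube_def)

lemma sum_flip:
  assumes "V \<subseteq> {1..N}" "v \<in> V"
  shows "(\<Sum>\<sigma>\<in>subcube N V \<omega>. F (flip v \<sigma>)) = (\<Sum>\<sigma>\<in>subcube N V \<omega>. F \<sigma>)"
  by (rule sum.reindex_bij_witness[of _ "flip v" "flip v"]) (use assms flip_in_subcube in auto)

lemma heat_bath_flip:
  assumes "\<sigma> v = -1 \<or> \<sigma> v = 1"
  shows "heat_bath w v f \<sigma> = (w \<sigma> * f \<sigma> + w (flip v \<sigma>) * f (flip v \<sigma>)) / (w \<sigma> + w (flip v \<sigma>))"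
  using assms
proof
  assume "\<sigma> v = -1"
  then have "\<sigma>(v := -1) = \<sigma>" "\<sigma>(v := 1) = flip v \<sigma>" by (auto simp: flip_def)
  then show ?thesis by (simp add: heat_bath_def add.commute)
next
  assume "\<sigma> v = 1"
  then have "\<sigma>(v := 1) = \<sigma>" "\<sigma>(v := -1) = flip v \<sigma>" by (auto simp: flip_def)
  then show ?thesis by (simp add: heat_bath_def)
qed

locale weighted_subcube =
  fixes N :: nat and V :: "nat set" and \<omega> :: "nat \<Rightarrow> real" and w :: "(nat \<Rightarrow> real) \<Rightarrow> real"
  assumes V: "V \<subseteq> {1..N}" and w_pos: "\<And>\<sigma>. w \<sigma> > 0"
begin

abbreviation "C \<equiv> subcube N V \<omega>"

lemma spin_cases: "\<sigma> \<in> C \<Longrightarrow> v \<in> V \<Longrightarrow> \<sigma> v = -1 \<or> \<sigma> v = 1"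
  using V spins_values[of \<sigma> N v] by (auto simp: subcube_def)

text \<open>Reduces identities between sums over the subcube to identities on the pairs formed by
  \<sigma> and \<open>flip v \<sigma>\<close>, on each of which \<open>heat_bath w v f\<close> is
  constant.\<close>

lemma sum_symmetrize:
  assumes "v \<in> V"
  shows "(\<Sum>\<sigma>\<in>C. F \<sigma> :: real) = (\<Sum>\<sigma>\<in>C. F \<sigma> + F (flip v \<sigma>)) / 2"
  by (simp add: sum.distrib sum_flip[OF V assms])

lemma heat_bath_flip_invariant:
  assumes "\<sigma> \<in> C" "v \<in> V"
  shows "heat_bath w v f (flip v \<sigma>) = heat_bath w v f \<sigma>"
  by (simp add: heat_bath_def flip_def)

lemma heat_bath_eq:
  assumes "\<sigma> \<in> C" "v \<in> V"
  shows "heat_bath w v f \<sigma> = (w \<sigma> * f \<sigma> + w (flip v \<sigma>) * f (flip v \<sigma>)) / (w \<sigma> + w (flip v \<sigma>))"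
  by (rule heat_bath_flip) (rule spin_cases[OF assms])

lemma sum_heat_bath:
  assumes "v \<in> V"
  shows "(\<Sum>\<sigma>\<in>C. w \<sigma> * heat_bath w v f \<sigma>) = (\<Sum>\<sigma>\<in>C. w \<sigma> * f \<sigma>)"
proof -
  have "w \<sigma> * heat_bath w v f \<sigma> + w (flip v \<sigma>) * heat_bath w v f (flip v \<sigma>) =
     w \<sigma> * f \<sigma> + w (flip v \<sigma>) * f (flip v \<sigma>)" if "\<sigma> \<in> C" for \<sigma>
  proof -
    have D: "w \<sigma> + w (flip v \<sigma>) > 0" by (simp add: add_pos_pos w_pos)
    have "d * (x / d) = x" if "d > 0" for d x :: real using that by simp
    from this[OF D] have "(w \<sigma> + w (flip v \<sigma>)) * heat_bath w v f \<sigma> = w \<sigma> * f \<sigma> + w (flip v \<sigma>) * f (flip v \<sigma>)"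
      by (simp only: heat_bath_eq[OF that assms])
    then show ?thesis
      by (subst heat_bath_flip_invariant[OF that assms]) (simp only: distrib_right)
  qed
  then show ?thesis
    unfolding sum_symmetrize[OF assms, of "\<lambda>\<sigma>. w \<sigma> * heat_bath w v f \<sigma>"]
      sum_symmetrize[OF assms, of "\<lambda>\<sigma>. w \<sigma> * f \<sigma>"]
    by (intro arg_cong[where f = "\<lambda>x. x / 2"] sum.cong refl)
qed

lemma heat_bath_pythagoras:
  assumes "v \<in> V"
  shows "sq_norm C w f = sq_norm C w (heat_bath w v f) + sq_norm C w (\<lambda>\<sigma>. f \<sigma> - heat_bath w v f \<sigma>)"
proof -
  have "w \<sigma> * (f \<sigma>)\<^sup>2 + w (flip v \<sigma>) * (f (flip v \<sigma>))\<^sup>2 =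
      (w \<sigma> * (heat_bath w v f \<sigma>)\<^sup>2 + w (flip v \<sigma>) * (heat_bath w v f (flip v \<sigma>))\<^sup>2) +
      (w \<sigma> * (f \<sigma> - heat_bath w v f \<sigma>)\<^sup>2 + w (flip v \<sigma>) * (f (flip v \<sigma>) - heat_bath w v f (flip v \<sigma>))\<^sup>2)"
    if "\<sigma> \<in> C" for \<sigma>
  proof -
    define a b x y where "a = w \<sigma>" "b = w (flip v \<sigma>)" "x = f \<sigma>" "y = f (flip v \<sigma>)"
    define m where "m = (a * x + b * y) / (a + b)"
    have "a + b > 0" by (simp add: add_pos_pos a_b_x_y_def w_pos)
    then have m: "m * (a + b) = a * x + b * y" by (simp add: m_def)
    \<comment> \<open>The defect in Pythagoras is a multiple of the equation that defines the
      weighted mean \<open>m\<close>.\<close>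
    have "a * x\<^sup>2 + b * y\<^sup>2 - ((a * m\<^sup>2 + b * m\<^sup>2) + (a * (x - m)\<^sup>2 + b * (y - m)\<^sup>2)) =
        2 * m * ((a * x + b * y) - m * (a + b))"
      by (simp add: power2_eq_square algebra_simps)
    then have "a * x\<^sup>2 + b * y\<^sup>2 = (a * m\<^sup>2 + b * m\<^sup>2) + (a * (x - m)\<^sup>2 + b * (y - m)\<^sup>2)"
      using m by simp
    then show ?thesis
      unfolding heat_bath_flip_invariant[OF that assms] heat_bath_eq[OF that assms]
      by (simp add: a_b_x_y_def m_def)
  qed
  then show ?thesis
    unfolding sq_norm_def sum_symmetrize[OF assms, of "\<lambda>\<sigma>. w \<sigma> * (f \<sigma>)\<^sup>2"]
      sum_symmetrize[OF assms, of "\<lambda>\<sigma>. w \<sigma> * (heat_bath w v f \<sigma>)\<^sup>2"]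
      sum_symmetrize[OF assms, of "\<lambda>\<sigma>. w \<sigma> * (f \<sigma> - heat_bath w v f \<sigma>)\<^sup>2"]
      add_divide_distrib[symmetric] sum.distrib[symmetric]
    by (intro arg_cong[where f = "\<lambda>x. x / 2"] sum.cong refl)
qed

text \<open>The exact conductance of a pair with weights \<open>x\<close> and \<open>y\<close> is
  \<open>x * y / (x + y)\<close>, which lies between half of \<open>min x y\<close> and
  \<open>min x y\<close>. The minimum passes directly through a one-sided bound of one weight by
  another, as required in \<open>poincare_comparable\<close>.\<close>

definition dirichlet :: "nat \<Rightarrow> ((nat \<Rightarrow> real) \<Rightarrow> real) \<Rightarrow> real" where
  "dirichlet v f = (\<Sum>\<sigma>\<in>C. min (w \<sigma>) (w (flip v \<sigma>)) * (f \<sigma> - f (flip v \<sigma>))\<^sup>2)"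

lemma dirichlet_nonneg: "dirichlet v f \<ge> 0"
  unfolding dirichlet_def using w_pos by (intro sum_nonneg mult_nonneg_nonneg) (auto simp: less_imp_le)

lemma dirichlet_le_residual:
  assumes "v \<in> V"
  shows "dirichlet v f \<le> 4 * sq_norm C w (\<lambda>\<sigma>. f \<sigma> - heat_bath w v f \<sigma>)"
proof -
  have "min (w \<sigma>) (w (flip v \<sigma>)) * (f \<sigma> - f (flip v \<sigma>))\<^sup>2 \<le>
     2 * (w \<sigma> * (f \<sigma> - heat_bath w v f \<sigma>)\<^sup>2 +
       w (flip v \<sigma>) * (f (flip v \<sigma>) - heat_bath w v f (flip v \<sigma>))\<^sup>2)"
    if "\<sigma> \<in> C" for \<sigma>
  proof -
    define a b m where "a = f \<sigma>" "b = f (flip v \<sigma>)" "m = heat_bath w v f \<sigma>"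
    define c where "c = min (w \<sigma>) (w (flip v \<sigma>))"
    have "c > 0" using w_pos by (simp add: c_def)
    have "(a - b)\<^sup>2 \<le> 2 * (a - m)\<^sup>2 + 2 * (b - m)\<^sup>2"
      using square_add_le[of 1 "a - m" "m - b"] by (simp add: power2_commute)
    then have "c * (a - b)\<^sup>2 \<le> c * (2 * (a - m)\<^sup>2 + 2 * (b - m)\<^sup>2)"
      using \<open>c > 0\<close> by (intro mult_left_mono) auto
    also have "\<dots> = 2 * (c * (a - m)\<^sup>2 + c * (b - m)\<^sup>2)" by (simp add: algebra_simps)
    also have "\<dots> \<le> 2 * (w \<sigma> * (a - m)\<^sup>2 + w (flip v \<sigma>) * (b - m)\<^sup>2)"
      by (intro mult_left_mono add_mono mult_right_mono) (auto simp: c_def)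
    finally show ?thesis
      unfolding heat_bath_flip_invariant[OF that assms] by (simp add: a_b_m_def c_def)
  qed
  then have "dirichlet v f \<le> (\<Sum>\<sigma>\<in>C. 2 * (w \<sigma> * (f \<sigma> - heat_bath w v f \<sigma>)\<^sup>2 +
       w (flip v \<sigma>) * (f (flip v \<sigma>) - heat_bath w v f (flip v \<sigma>))\<^sup>2))"
    unfolding dirichlet_def by (intro sum_mono) auto
  also have "\<dots> = 4 * sq_norm C w (\<lambda>\<sigma>. f \<sigma> - heat_bath w v f \<sigma>)"
    unfolding sq_norm_def sum_symmetrize[OF assms, of "\<lambda>\<sigma>. w \<sigma> * (f \<sigma> - heat_bath w v f \<sigma>)\<^sup>2"]
      sum_distrib_left[symmetric] by simp
  finally show ?thesis .
qed

end

text \<open>Exchanging the \<open>S\<close>-parts of two copies is an involution of the pairs of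
  configurations, and by assumption it preserves the product weight.\<close>

lemma sum_hybrid_swap:
  assumes "\<And>\<sigma> \<tau>. \<sigma> \<in> subcube N V \<omega> \<Longrightarrow> \<tau> \<in> subcube N V \<omega> \<Longrightarrow>
      w (hybrid S \<sigma> \<tau>) * w (hybrid S \<tau> \<sigma>) = w \<sigma> * w \<tau>"
  shows "(\<Sum>\<sigma>\<in>subcube N V \<omega>. \<Sum>\<tau>\<in>subcube N V \<omega>. w \<sigma> * w \<tau> * F (hybrid S \<sigma> \<tau>) (hybrid S \<tau> \<sigma>))
       = (\<Sum>\<sigma>\<in>subcube N V \<omega>. \<Sum>\<tau>\<in>subcube N V \<omega>. w \<sigma> * w \<tau> * F \<sigma> (\<tau>::nat \<Rightarrow> real) :: real)"
proof -
  have H: "hybrid S \<sigma> \<tau> \<in> subcube N V \<omega>" if "\<sigma> \<in> subcube N V \<omega>" "\<tau> \<in> subcube N V \<omega>" for \<sigma> \<tau>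
    using that unfolding subcube_def spins_def hybrid_def by (auto simp: PiE_iff extensional_def)
  have HH: "hybrid S (hybrid S \<sigma> \<tau>) (hybrid S \<tau> \<sigma>) = \<sigma>" for \<sigma> \<tau> :: "nat \<Rightarrow> real"
    by (auto simp: hybrid_def)
  show ?thesis unfolding sum.cartesian_product
    by (rule sum.reindex_bij_witness[of _ "\<lambda>(\<sigma>, \<tau>). (hybrid S \<sigma> \<tau>, hybrid S \<tau> \<sigma>)"
          "\<lambda>(\<sigma>, \<tau>). (hybrid S \<sigma> \<tau>, hybrid S \<tau> \<sigma>)"])
       (auto simp: H HH assms)
qed

lemma hybrid_in_subcube:
  "\<sigma> \<in> subcube N V \<omega> \<Longrightarrow> \<tau> \<in> subcube N V \<omega> \<Longrightarrow> hybrid S \<sigma> \<tau> \<in> subcube N V \<omega>"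
  unfolding subcube_def spins_def hybrid_def by (auto simp: PiE_iff extensional_def)

section \<open>Poincare inequality for weights that factorise over blocks of one or two
  sites\<close>

definition verts :: "(nat \<times> nat) set \<Rightarrow> nat set" where
  "verts E = (\<Union>(i, j)\<in>E. {i, j})"

lemma verts_insert: "verts (insert p E) = {fst p, snd p} \<union> verts E"
  by (auto simp: verts_def split: prod.splits)

lemma verts_iff: "v \<in> verts E \<longleftrightarrow> (\<exists>e\<in>E. v = fst e \<or> v = snd e)"
  by (auto simp: verts_def case_prod_unfold)

lemma vertex_disjointI:
  "(\<And>p q. p \<in> E \<Longrightarrow> q \<in> E \<Longrightarrow> p \<noteq> q \<Longrightarrow> {fst p, snd p} \<inter> {fst q, snd q} = {}) \<Longrightarrow> vertex_disjoint E"
  unfolding vertex_disjoint_def by fastforce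

lemma vertex_disjointD:
  assumes "vertex_disjoint E" "p \<in> E" "q \<in> E" "p \<noteq> q"
  shows "{fst p, snd p} \<inter> {fst q, snd q} = {}"
proof -
  obtain i j k l where "p = (i, j)" "q = (k, l)" by fastforce
  then show ?thesis using assms unfolding vertex_disjoint_def by auto
qed

lemma verts_empty [simp]: "verts {} = {}" by (simp add: verts_def)

text \<open>\<open>P\<close> is a partition of \<open>V\<close> into blocks of one or two sites, a singleton \<open>{v}\<close> being the
  pair \<open>(v, v)\<close>.\<close>

locale pair_weights = weighted_subcube N V \<omega> w for N V \<omega> w +
  fixes P :: "(nat \<times> nat) set" and R :: real
  assumes finite_P: "finite P" and disjoint: "vertex_disjoint P" and verts_P: "verts P = V"
    and product: "\<And>Q \<sigma> \<tau>. Q \<subseteq> P \<Longrightarrow> \<sigma> \<in> subcube N V \<omega> \<Longrightarrow> \<tau> \<in> subcube N V \<omega> \<Longrightarrow>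
      w (hybrid (verts Q) \<sigma> \<tau>) * w (hybrid (verts Q) \<tau> \<sigma>) = w \<sigma> * w \<tau>"
    and ratio: "\<And>p \<sigma> \<tau>. p \<in> P \<Longrightarrow> \<sigma> \<in> subcube N V \<omega> \<Longrightarrow> \<tau> \<in> subcube N V \<omega> \<Longrightarrow>
      (\<And>v. v \<noteq> fst p \<Longrightarrow> v \<noteq> snd p \<Longrightarrow> \<sigma> v = \<tau> v) \<Longrightarrow> w \<sigma> \<le> R * w \<tau>"
begin

text \<open>Up to normalisation, the mean squared change of \<open>f\<close> when the spins in
  \<open>S\<close> are redrawn. For \<open>S = V\<close> it is twice the variance.\<close>

definition resampling_cost :: "((nat \<Rightarrow> real) \<Rightarrow> real) \<Rightarrow> nat set \<Rightarrow> real" where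
  "resampling_cost f S = (\<Sum>\<sigma>\<in>C. \<Sum>\<tau>\<in>C. w \<sigma> * w \<tau> * (f \<sigma> - f (hybrid S \<sigma> \<tau>))\<^sup>2)"

text \<open>Setting the spin at \<open>i\<close> to \<open>x\<close> maps the subcube two-to-one
  onto the configurations with that value.\<close>

lemma sum_le_double:
  assumes "i \<in> V" "\<And>\<sigma>. G \<sigma> \<ge> (0::real)" "x \<in> {-1, 1}"
  shows "(\<Sum>\<sigma>\<in>C. G (\<sigma>(i := x))) \<le> 2 * (\<Sum>\<sigma>\<in>C. G \<sigma>)"
proof -
  have "(\<Sum>\<sigma>\<in>C. G (\<sigma>(i := x))) \<le> (\<Sum>\<sigma>\<in>C. G \<sigma> + G (flip i \<sigma>))"
  proof (rule sum_mono)
    fix \<sigma> assume "\<sigma> \<in> C"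
    then have "\<sigma> i = -1 \<or> \<sigma> i = 1" using spin_cases assms by auto
    then have "\<sigma>(i := x) = \<sigma> \<or> \<sigma>(i := x) = flip i \<sigma>"
      using assms(3) by (auto simp: flip_def fun_eq_iff)
    then show "G (\<sigma>(i := x)) \<le> G \<sigma> + G (flip i \<sigma>)"
      using assms(2)[of \<sigma>] assms(2)[of "flip i \<sigma>"] by auto
  qed
  also have "\<dots> = 2 * (\<Sum>\<sigma>\<in>C. G \<sigma>)"
    using sum_symmetrize[OF assms(1), of G] by simp
  finally show ?thesis .
qed

lemma upd_difference_le:
  fixes f :: "(nat \<Rightarrow> real) \<Rightarrow> real"
  assumes "\<sigma> \<in> C" "i \<in> V" "x \<in> {-1, 1}"
  shows "(f \<sigma> - f (\<sigma>(i := x)))\<^sup>2 \<le> (f \<sigma> - f (flip i \<sigma>))\<^sup>2"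
proof -
  have "\<sigma> i = -1 \<or> \<sigma> i = 1" using spin_cases assms by auto
  then have "\<sigma>(i := x) = \<sigma> \<or> \<sigma>(i := x) = flip i \<sigma>"
    using assms(3) by (auto simp: flip_def fun_eq_iff)
  then show ?thesis by auto
qed

text \<open>The block is changed one site at a time, so the change of \<open>f\<close> splits into
  two single flips. Within the block all weights agree up to the factor \<open>R\<close>, which
  allows \<open>w \<sigma>\<close> to be replaced by the weight carried by either flip. The constant
  is 2 from splitting the square times 2 from \<open>sum_le_double\<close>.\<close>

lemma local_cost_le:
  assumes p: "p \<in> P" and \<tau>: "\<tau> \<in> C"
  shows "(\<Sum>\<sigma>\<in>C. w \<sigma> * (f \<sigma> - f (hybrid {fst p, snd p} \<sigma> \<tau>))\<^sup>2)
    \<le> 4 * R * (dirichlet (fst p) f + dirichlet (snd p) f)"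
proof -
  obtain i j where ij: "p = (i, j)" by force
  have iV: "i \<in> V" and jV: "j \<in> V" using p ij verts_P by (auto simp: verts_def)
  have \<tau>i: "\<tau> i \<in> {-1, 1}" and \<tau>j: "\<tau> j \<in> {-1, 1}" using spin_cases \<tau> iV jV by auto
  define m where "m v \<sigma> = min (w \<sigma>) (w (flip v \<sigma>)) * (f \<sigma> - f (flip v \<sigma>))\<^sup>2" for v \<sigma>
  have m0: "m v \<sigma> \<ge> 0" for v \<sigma> using w_pos by (auto simp: m_def less_imp_le)
  have R: "R > 0"
  proof -
    have "w \<tau> \<le> R * w \<tau>" using ratio[OF p \<tau> \<tau>] by simp
    then show ?thesis using w_pos[of \<tau>] by (metis mult_le_cancel_right1 less_le_trans zero_less_one not_less)
  qed
  \<comment> \<open>Both ends of the flip at \<rho> agree with \<sigma> off the block, so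
    \<open>ratio\<close> applies to each of them and hence to their minimum.\<close>
  have weight: "w \<sigma> \<le> R * min (w \<rho>) (w (flip v \<rho>))"
    if "\<sigma> \<in> C" "\<rho> \<in> C" "v \<in> {i, j}" "\<And>u. u \<noteq> i \<Longrightarrow> u \<noteq> j \<Longrightarrow> \<sigma> u = \<rho> u" for \<sigma> \<rho> v
  proof -
    have "w \<sigma> \<le> R * w \<rho>" using ratio[OF p that(1,2)] that(4) ij by auto
    moreover have "w \<sigma> \<le> R * w (flip v \<rho>)"
      using ratio[OF p that(1) flip_in_subcube[OF V that(2)], of v] that(3,4) ij iV jV
      by (auto simp: flip_def)
    ultimately show ?thesis by (simp add: min_def)
  qed
  have "(\<Sum>\<sigma>\<in>C. w \<sigma> * (f \<sigma> - f (hybrid {fst p, snd p} \<sigma> \<tau>))\<^sup>2)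
      \<le> (\<Sum>\<sigma>\<in>C. 2 * R * m i \<sigma> + 2 * R * m j (\<sigma>(i := \<tau> i)))"
  proof (rule sum_mono)
    fix \<sigma> assume \<sigma>: "\<sigma> \<in> C"
    define \<sigma>' where "\<sigma>' = \<sigma>(i := \<tau> i)"
    have \<sigma>': "\<sigma>' \<in> C" unfolding \<sigma>'_def by (rule subcube_upd[OF V \<sigma> iV \<tau>i])
    have h: "hybrid {fst p, snd p} \<sigma> \<tau> = \<sigma>'(j := \<tau> j)"
      by (auto simp: hybrid_def ij \<sigma>'_def fun_eq_iff)
    have "(f \<sigma> - f (\<sigma>'(j := \<tau> j)))\<^sup>2 \<le> 2 * (f \<sigma> - f \<sigma>')\<^sup>2 + 2 * (f \<sigma>' - f (\<sigma>'(j := \<tau> j)))\<^sup>2"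
      using square_add_le[of 1 "f \<sigma> - f \<sigma>'" "f \<sigma>' - f (\<sigma>'(j := \<tau> j))"] by simp
    also have "\<dots> \<le> 2 * (f \<sigma> - f (flip i \<sigma>))\<^sup>2 + 2 * (f \<sigma>' - f (flip j \<sigma>'))\<^sup>2"
      using upd_difference_le[OF \<sigma> iV \<tau>i, of f] upd_difference_le[OF \<sigma>' jV \<tau>j, of f]
      by (simp add: \<sigma>'_def)
    finally have "w \<sigma> * (f \<sigma> - f (\<sigma>'(j := \<tau> j)))\<^sup>2
        \<le> w \<sigma> * (2 * (f \<sigma> - f (flip i \<sigma>))\<^sup>2 + 2 * (f \<sigma>' - f (flip j \<sigma>'))\<^sup>2)"
      using w_pos[of \<sigma>] by (intro mult_left_mono) auto
    also have "\<dots> = 2 * (w \<sigma> * (f \<sigma> - f (flip i \<sigma>))\<^sup>2) + 2 * (w \<sigma> * (f \<sigma>' - f (flip j \<sigma>'))\<^sup>2)"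
      by (simp add: algebra_simps)
    also have "\<dots> \<le> 2 * (R * min (w \<sigma>) (w (flip i \<sigma>)) * (f \<sigma> - f (flip i \<sigma>))\<^sup>2)
        + 2 * (R * min (w \<sigma>') (w (flip j \<sigma>')) * (f \<sigma>' - f (flip j \<sigma>'))\<^sup>2)"
      using weight[OF \<sigma> \<sigma>, of i] weight[OF \<sigma> \<sigma>', of j]
      by (intro add_mono mult_left_mono mult_right_mono) (auto simp: \<sigma>'_def)
    also have "\<dots> = 2 * R * m i \<sigma> + 2 * R * m j \<sigma>'" by (simp add: m_def algebra_simps)
    finally show "w \<sigma> * (f \<sigma> - f (hybrid {fst p, snd p} \<sigma> \<tau>))\<^sup>2 \<le> 2 * R * m i \<sigma> + 2 * R * m j (\<sigma>(i := \<tau> i))"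
      by (simp add: h \<sigma>'_def)
  qed
  also have "\<dots> = 2 * R * (\<Sum>\<sigma>\<in>C. m i \<sigma>) + 2 * R * (\<Sum>\<sigma>\<in>C. m j (\<sigma>(i := \<tau> i)))"
    by (simp add: sum.distrib sum_distrib_left)
  also have "\<dots> \<le> 2 * R * (\<Sum>\<sigma>\<in>C. m i \<sigma>) + 2 * R * (2 * (\<Sum>\<sigma>\<in>C. m j \<sigma>))"
    using R by (intro add_left_mono mult_left_mono sum_le_double[OF iV m0 \<tau>i]) auto
  also have "\<dots> \<le> 4 * R * (dirichlet i f + dirichlet j f)"
    using R dirichlet_nonneg[of i f] by (simp add: dirichlet_def m_def algebra_simps)
  finally show ?thesis by (simp add: ij)
qed

lemma resampling_cost_le:
  assumes "p \<in> P"
  shows "resampling_cost f {fst p, snd p} \<le>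
    4 * R * (\<Sum>\<tau>\<in>C. w \<tau>) * (dirichlet (fst p) f + dirichlet (snd p) f)"
proof -
  have "resampling_cost f {fst p, snd p} =
      (\<Sum>\<tau>\<in>C. w \<tau> * (\<Sum>\<sigma>\<in>C. w \<sigma> * (f \<sigma> - f (hybrid {fst p, snd p} \<sigma> \<tau>))\<^sup>2))"
    unfolding resampling_cost_def
    by (subst sum.swap) (simp add: sum_distrib_left algebra_simps)
  also have "\<dots> \<le> (\<Sum>\<tau>\<in>C. w \<tau> * (4 * R * (dirichlet (fst p) f + dirichlet (snd p) f)))"
    using w_pos by (intro sum_mono mult_left_mono local_cost_le assms) (auto simp: less_imp_le)
  also have "\<dots> = 4 * R * (\<Sum>\<tau>\<in>C. w \<tau>) * (dirichlet (fst p) f + dirichlet (snd p) f)"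
    by (simp only: sum_distrib_right[symmetric]) (simp add: algebra_simps)
  finally show ?thesis .
qed

text \<open>The blocks are redrawn one after another. Since the weight factorises, the configuration
  with \<open>S\<close> redrawn and the one holding the discarded spins are again two independent
  copies, so redrawing the next block costs the same as at the start. The Efron--Stein inequality
  would avoid the factor \<open>length ps\<close>, but a polynomial loss is harmless here.\<close>

lemma resampling_cost_verts_le:
  "distinct ps \<Longrightarrow> set ps \<subseteq> P \<Longrightarrow> resampling_cost f (verts (set ps)) \<le>
    real (length ps) * (\<Sum>p\<leftarrow>ps. resampling_cost f {fst p, snd p})"
proof (induction ps)
  case Nil
  then show ?case by (simp add: resampling_cost_def hybrid_def)
next
  case (Cons p ps)
  define S where "S = verts (set ps)"
  define B where "B = {fst p, snd p}"
  have disj: "B \<inter> S = {}"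
  proof -
    have "p \<notin> set ps" "p \<in> P" "set ps \<subseteq> P" using Cons.prems by auto
    then have "\<forall>q\<in>set ps. {fst p, snd p} \<inter> {fst q, snd q} = {}"
      using vertex_disjointD[OF disjoint, of p] by blast
    then show ?thesis unfolding B_def S_def verts_def by (auto split: prod.splits)
  qed
  have h: "hybrid (B \<union> S) \<sigma> \<tau> = hybrid B (hybrid S \<sigma> \<tau>) (hybrid S \<tau> \<sigma>)" for \<sigma> \<tau> :: "nat \<Rightarrow> real"
    using disj by (auto simp: hybrid_def fun_eq_iff)
  \<comment> \<open>Redrawing \<open>B \<union> S\<close> in \<sigma> is redrawing \<open>B\<close>
    in the pair already swapped on \<open>S\<close>, and this swap preserves the weight.\<close>
  have Y: "(\<Sum>\<sigma>\<in>C. \<Sum>\<tau>\<in>C. w \<sigma> * w \<tau> * (f (hybrid S \<sigma> \<tau>) - f (hybrid (B \<union> S) \<sigma> \<tau>))\<^sup>2)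
      = resampling_cost f B"
    unfolding h resampling_cost_def
    by (rule sum_hybrid_swap[where F = "\<lambda>\<sigma> \<tau>. (f \<sigma> - f (hybrid B \<sigma> \<tau>))\<^sup>2"])
       (use product[of "set ps"] Cons.prems in \<open>auto simp: S_def\<close>)
  have nonneg: "resampling_cost f S' \<ge> 0" for S'
    unfolding resampling_cost_def using w_pos
    by (intro sum_nonneg mult_nonneg_nonneg) (auto simp: less_imp_le)
  have "resampling_cost f (B \<union> S) \<le> (real (length ps) + 1) *
      ((\<Sum>p\<leftarrow>ps. resampling_cost f {fst p, snd p}) + resampling_cost f B)"
  proof (rule telescoped_bound_step[where X = "resampling_cost f S" and Y = "resampling_cost f B"])
    show "0 \<le> (\<Sum>p\<leftarrow>ps. resampling_cost f {fst p, snd p})"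
      using nonneg by (intro sum_list_nonneg) auto
    show "resampling_cost f S \<le> real (length ps) * (\<Sum>p\<leftarrow>ps. resampling_cost f {fst p, snd p})"
      using Cons unfolding S_def by auto
    show "resampling_cost f (B \<union> S) \<le> resampling_cost f B" if "real (length ps) = 0"
      using that by (simp add: S_def)
    show "resampling_cost f (B \<union> S) \<le> (1 + 1 / real (length ps)) * resampling_cost f S
        + (1 + real (length ps)) * resampling_cost f B" if n: "0 < real (length ps)"
    proof -
      define n where "n = real (length ps)"
      have "resampling_cost f (B \<union> S) \<le> (\<Sum>\<sigma>\<in>C. \<Sum>\<tau>\<in>C. w \<sigma> * w \<tau> *
          ((1 + 1 / n) * (f \<sigma> - f (hybrid S \<sigma> \<tau>))\<^sup>2
          + (1 + n) * (f (hybrid S \<sigma> \<tau>) - f (hybrid (B \<union> S) \<sigma> \<tau>))\<^sup>2))"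
        unfolding resampling_cost_def
      proof (intro sum_mono mult_left_mono)
        show "(f \<sigma> - f (hybrid (B \<union> S) \<sigma> \<tau>))\<^sup>2 \<le> (1 + 1 / n) * (f \<sigma> - f (hybrid S \<sigma> \<tau>))\<^sup>2
          + (1 + n) * (f (hybrid S \<sigma> \<tau>) - f (hybrid (B \<union> S) \<sigma> \<tau>))\<^sup>2" for \<sigma> \<tau>
          using square_add_le[of n "f \<sigma> - f (hybrid S \<sigma> \<tau>)" "f (hybrid S \<sigma> \<tau>) - f (hybrid (B \<union> S) \<sigma> \<tau>)"] n
          by (simp add: n_def)
      qed (use w_pos in \<open>auto simp: less_imp_le\<close>)
      also have "\<dots> = (1 + 1 / n) * resampling_cost f S + (1 + n) * resampling_cost f B"
        unfolding Y[symmetric] unfolding resampling_cost_def sum_distrib_left sum.distrib[symmetric]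
        by (simp add: algebra_simps)
      finally show ?thesis by (simp add: n_def)
    qed
  qed (use nonneg in auto)
  then show ?case by (simp add: verts_insert S_def B_def algebra_simps)
qed

text \<open>Redrawing all blocks turns \<sigma> into \<tau>, so the left side is the cost of
  redrawing everything; it is bounded block by block, and the blocks partition
  \<open>V\<close>.\<close>

lemma pair_variance_le:
  "(\<Sum>\<sigma>\<in>C. \<Sum>\<tau>\<in>C. w \<sigma> * w \<tau> * (f \<sigma> - f \<tau>)\<^sup>2)
    \<le> 8 * R * real (card V) * (\<Sum>\<sigma>\<in>C. w \<sigma>) * (\<Sum>v\<in>V. dirichlet v f)"
proof (cases "C = {}")
  case True
  then show ?thesis by (simp add: dirichlet_def)
next
  case False
  then obtain \<rho> where \<rho>: "\<rho> \<in> C" by auto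
  obtain ps where ps: "set ps = P" "distinct ps" using finite_P finite_distinct_list by blast
  have finV: "finite V" using V finite_subset by blast
  have W: "(\<Sum>\<sigma>\<in>C. w \<sigma>) \<ge> 0" using w_pos by (intro sum_nonneg) (auto simp: less_imp_le)
  have fullh: "hybrid V \<sigma> \<tau> = \<tau>" if "\<sigma> \<in> C" "\<tau> \<in> C" for \<sigma> \<tau>
  proof (rule spins_ext)
    show "hybrid V \<sigma> \<tau> \<in> spins N" using hybrid_in_subcube[OF that] by (auto simp: subcube_def)
  qed (use that in \<open>auto simp: hybrid_def subcube_def\<close>)
  \<comment> \<open>A singleton block has equal first and second component and is counted twice on
    the left, which is where the factor 2 comes from.\<close>
  have pair: "dirichlet (fst p) f + dirichlet (snd p) f \<le> 2 * (\<Sum>v\<in>{fst p, snd p}. dirichlet v f)" for p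
    using dirichlet_nonneg[of "fst p" f] dirichlet_nonneg[of "snd p" f]
    by (cases "fst p = snd p") auto
  have blocks: "(\<Sum>p\<in>P. \<Sum>v\<in>{fst p, snd p}. dirichlet v f) = (\<Sum>v\<in>V. dirichlet v f)"
  proof -
    have V_eq: "V = (\<Union>p\<in>P. {fst p, snd p})" unfolding verts_P[symmetric] verts_def
      by (simp add: case_prod_unfold)
    have "(\<Sum>v\<in>(\<Union>p\<in>P. {fst p, snd p}). dirichlet v f) = (\<Sum>p\<in>P. \<Sum>v\<in>{fst p, snd p}. dirichlet v f)"
    proof (rule sum.UNION_disjoint)
      show "\<forall>p\<in>P. \<forall>q\<in>P. p \<noteq> q \<longrightarrow> {fst p, snd p} \<inter> {fst q, snd q} = {}"
        using vertex_disjointD[OF disjoint] by blast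
    qed (use finite_P in auto)
    then show ?thesis using V_eq by metis
  qed
  have cardP: "card P \<le> card V"
  proof (rule card_inj_on_le[of fst])
    show "inj_on fst P" using vertex_disjointD[OF disjoint] unfolding inj_on_def by blast
    show "fst ` P \<subseteq> V" unfolding verts_P[symmetric] verts_def by (simp add: case_prod_unfold) blast
  qed (use finV in auto)
  show ?thesis
  proof (cases "P = {}")
    case True
    then have "V = {}" using verts_P by simp
    then have "\<sigma> = \<tau>" if "\<sigma> \<in> C" "\<tau> \<in> C" for \<sigma> \<tau>
      using fullh[OF that] by (simp add: hybrid_def)
    then have "C = {\<rho>}" using \<rho> by blast
    then have "(\<Sum>\<sigma>\<in>C. \<Sum>\<tau>\<in>C. w \<sigma> * w \<tau> * (f \<sigma> - f \<tau>)\<^sup>2) = 0" by simp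
    then show ?thesis by (simp add: \<open>V = {}\<close>)
  next
    case False
    then obtain p where "p \<in> P" by auto
    have R: "R > 0"
    proof -
      have "w \<rho> \<le> R * w \<rho>" using ratio[OF \<open>p \<in> P\<close> \<rho> \<rho>] by simp
      then show ?thesis using w_pos[of \<rho>] by (metis mult_le_cancel_right1 less_le_trans zero_less_one not_less)
    qed
    have "(\<Sum>\<sigma>\<in>C. \<Sum>\<tau>\<in>C. w \<sigma> * w \<tau> * (f \<sigma> - f \<tau>)\<^sup>2) = resampling_cost f (verts (set ps))"
      unfolding resampling_cost_def ps verts_P by (simp add: fullh)
    also have "\<dots> \<le> real (length ps) * (\<Sum>p\<leftarrow>ps. resampling_cost f {fst p, snd p})"
      using resampling_cost_verts_le[of ps f] ps by simp
    also have "\<dots> = real (card P) * (\<Sum>p\<in>P. resampling_cost f {fst p, snd p})"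
      using ps by (simp add: sum_list_distinct_conv_sum_set distinct_card[symmetric])
    also have "\<dots> \<le> real (card P) * (\<Sum>p\<in>P. 4 * R * (\<Sum>\<sigma>\<in>C. w \<sigma>) *
        (2 * (\<Sum>v\<in>{fst p, snd p}. dirichlet v f)))"
    proof (intro mult_left_mono sum_mono)
      fix p assume "p \<in> P"
      have "4 * R * (\<Sum>\<sigma>\<in>C. w \<sigma>) \<ge> 0" using R W by simp
      then show "resampling_cost f {fst p, snd p} \<le> 4 * R * (\<Sum>\<sigma>\<in>C. w \<sigma>) *
        (2 * (\<Sum>v\<in>{fst p, snd p}. dirichlet v f))"
        using resampling_cost_le[OF \<open>p \<in> P\<close>, of f] mult_left_mono[OF pair[of p]] by (meson order.trans)
    qed auto
    also have "\<dots> = real (card P) * (8 * R * (\<Sum>\<sigma>\<in>C. w \<sigma>) * (\<Sum>v\<in>V. dirichlet v f))"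
      unfolding blocks[symmetric] sum_distrib_left[symmetric] by simp
    also have "\<dots> \<le> real (card V) * (8 * R * (\<Sum>\<sigma>\<in>C. w \<sigma>) * (\<Sum>v\<in>V. dirichlet v f))"
      using cardP R W dirichlet_nonneg by (intro mult_right_mono mult_nonneg_nonneg sum_nonneg)
        (auto simp: w_pos less_imp_le)
    finally show ?thesis by (simp add: algebra_simps)
  qed
qed

end

section \<open>Wells of separated couplings\<close>

context weighted_subcube begin

lemma sq_norm_mean:
  defines "W \<equiv> \<Sum>\<sigma>\<in>C. w \<sigma>"
  shows "sq_norm C w (\<lambda>\<sigma>. f \<sigma> - c) = sq_norm C w f - 2 * c * (\<Sum>\<sigma>\<in>C. w \<sigma> * f \<sigma>) + c\<^sup>2 * W"
  unfolding sq_norm_def W_def sum_distrib_left sum_distrib_right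
    sum.distrib[symmetric] sum_subtractf[symmetric]
  by (simp add: power2_eq_square algebra_simps)

lemma double_sum_square:
  "(\<Sum>\<sigma>\<in>C. \<Sum>\<tau>\<in>C. w \<sigma> * w \<tau> * (f \<sigma> - f \<tau>)\<^sup>2)
    = 2 * (\<Sum>\<sigma>\<in>C. w \<sigma>) * sq_norm C w f - 2 * (\<Sum>\<sigma>\<in>C. w \<sigma> * f \<sigma>)\<^sup>2"
proof -
  have "(\<Sum>\<tau>\<in>C. w \<sigma> * w \<tau> * (f \<sigma> - f \<tau>)\<^sup>2) =
      w \<sigma> * (f \<sigma>)\<^sup>2 * (\<Sum>\<tau>\<in>C. w \<tau>) - 2 * (w \<sigma> * f \<sigma>) * (\<Sum>\<tau>\<in>C. w \<tau> * f \<tau>)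
      + w \<sigma> * (\<Sum>\<tau>\<in>C. w \<tau> * (f \<tau>)\<^sup>2)" for \<sigma>
    unfolding sum_distrib_left sum.distrib[symmetric] sum_subtractf[symmetric]
    by (simp add: power2_eq_square algebra_simps)
  then have "(\<Sum>\<sigma>\<in>C. \<Sum>\<tau>\<in>C. w \<sigma> * w \<tau> * (f \<sigma> - f \<tau>)\<^sup>2) =
      (\<Sum>\<sigma>\<in>C. w \<sigma> * (f \<sigma>)\<^sup>2) * (\<Sum>\<tau>\<in>C. w \<tau>) - 2 * (\<Sum>\<sigma>\<in>C. w \<sigma> * f \<sigma>) * (\<Sum>\<tau>\<in>C. w \<tau> * f \<tau>)
      + (\<Sum>\<sigma>\<in>C. w \<sigma>) * (\<Sum>\<tau>\<in>C. w \<tau> * (f \<tau>)\<^sup>2)"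
    by (simp add: sum.distrib sum_subtractf sum_distrib_right[symmetric] sum_distrib_left[symmetric])
  then show ?thesis by (simp add: sq_norm_def power2_eq_square algebra_simps)
qed

end

text \<open>The Holley--Stroock perturbation argument: the variance under \<open>w'\<close> is at
  most \<open>A\<close> times that under \<open>w\<close>, and the Dirichlet form of
  \<open>w\<close> at most \<open>B\<close> times that of \<open>w'\<close>. Only the product of
  \<open>A\<close> and \<open>B\<close> matters, so a common factor between the two weights costs
  nothing.\<close>

lemma (in pair_weights) poincare_comparable:
  fixes w' :: "(nat \<Rightarrow> real) \<Rightarrow> real"
  assumes w': "\<And>\<sigma>. w' \<sigma> > 0" and A: "\<And>\<sigma>. \<sigma> \<in> C \<Longrightarrow> w' \<sigma> \<le> A * w \<sigma>"
    and B: "\<And>\<sigma>. \<sigma> \<in> C \<Longrightarrow> w \<sigma> \<le> B * w' \<sigma>" and "C \<noteq> {}" "R \<ge> 1"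
    and mean: "(\<Sum>\<sigma>\<in>C. w' \<sigma> * f \<sigma>) = 0"
  shows "sq_norm C w' f \<le>
    16 * A * B * R * real (card V) * (\<Sum>v\<in>V. sq_norm C w' (\<lambda>\<sigma>. f \<sigma> - heat_bath w' v f \<sigma>))"
proof -
  interpret w': weighted_subcube N V \<omega> w' using V w' by unfold_locales
  obtain \<rho> where \<rho>: "\<rho> \<in> C" using assms(4) by auto
  have pos: "A > 0" "B > 0"
    using A[OF \<rho>] B[OF \<rho>] w'[of \<rho>] w_pos[of \<rho>]
    by (metis less_le_trans zero_less_mult_pos2)+
  define W where "W = (\<Sum>\<sigma>\<in>C. w \<sigma>)"
  define m where "m = (\<Sum>\<sigma>\<in>C. w \<sigma> * f \<sigma>) / W"
  have W: "W > 0" unfolding W_def using \<rho> w_pos by (intro sum_pos2[of _ \<rho>]) (auto simp: less_imp_le)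
  have "2 * W * sq_norm C w (\<lambda>\<sigma>. f \<sigma> - m) = (\<Sum>\<sigma>\<in>C. \<Sum>\<tau>\<in>C. w \<sigma> * w \<tau> * (f \<sigma> - f \<tau>)\<^sup>2)"
    unfolding sq_norm_mean double_sum_square using W
    by (simp add: m_def W_def[symmetric] field_simps power2_eq_square)
  also have "\<dots> \<le> 8 * R * real (card V) * W * (\<Sum>v\<in>V. dirichlet v f)"
    unfolding W_def by (rule pair_variance_le)
  finally have "2 * W * sq_norm C w (\<lambda>\<sigma>. f \<sigma> - m) \<le> 2 * W * (4 * R * real (card V) * (\<Sum>v\<in>V. dirichlet v f))"
    by (simp add: algebra_simps)
  then have var: "sq_norm C w (\<lambda>\<sigma>. f \<sigma> - m) \<le> 4 * R * real (card V) * (\<Sum>v\<in>V. dirichlet v f)"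
    using W by simp
  have dir: "dirichlet v f \<le> 4 * B * sq_norm C w' (\<lambda>\<sigma>. f \<sigma> - heat_bath w' v f \<sigma>)" if "v \<in> V" for v
  proof -
    have "dirichlet v f \<le> B * w'.dirichlet v f"
      unfolding dirichlet_def w'.dirichlet_def sum_distrib_left
    proof (rule sum_mono)
      fix \<sigma> assume \<sigma>: "\<sigma> \<in> C"
      have "min (w \<sigma>) (w (flip v \<sigma>)) \<le> B * min (w' \<sigma>) (w' (flip v \<sigma>))"
        using B[OF \<sigma>] B[OF flip_in_subcube[OF V \<sigma> that]] by (auto simp: min_def)
      then show "min (w \<sigma>) (w (flip v \<sigma>)) * (f \<sigma> - f (flip v \<sigma>))\<^sup>2
          \<le> B * (min (w' \<sigma>) (w' (flip v \<sigma>)) * (f \<sigma> - f (flip v \<sigma>))\<^sup>2)"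
        unfolding mult.assoc[symmetric] by (rule mult_right_mono) simp
    qed
    also have "\<dots> \<le> B * (4 * sq_norm C w' (\<lambda>\<sigma>. f \<sigma> - heat_bath w' v f \<sigma>))"
      using pos w'.dirichlet_le_residual[OF that, of f] by (intro mult_left_mono) auto
    finally show ?thesis by simp
  qed
  \<comment> \<open>Under \<open>w'\<close> the function already has mean zero, so shifting it by
    the \<open>w\<close>-mean \<open>m\<close> can only increase its norm.\<close>
  have "sq_norm C w' f \<le> sq_norm C w' (\<lambda>\<sigma>. f \<sigma> - m)"
    unfolding w'.sq_norm_mean mean using w' by (simp add: sum_nonneg less_imp_le)
  also have "\<dots> \<le> A * sq_norm C w (\<lambda>\<sigma>. f \<sigma> - m)"
    unfolding sq_norm_def sum_distrib_left mult.assoc[symmetric]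
    using A by (intro sum_mono mult_right_mono) auto
  also have "\<dots> \<le> A * (4 * R * real (card V) * (\<Sum>v\<in>V. 4 * B * sq_norm C w' (\<lambda>\<sigma>. f \<sigma> - heat_bath w' v f \<sigma>)))"
    using pos assms(5) by (intro mult_left_mono order.trans[OF var] sum_mono dir) auto
  also have "\<dots> = 16 * A * B * R * real (card V) * (\<Sum>v\<in>V. sq_norm C w' (\<lambda>\<sigma>. f \<sigma> - heat_bath w' v f \<sigma>))"
    unfolding sum_distrib_left[symmetric] by simp
  finally show ?thesis .
qed

lemma finite_pairs [simp]: "finite (pairs N)"
  by (rule finite_subset[of _ "{1..N} \<times> {1..N}"]) (auto simp: pairs_def)

section \<open>Heavy, medium and small couplings\<close>

definition boltzmann :: "real \<Rightarrow> nat \<Rightarrow> (nat \<times> nat \<Rightarrow> real) \<Rightarrow> (nat \<Rightarrow> real) \<Rightarrow> real" where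
  "boltzmann \<beta> N J \<sigma> = exp (\<beta> * hamiltonian N J \<sigma>)"

lemma boltzmann_pos [simp]: "boltzmann \<beta> N J \<sigma> > 0"
  by (simp add: boltzmann_def)

definition bond :: "(nat \<times> nat \<Rightarrow> real) \<Rightarrow> (nat \<Rightarrow> real) \<Rightarrow> nat \<times> nat \<Rightarrow> real" where
  "bond J \<sigma> e = J e * (\<sigma> (fst e) * \<sigma> (snd e))"

lemma hamiltonian_bond: "hamiltonian N J \<sigma> = (\<Sum>e\<in>pairs N. bond J \<sigma> e)"
  unfolding hamiltonian_def by (intro sum.cong) (auto simp: bond_def)

text \<open>Couplings of three kinds: the wells are determined by the heavy ones \<open>E\<close>, the medium ones
  \<open>D\<close> are treated as a product measure, and the sum of the others is bounded by \<open>M\<close>.\<close>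

locale separated_couplings =
  fixes N :: nat and \<beta> :: real and J :: "nat \<times> nat \<Rightarrow> real"
    and E D :: "(nat \<times> nat) set" and \<theta> K M :: real
  assumes beta: "\<beta> > 0" and E: "E \<subseteq> pairs N" and D: "D \<subseteq> pairs N" and ED: "E \<inter> D = {}"
    and disjoint_ED: "vertex_disjoint (E \<union> D)"
    and heavy: "\<And>e. e \<in> E \<Longrightarrow> \<bar>J e\<bar> \<ge> \<theta>" and theta: "\<theta> > 0"
    and medium: "\<And>e. e \<in> D \<Longrightarrow> \<bar>J e\<bar> \<le> K" and K: "K \<ge> 0"
    and small: "(\<Sum>e\<in>pairs N - (E \<union> D). \<bar>J e\<bar>) \<le> M"
begin

abbreviation "H \<equiv> hamiltonian N J"
abbreviation "bw \<equiv> boltzmann \<beta> N J"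
abbreviation "frozen \<equiv> verts E"
abbreviation "free \<equiv> {1..N} - verts E"
abbreviation "sites \<equiv> {1..N}"

definition ground :: "(nat \<Rightarrow> real) set" where
  "ground = {\<omega> \<in> spins N. E \<subseteq> satisfied N J \<omega>}"

text \<open>The part of the Boltzmann weight that factorises over \<open>blocks\<close>. On a well
  the heavy couplings contribute a constant and the small ones a factor bounded in terms of
  \<open>M\<close>.\<close>

definition weight0 :: "(nat \<Rightarrow> real) \<Rightarrow> real" where
  "weight0 \<sigma> = exp (\<beta> * (\<Sum>e\<in>D. bond J \<sigma> e))"

definition blocks :: "(nat \<times> nat) set" where
  "blocks = D \<union> (\<lambda>v. (v, v)) ` (free - verts D)"

lemma finite_E: "finite E" and finite_D: "finite D"
  using E D finite_pairs finite_subset by blast+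

lemma frozen_subset: "frozen \<subseteq> sites"
  using E by (auto simp: verts_def pairs_def)

lemma verts_D: "verts D \<subseteq> free"
proof
  fix v assume "v \<in> verts D"
  then obtain e where e: "e \<in> D" "v \<in> {fst e, snd e}" by (auto simp: verts_def)
  have "v \<notin> verts E"
  proof
    assume "v \<in> verts E"
    then obtain e' where e': "e' \<in> E" "v \<in> {fst e', snd e'}" by (auto simp: verts_def)
    then show False using vertex_disjointD[OF disjoint_ED, of e e'] e ED by auto
  qed
  then show "v \<in> free" using e D by (auto simp: pairs_def)
qed

lemma abs_bond:
  assumes "\<sigma> \<in> spins N" "e \<in> pairs N"
  shows "\<bar>bond J \<sigma> e\<bar> = \<bar>J e\<bar>"
proof -
  have "fst e \<in> {1..N}" "snd e \<in> {1..N}" using assms(2) by (auto simp: pairs_def)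
  then have "\<bar>\<sigma> (fst e) * \<sigma> (snd e)\<bar> = 1"
    using spins_values[OF assms(1), of "fst e"] spins_values[OF assms(1), of "snd e"] by auto
  then show ?thesis by (simp add: bond_def abs_mult)
qed

lemma finite_blocks: "finite blocks"
  unfolding blocks_def using finite_D by auto

lemma disjoint_blocks: "vertex_disjoint blocks"
proof (rule vertex_disjointI)
  fix p q assume 1: "p \<in> blocks" "q \<in> blocks" and ne: "p \<noteq> q"
  have D': "{fst p, snd p} \<inter> {fst q, snd q} = {}" if "p \<in> D" "q \<in> D"
    using vertex_disjointD[OF disjoint_ED, of p q] that ne by auto
  from 1 consider "p \<in> D" "q \<in> D" | "p \<in> D" "fst q = snd q" "fst q \<notin> verts D"
    | "q \<in> D" "fst p = snd p" "fst p \<notin> verts D" | "fst p = snd p" "fst q = snd q"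
    by (auto simp: blocks_def)
  then show "{fst p, snd p} \<inter> {fst q, snd q} = {}"
  proof cases
    case 1
    then show ?thesis by (rule D')
  qed (use ne in \<open>auto simp: verts_iff prod_eq_iff\<close>)
qed

lemma verts_blocks: "verts blocks = free"
proof -
  have "verts blocks = verts D \<union> (free - verts D)" by (auto simp: verts_def blocks_def)
  then show ?thesis using verts_D by auto
qed

lemma verts_subset_blocks:
  assumes "Q \<subseteq> blocks" "e \<in> D"
  shows "fst e \<in> verts Q \<longleftrightarrow> snd e \<in> verts Q"
proof -
  have "e \<in> Q" if "v \<in> verts Q" "v \<in> {fst e, snd e}" for v
  proof -
    obtain q where q: "q \<in> Q" "v \<in> {fst q, snd q}" using \<open>v \<in> verts Q\<close> by (auto simp: verts_def)
    have "e \<in> blocks" using assms(2) by (simp add: blocks_def)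
    have "q \<in> blocks" using q assms(1) by blast
    then have "q = e" using vertex_disjointD[OF disjoint_blocks _ \<open>e \<in> blocks\<close>] q that(2) by blast
    then show ?thesis using q by simp
  qed
  then show ?thesis by (meson insertCI verts_iff)
qed

text \<open>A union of blocks contains both ends of a medium edge or neither, so swapping it between
  two copies preserves or exchanges their energies on that edge.\<close>

lemma weight0_product:
  assumes "Q \<subseteq> blocks"
  shows "weight0 (hybrid (verts Q) \<sigma> \<tau>) * weight0 (hybrid (verts Q) \<tau> \<sigma>) = weight0 \<sigma> * weight0 \<tau>"
proof -
  have "bond J (hybrid (verts Q) \<sigma> \<tau>) e + bond J (hybrid (verts Q) \<tau> \<sigma>) e = bond J \<sigma> e + bond J \<tau> e"
    if "e \<in> D" for e
    using verts_subset_blocks[OF assms that] by (auto simp: bond_def hybrid_def)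
  then have "(\<Sum>e\<in>D. bond J (hybrid (verts Q) \<sigma> \<tau>) e) + (\<Sum>e\<in>D. bond J (hybrid (verts Q) \<tau> \<sigma>) e)
      = (\<Sum>e\<in>D. bond J \<sigma> e) + (\<Sum>e\<in>D. bond J \<tau> e)"
    by (simp add: sum.distrib[symmetric])
  then show ?thesis
    by (simp add: weight0_def exp_add[symmetric] distrib_left[symmetric])
qed

text \<open>Medium edges are disjoint from the block \<open>p\<close> or equal to it. So at most the
  coupling of \<open>p\<close> itself changes, by at most \<open>2 * K\<close>.\<close>

lemma weight0_ratio:
  assumes p: "p \<in> blocks" and \<sigma>: "\<sigma> \<in> spins N" and \<tau>: "\<tau> \<in> spins N"
    and agree: "\<And>v. v \<noteq> fst p \<Longrightarrow> v \<noteq> snd p \<Longrightarrow> \<sigma> v = \<tau> v"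
  shows "weight0 \<sigma> \<le> exp (2 * \<beta> * K) * weight0 \<tau>"
proof -
  have "(\<Sum>e\<in>D. bond J \<sigma> e - bond J \<tau> e) \<le> (\<Sum>e\<in>D. if e = p then 2 * K else 0)"
  proof (rule sum_mono)
    fix e assume e: "e \<in> D"
    show "bond J \<sigma> e - bond J \<tau> e \<le> (if e = p then 2 * K else 0)"
    proof (cases "e = p")
      case True
      have "e \<in> pairs N" using D e by auto
      then show ?thesis using abs_bond[OF \<sigma>, of e] abs_bond[OF \<tau>, of e] medium[OF e] True by auto
    next
      case False
      have "e \<in> blocks" using e by (simp add: blocks_def)
      then have "fst e \<noteq> fst p" "fst e \<noteq> snd p" "snd e \<noteq> fst p" "snd e \<noteq> snd p"
        using vertex_disjointD[OF disjoint_blocks, of e p] p False by auto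
      then show ?thesis using agree False by (simp add: bond_def)
    qed
  qed
  also have "\<dots> \<le> 2 * K" using K finite_D by (simp add: sum.delta)
  finally have "\<beta> * (\<Sum>e\<in>D. bond J \<sigma> e) \<le> \<beta> * (2 * K + (\<Sum>e\<in>D. bond J \<tau> e))"
    using beta by (intro mult_left_mono) (auto simp: sum_subtractf)
  then show ?thesis
    unfolding weight0_def exp_add[symmetric] by (simp add: algebra_simps)
qed

lemma hamiltonian_split:
  "H \<sigma> = (\<Sum>e\<in>E. bond J \<sigma> e) + (\<Sum>e\<in>D. bond J \<sigma> e) + (\<Sum>e\<in>pairs N - (E \<union> D). bond J \<sigma> e)"
proof -
  have "pairs N = E \<union> D \<union> (pairs N - (E \<union> D))" using E D by auto
  then have "H \<sigma> = (\<Sum>e\<in>E \<union> D. bond J \<sigma> e) + (\<Sum>e\<in>pairs N - (E \<union> D). bond J \<sigma> e)"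
    unfolding hamiltonian_bond using E D
    by (metis Un_least finite_pairs sum.subset_diff add.commute)
  then show ?thesis using finite_E finite_D ED by (simp add: sum.union_disjoint)
qed

lemma small_part:
  assumes "\<sigma> \<in> spins N"
  shows "\<bar>\<Sum>e\<in>pairs N - (E \<union> D). bond J \<sigma> e\<bar> \<le> M"
proof -
  have "\<bar>\<Sum>e\<in>pairs N - (E \<union> D). bond J \<sigma> e\<bar> \<le> (\<Sum>e\<in>pairs N - (E \<union> D). \<bar>bond J \<sigma> e\<bar>)"
    by (rule sum_abs)
  also have "\<dots> = (\<Sum>e\<in>pairs N - (E \<union> D). \<bar>J e\<bar>)"
    using assms by (intro sum.cong refl abs_bond) auto
  finally show ?thesis using small by simp
qed

lemma frozen_edge: "e \<in> E \<Longrightarrow> fst e \<in> frozen \<and> snd e \<in> frozen"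
  by (auto simp: verts_iff)

lemma heavy_part:
  assumes "\<omega> \<in> ground" "\<sigma> \<in> subcube N free \<omega>"
  shows "(\<Sum>e\<in>E. bond J \<sigma> e) = (\<Sum>e\<in>E. \<bar>J e\<bar>)"
proof (rule sum.cong)
  fix e assume e: "e \<in> E"
  have "\<sigma> (fst e) = \<omega> (fst e)" "\<sigma> (snd e) = \<omega> (snd e)"
    using frozen_edge[OF e] assms(2) frozen_subset by (auto simp: subcube_def)
  moreover have "\<omega> (fst e) * \<omega> (snd e) = sgn (J e)"
    using assms(1) e by (auto simp: ground_def satisfied_def)
  ultimately show "bond J \<sigma> e = \<bar>J e\<bar>" by (simp add: bond_def abs_sgn)
qed simp

lemma ground_in_subcube: "\<omega> \<in> ground \<Longrightarrow> \<omega> \<in> subcube N free \<omega>"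
  by (auto simp: ground_def subcube_def)

text \<open>The heavy energy \<open>h\<close> is the same throughout a well; it enters the two
  bounds with opposite signs and will cancel in their product.\<close>

lemma boltzmann_weight0:
  assumes "\<omega> \<in> ground" "\<sigma> \<in> subcube N free \<omega>"
  defines "h \<equiv> \<Sum>e\<in>E. \<bar>J e\<bar>"
  shows "bw \<sigma> \<le> exp (\<beta> * (h + M)) * weight0 \<sigma>" "weight0 \<sigma> \<le> exp (\<beta> * (M - h)) * bw \<sigma>"
proof -
  have \<sigma>: "\<sigma> \<in> spins N" using assms(2) by (simp add: subcube_def)
  show "bw \<sigma> \<le> exp (\<beta> * (h + M)) * weight0 \<sigma>"
    unfolding boltzmann_def weight0_def exp_add[symmetric] exp_le_cancel_iff distrib_left[symmetric]
    using small_part[OF \<sigma>] beta heavy_part[OF assms(1,2)] hamiltonian_split[of \<sigma>]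
    by (intro mult_left_mono) (auto simp: h_def)
  show "weight0 \<sigma> \<le> exp (\<beta> * (M - h)) * bw \<sigma>"
    unfolding boltzmann_def weight0_def exp_add[symmetric] exp_le_cancel_iff distrib_left[symmetric]
    using small_part[OF \<sigma>] beta heavy_part[OF assms(1,2)] hamiltonian_split[of \<sigma>]
    by (intro mult_left_mono) (auto simp: h_def)
qed

text \<open>The factor \<open>exp (2 * \<beta> * K)\<close> is the weight ratio within a medium
  pair, \<open>exp (2 * \<beta> * M)\<close> the cost of the small couplings in
  \<open>poincare_comparable\<close>, and \<open>N\<close> bounds the number of free sites.\<close>

definition gap_const :: real where
  "gap_const = 16 * real N * exp (2 * \<beta> * (M + K))"

lemma poincare:
  assumes \<omega>: "\<omega> \<in> ground" and mean: "(\<Sum>\<sigma>\<in>subcube N free \<omega>. bw \<sigma> * f \<sigma>) = 0"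
  shows "sq_norm (subcube N free \<omega>) bw f \<le>
    gap_const * (\<Sum>v\<in>free. sq_norm (subcube N free \<omega>) bw (\<lambda>\<sigma>. f \<sigma> - heat_bath bw v f \<sigma>))"
proof -
  interpret pair_weights N free \<omega> weight0 blocks "exp (2 * \<beta> * K)"
  proof unfold_locales
    show "weight0 \<sigma> \<le> exp (2 * \<beta> * K) * weight0 \<tau>"
      if "p \<in> blocks" "\<sigma> \<in> subcube N free \<omega>" "\<tau> \<in> subcube N free \<omega>"
        "\<And>v. v \<noteq> fst p \<Longrightarrow> v \<noteq> snd p \<Longrightarrow> \<sigma> v = \<tau> v" for p \<sigma> \<tau>
      using that by (intro weight0_ratio[of p]) (auto simp: subcube_def)
  qed (auto simp: finite_blocks disjoint_blocks verts_blocks weight0_product, simp add: weight0_def)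
  define h where "h = (\<Sum>e\<in>E. \<bar>J e\<bar>)"
  define S where "S = (\<Sum>v\<in>free. sq_norm (subcube N free \<omega>) bw (\<lambda>\<sigma>. f \<sigma> - heat_bath bw v f \<sigma>))"
  have S: "S \<ge> 0" unfolding S_def by (intro sum_nonneg sq_norm_nonneg) (simp add: boltzmann_def)
  have "sq_norm (subcube N free \<omega>) bw f \<le>
    16 * exp (\<beta> * (h + M)) * exp (\<beta> * (M - h)) * exp (2 * \<beta> * K) * real (card free) * S"
    unfolding S_def h_def
    by (rule poincare_comparable)
       (use boltzmann_weight0[OF \<omega>] mean ground_in_subcube[OF \<omega>] beta K in auto)
  also have "\<dots> = 16 * exp (2 * \<beta> * (M + K)) * real (card free) * S"
    by (simp add: exp_add[symmetric] algebra_simps)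
  also have "\<dots> \<le> 16 * exp (2 * \<beta> * (M + K)) * real N * S"
    using S card_mono[of "{1..N}" free] by (intro mult_right_mono mult_left_mono) auto
  finally show ?thesis by (simp add: gap_const_def S_def algebra_simps)
qed

end

lemma heat_bath_diff_const:
  assumes "\<And>\<sigma>. w \<sigma> > 0"
  shows "heat_bath w v (\<lambda>x. f x - c) \<sigma> = heat_bath w v f \<sigma> - c"
proof -
  have "w (\<sigma>(v := 1)) + w (\<sigma>(v := -1)) > 0" by (intro add_pos_pos assms)
  then show ?thesis by (simp add: heat_bath_def field_simps)
qed

lemma heat_bath_diff:
  "heat_bath w v (\<lambda>x. f x - g x) \<sigma> = heat_bath w v f \<sigma> - heat_bath w v g \<sigma>"
  unfolding heat_bath_def diff_divide_distrib[symmetric] by (simp add: algebra_simps)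

lemma heat_bath_near:
  assumes "\<And>\<sigma>. w \<sigma> > 0" "\<bar>f (\<sigma>(v := 1)) - c\<bar> \<le> d" "\<bar>f (\<sigma>(v := -1)) - c\<bar> \<le> d"
  shows "\<bar>heat_bath w v f \<sigma> - c\<bar> \<le> d"
proof -
  define p q where "p = w (\<sigma>(v := 1))" "q = w (\<sigma>(v := -1))"
  have pq: "p > 0" "q > 0" by (auto simp: p_q_def assms)
  have "\<bar>p * (f (\<sigma>(v := 1)) - c) + q * (f (\<sigma>(v := -1)) - c)\<bar>
      \<le> p * \<bar>f (\<sigma>(v := 1)) - c\<bar> + q * \<bar>f (\<sigma>(v := -1)) - c\<bar>"
    using pq by (intro order.trans[OF abs_triangle_ineq]) (simp add: abs_mult)
  also have "\<dots> \<le> p * d + q * d"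
    using assms(2,3) pq by (intro add_mono mult_left_mono) auto
  finally have "\<bar>p * (f (\<sigma>(v := 1)) - c) + q * (f (\<sigma>(v := -1)) - c)\<bar> \<le> (p + q) * d"
    by (simp add: algebra_simps)
  moreover have "heat_bath w v f \<sigma> - c = (p * (f (\<sigma>(v := 1)) - c) + q * (f (\<sigma>(v := -1)) - c)) / (p + q)"
    by (subst heat_bath_diff_const[symmetric, OF assms(1)]) (simp add: heat_bath_def p_q_def)
  ultimately show ?thesis using pq by (simp add: abs_divide divide_le_eq mult.commute)
qed

lemma heat_bath_range:
  assumes "\<And>\<sigma>. w \<sigma> > 0" "\<And>\<sigma>. 0 \<le> f \<sigma> \<and> f \<sigma> \<le> 1"
  shows "0 \<le> heat_bath w v f \<sigma> \<and> heat_bath w v f \<sigma> \<le> 1"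
proof -
  have "\<bar>heat_bath w v f \<sigma> - 1 / 2\<bar> \<le> 1 / 2"
    using assms(2)[of "\<sigma>(v := 1)"] assms(2)[of "\<sigma>(v := -1)"]
    by (intro heat_bath_near assms(1)) (auto simp: abs_if)
  then show ?thesis unfolding abs_le_iff by linarith
qed

section \<open>The settled dynamics and its mixing inside a well\<close>

context separated_couplings begin

definition edge_at :: "nat \<Rightarrow> nat \<times> nat" where
  "edge_at v = (THE e. e \<in> E \<and> (v = fst e \<or> v = snd e))"

text \<open>The sum of both endpoints minus one of them gives the other, whichever endpoint
  \<open>v\<close> is.\<close>

definition mate :: "nat \<Rightarrow> nat" where
  "mate v = fst (edge_at v) + snd (edge_at v) - v"

definition settle :: "nat \<Rightarrow> (nat \<Rightarrow> real) \<Rightarrow> nat \<Rightarrow> real" where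
  "settle v \<sigma> = (if v \<in> frozen then \<sigma>(v := sgn (J (edge_at v)) * \<sigma> (mate v)) else \<sigma>)"

text \<open>A dynamics in which a frozen site always obeys its heavy edge, while free sites keep the
  true heat bath. It never leaves a well once there, and in the well it is stationary for the
  conditional Gibbs measure.\<close>

definition settled_bath :: "nat \<Rightarrow> ((nat \<Rightarrow> real) \<Rightarrow> real) \<Rightarrow> (nat \<Rightarrow> real) \<Rightarrow> real" where
  "settled_bath v f \<sigma> = (if v \<in> frozen then f (settle v \<sigma>) else heat_bath bw v f \<sigma>)"

definition mean :: "(nat \<Rightarrow> real) set \<Rightarrow> ((nat \<Rightarrow> real) \<Rightarrow> real) \<Rightarrow> real" where
  "mean C f = (\<Sum>\<sigma>\<in>C. bw \<sigma> * f \<sigma>) / (\<Sum>\<sigma>\<in>C. bw \<sigma>)"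

definition bottoms :: "(nat \<Rightarrow> real) set set" where
  "bottoms = subcube N free ` ground"

lemma edge_at_eq: "e \<in> E \<Longrightarrow> v = fst e \<or> v = snd e \<Longrightarrow> edge_at v = e"
  unfolding edge_at_def
  by (rule the_equality) (use vertex_disjointD[OF disjoint_ED, of _ e] in blast)+

lemma frozenE:
  assumes "v \<in> frozen"
  obtains e where "e \<in> E" "v = fst e \<or> v = snd e" "edge_at v = e"
  using assms edge_at_eq by (auto simp: verts_iff)

lemma mate_fst: "e \<in> E \<Longrightarrow> mate (fst e) = snd e"
  and mate_snd: "e \<in> E \<Longrightarrow> mate (snd e) = fst e"
  using edge_at_eq[of e "fst e"] edge_at_eq[of e "snd e"] by (auto simp: mate_def)

lemma edge_neq: "e \<in> E \<Longrightarrow> fst e \<noteq> snd e"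
  using E by (auto simp: pairs_def)

lemma mate_frozen:
  assumes "v \<in> frozen" shows "mate v \<in> frozen"
proof -
  obtain e where "e \<in> E" "v = fst e \<or> v = snd e" using frozenE[OF assms] by metis
  then show ?thesis using frozen_edge mate_fst mate_snd by metis
qed

lemma sgn_heavy: "e \<in> E \<Longrightarrow> sgn (J e) = -1 \<or> sgn (J e) = 1"
  using heavy[of e] theta by (auto simp: sgn_real_def)

lemma target_spin:
  assumes "\<sigma> \<in> spins N" "v \<in> frozen"
  shows "sgn (J (edge_at v)) * \<sigma> (mate v) \<in> {-1, 1}"
proof -
  obtain e where e: "e \<in> E" "edge_at v = e" using frozenE[OF assms(2)] by metis
  have "mate v \<in> {1..N}" using mate_frozen[OF assms(2)] frozen_subset by auto
  then show ?thesis using spins_values[OF assms(1)] sgn_heavy[OF e(1)] e(2) by fastforce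
qed

lemma settle_spins: "\<sigma> \<in> spins N \<Longrightarrow> settle v \<sigma> \<in> spins N"
  unfolding settle_def using target_spin frozen_subset by (auto intro!: spins_upd)

lemma fold_settle_spins: "\<sigma> \<in> spins N \<Longrightarrow> fold settle l \<sigma> \<in> spins N"
  by (induction l arbitrary: \<sigma>) (auto simp: settle_spins)

lemma ground_iff: "\<omega> \<in> ground \<longleftrightarrow> \<omega> \<in> spins N \<and> (\<forall>e\<in>E. \<omega> (fst e) * \<omega> (snd e) = sgn (J e))"
  using E by (force simp: ground_def satisfied_def)

lemma ground_settled:
  assumes "\<sigma> \<in> ground"
  shows "settle v \<sigma> = \<sigma>"
proof (cases "v \<in> frozen")
  case True
  then obtain e where e: "e \<in> E" "v = fst e \<or> v = snd e" "edge_at v = e" by (rule frozenE)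
  have \<sigma>: "\<sigma> (fst e) * \<sigma> (snd e) = sgn (J e)" "\<sigma> \<in> spins N" using assms e by (auto simp: ground_iff)
  have "fst e \<in> {1..N}" "snd e \<in> {1..N}" using e(1) E by (auto simp: pairs_def)
  then have "\<sigma> (fst e) * \<sigma> (fst e) = 1" "\<sigma> (snd e) * \<sigma> (snd e) = 1" using spins_square[OF \<sigma>(2)] by auto
  then have "sgn (J e) * \<sigma> (snd e) = \<sigma> (fst e)" "sgn (J e) * \<sigma> (fst e) = \<sigma> (snd e)"
    unfolding \<sigma>(1)[symmetric] by (simp_all add: mult.assoc mult.left_commute[of "\<sigma> (fst e)"])
  then have "sgn (J (edge_at v)) * \<sigma> (mate v) = \<sigma> v"
    using e mate_fst[OF e(1)] mate_snd[OF e(1)] by auto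
  then show ?thesis using True by (simp add: settle_def)
qed (simp add: settle_def)

lemma subcube_ground:
  assumes "\<omega> \<in> ground" "\<sigma> \<in> subcube N free \<omega>"
  shows "\<sigma> \<in> ground"
proof -
  have "\<sigma> v = \<omega> v" if "v \<in> frozen" for v
    using assms(2) that frozen_subset by (auto simp: subcube_def)
  then show ?thesis using assms frozen_edge by (auto simp: ground_iff subcube_def)
qed

lemma settled_bath_range:
  "(\<And>\<sigma>. 0 \<le> f \<sigma> \<and> f \<sigma> \<le> 1) \<Longrightarrow> 0 \<le> settled_bath v f \<sigma> \<and> settled_bath v f \<sigma> \<le> 1"
  unfolding settled_bath_def using heat_bath_range[of bw f v \<sigma>] by auto

lemma foldr_settled_bath_range:
  "(\<And>\<sigma>. 0 \<le> f \<sigma> \<and> f \<sigma> \<le> 1) \<Longrightarrow> 0 \<le> foldr settled_bath l f \<sigma> \<and> foldr settled_bath l f \<sigma> \<le> 1"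
proof (induction l arbitrary: \<sigma>)
  case (Cons v l)
  then show ?case by (auto simp: settled_bath_range)
qed simp

lemma foldr_settled_bath_diff_const:
  "foldr settled_bath l (\<lambda>x. f x - c) = (\<lambda>x. foldr settled_bath l f x - c)"
proof -
  have "settled_bath v (\<lambda>x. g x - c) = (\<lambda>x. settled_bath v g x - c)" for v g
    by (auto simp: settled_bath_def heat_bath_diff_const)
  then show ?thesis by (induction l) simp_all
qed

text \<open>On a well the heavy edges are already satisfied, so frozen sites act as the identity,
  and free sites as conditional expectations.\<close>

lemma projections_well:
  assumes "\<omega> \<in> ground"
  shows "projections (subcube N free \<omega>) bw sites settled_bath"
proof
  interpret weighted_subcube N free \<omega> bw by unfold_locales auto
  fix v f assume "v \<in> sites"
  show "sq_norm C bw f = sq_norm C bw (settled_bath v f) + sq_norm C bw (\<lambda>\<sigma>. f \<sigma> - settled_bath v f \<sigma>)"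
  proof (cases "v \<in> frozen")
    case True
    then have "settled_bath v f \<sigma> = f \<sigma>" if "\<sigma> \<in> C" for \<sigma>
      using ground_settled[OF subcube_ground[OF assms that]] by (simp add: settled_bath_def)
    then show ?thesis by (simp add: sq_norm_def)
  next
    case False
    have v: "v \<in> free" using False \<open>v \<in> sites\<close> by simp
    have "settled_bath v f = heat_bath bw v f" using False by (simp add: settled_bath_def fun_eq_iff)
    then show ?thesis using heat_bath_pythagoras[OF v, of f] by simp
  qed
next
  fix v f g and x :: "nat \<Rightarrow> real"
  show "settled_bath v (\<lambda>y. f y - g y) x = settled_bath v f x - settled_bath v g x"
    by (simp add: settled_bath_def heat_bath_diff)
qed (auto simp: less_imp_le)

lemma sum_bw_pos: "\<omega> \<in> ground \<Longrightarrow> (\<Sum>\<sigma>\<in>subcube N free \<omega>. bw \<sigma>) > 0"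
  using ground_in_subcube[of \<omega>] by (intro sum_pos) auto

lemma card_D: "card D \<le> N"
proof -
  have "inj_on fst D"
    using vertex_disjointD[OF disjoint_ED] unfolding inj_on_def by blast
  moreover have "fst ` D \<subseteq> {1..N}" using D by (auto simp: pairs_def)
  ultimately show ?thesis using card_inj_on_le[of fst D "{1..N}"] by simp
qed

text \<open>At most \<open>N\<close> medium couplings, each of size at most \<open>K\<close>, and
  the small ones with total at most \<open>M\<close> vary over a well. The bound is crude, but it
  only has to control the passage from mean square to pointwise estimates.\<close>

lemma energy_spread:
  assumes \<omega>: "\<omega> \<in> ground" and "\<sigma> \<in> subcube N free \<omega>" "\<tau> \<in> subcube N free \<omega>"
  shows "bw \<tau> \<le> exp (2 * \<beta> * (real N * K + M)) * bw \<sigma>"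
proof -
  have st: "\<sigma> \<in> spins N" "\<tau> \<in> spins N" using assms by (auto simp: subcube_def)
  have "\<bar>\<Sum>e\<in>D. bond J \<rho> e\<bar> \<le> real N * K" if "\<rho> \<in> spins N" for \<rho>
  proof -
    have "\<bar>\<Sum>e\<in>D. bond J \<rho> e\<bar> \<le> (\<Sum>e\<in>D. \<bar>bond J \<rho> e\<bar>)" by (rule sum_abs)
    also have "\<dots> \<le> (\<Sum>e\<in>D. K)"
      using that D medium abs_bond by (intro sum_mono) (auto simp: subset_iff)
    also have "\<dots> \<le> real N * K" using card_D K by (simp add: mult_right_mono)
    finally show ?thesis .
  qed
  from this[OF st(1)] this[OF st(2)] have "H \<tau> \<le> H \<sigma> + 2 * (real N * K + M)"
    using small_part[OF st(1)] small_part[OF st(2)] heavy_part[OF \<omega>] assms(2,3)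
      hamiltonian_split[of \<sigma>] hamiltonian_split[of \<tau>] by fastforce
  then have "\<beta> * H \<tau> \<le> \<beta> * (H \<sigma> + 2 * (real N * K + M))"
    using beta by (intro mult_left_mono) auto
  then show ?thesis
    unfolding boltzmann_def exp_add[symmetric] by (simp add: algebra_simps)
qed

lemma gap_const_pos: "N > 0 \<Longrightarrow> gap_const > 0"
  by (simp add: gap_const_def)

text \<open>The first two factors under the root bound the inverse of the smallest conditional Gibbs
  weight in a well. The last one is the contraction of the squared norm over \<open>R\<close> sweeps
  with at most \<open>n\<close> updates in total.\<close>

definition mixing_error :: "real \<Rightarrow> real \<Rightarrow> real" where
  "mixing_error R n = sqrt (2 ^ N * exp (2 * \<beta> * (real N * K + M)) * exp (- (R\<^sup>2 / (n * gap_const * real N))))"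

text \<open>The function \<open>f\<close> minus its mean keeps mean zero under every update, so the
  Poincare inequality is available in every sweep. As the operators act from the right,
  \<open>r\<close> holds the updates that come last in time and act first on \<open>f\<close>; this
  incomplete sweep merely does not increase the norm.\<close>

lemma mixing:
  assumes \<omega>: "\<omega> \<in> ground" and N: "N > 0" and f: "\<And>\<sigma>. 0 \<le> f \<sigma> \<and> f \<sigma> \<le> 1"
    and blocks: "\<And>l. l \<in> set ls \<Longrightarrow> set l = sites" "ls \<noteq> []" and r: "set r \<subseteq> sites"
    and n: "real (length (concat ls)) \<le> n" and \<sigma>: "\<sigma> \<in> subcube N free \<omega>"
  shows "\<bar>foldr settled_bath (concat ls @ r) f \<sigma> - mean (subcube N free \<omega>) f\<bar>
    \<le> mixing_error (real (length ls)) n"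
proof -
  interpret C: weighted_subcube N free \<omega> bw by unfold_locales auto
  interpret projections C.C bw sites settled_bath by (rule projections_well[OF \<omega>])
  define Z where "Z = (\<Sum>\<sigma>\<in>C.C. bw \<sigma>)"
  have Z: "Z > 0" unfolding Z_def by (rule sum_bw_pos[OF \<omega>])
  define m where "m = mean C.C f"
  define P where "P g \<longleftrightarrow> (\<Sum>\<sigma>\<in>C.C. bw \<sigma> * g \<sigma>) = 0" for g :: "(nat \<Rightarrow> real) \<Rightarrow> real"
  have Pf: "P (\<lambda>x. f x - m)"
    unfolding P_def m_def mean_def Z_def[symmetric] right_diff_distrib sum_subtractf
      sum_distrib_right[symmetric] using Z by simp
  have PT: "P (settled_bath v g)" if "v \<in> sites" "P g" for v g
  proof (cases "v \<in> frozen")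
    case True
    then have "settled_bath v g \<sigma> = g \<sigma>" if "\<sigma> \<in> C.C" for \<sigma>
      using ground_settled[OF subcube_ground[OF \<omega> that]] by (simp add: settled_bath_def)
    then show ?thesis using \<open>P g\<close> by (simp add: P_def)
  next
    case False
    then have "settled_bath v g = heat_bath bw v g" "v \<in> free" using that
      by (simp_all add: settled_bath_def fun_eq_iff)
    then show ?thesis using C.sum_heat_bath[of v g] that by (simp add: P_def)
  qed
  have Pr: "P (foldr settled_bath r (\<lambda>x. f x - m))"
    using r by (induction r) (auto simp: Pf PT)
  have poin: "sq g \<le> gap_const * (\<Sum>v\<in>sites. sq (\<lambda>x. g x - settled_bath v g x))" if "P g" for g
  proof -
    have "sq g \<le> gap_const * (\<Sum>v\<in>free. sq (\<lambda>x. g x - heat_bath bw v g x))"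
      using poincare[OF \<omega>, of g] that by (simp add: P_def)
    also have "\<dots> = gap_const * (\<Sum>v\<in>free. sq (\<lambda>x. g x - settled_bath v g x))"
      by (intro arg_cong[where f = "\<lambda>x. gap_const * x"] sum.cong) (auto simp: settled_bath_def)
    also have "\<dots> \<le> gap_const * (\<Sum>v\<in>sites. sq (\<lambda>x. g x - settled_bath v g x))"
      using gap_const_pos[OF N] by (intro mult_left_mono sum_mono2)
        (auto intro!: sq_norm_nonneg simp: less_imp_le)
    finally show ?thesis .
  qed
  define R where "R = real (length ls)"
  have R: "R > 0" using blocks by (simp add: R_def)
  have lenpos: "length (concat ls) > 0"
  proof -
    obtain l ls' where "ls = l # ls'" using blocks(2) by (cases ls) auto
    then have "set l = sites" using blocks(1) by auto
    then have "l \<noteq> []" using N by auto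
    then show ?thesis using \<open>ls = l # ls'\<close> by simp
  qed
  have npos: "n > 0" using lenpos n by linarith
  \<comment> \<open>The mean sweep length allowed by \<open>n\<close> is the best tangent point: it
    turns \<open>2 * R / B - n / B\<^sup>2\<close> into \<open>R\<^sup>2 / n\<close>.\<close>
  define B where "B = n / R"
  have B: "B > 0" using npos R by (simp add: B_def)
  define g where "g = foldr settled_bath (concat ls @ r) (\<lambda>x. f x - m)"
  have "sq g \<le> exp (- (2 * R / B - real (length (concat ls)) / B\<^sup>2) / (gap_const * real (card sites)))
      * sq (foldr settled_bath r (\<lambda>x. f x - m))"
    unfolding g_def R_def
    using sq_foldr_blocks_le[of P gap_const "foldr settled_bath r (\<lambda>x. f x - m)" B ls,
        OF poin PT Pr gap_const_pos[OF N] B _ blocks(1)] N by simp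
  also have "\<dots> \<le> exp (- (R\<^sup>2 / (n * gap_const * real N))) * sq (foldr settled_bath r (\<lambda>x. f x - m))"
  proof (rule mult_right_mono[OF _ sq_nonneg])
    have "R\<^sup>2 / n = 2 * R / B - n / B\<^sup>2"
      using npos R by (simp add: B_def power2_eq_square field_simps)
    also have "\<dots> \<le> 2 * R / B - real (length (concat ls)) / B\<^sup>2"
      using n B by (intro diff_mono divide_right_mono) auto
    finally have "R\<^sup>2 / n / (gap_const * real N) \<le> (2 * R / B - real (length (concat ls)) / B\<^sup>2) / (gap_const * real N)"
      using gap_const_pos[OF N] by (intro divide_right_mono) auto
    then show "exp (- (2 * R / B - real (length (concat ls)) / B\<^sup>2) / (gap_const * real (card sites)))
        \<le> exp (- (R\<^sup>2 / (n * gap_const * real N)))"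
      unfolding minus_divide_left[symmetric] exp_le_cancel_iff neg_le_iff_le by (simp add: mult.assoc)
  qed
  also have "\<dots> \<le> exp (- (R\<^sup>2 / (n * gap_const * real N))) * sq (\<lambda>x. f x - m)"
    by (intro mult_left_mono sq_foldr_le r) auto
  also have "\<dots> \<le> exp (- (R\<^sup>2 / (n * gap_const * real N))) * Z"
  proof (intro mult_left_mono)
    have "0 \<le> m \<and> m \<le> 1"
    proof -
      have "0 \<le> (\<Sum>\<sigma>\<in>C.C. bw \<sigma> * f \<sigma>)" using f by (intro sum_nonneg) (auto simp: less_imp_le)
      moreover have "(\<Sum>\<sigma>\<in>C.C. bw \<sigma> * f \<sigma>) \<le> Z" unfolding Z_def
        using f by (intro sum_mono) (simp add: mult_left_le less_imp_le)
      ultimately show ?thesis using Z unfolding m_def mean_def Z_def[symmetric] by simp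
    qed
    then have "\<bar>f x - m\<bar> \<le> 1" for x using f[of x] by auto
    then have "(f x - m)\<^sup>2 \<le> 1" for x by (simp add: abs_square_le_1)
    then show "sq (\<lambda>x. f x - m) \<le> Z"
      unfolding sq_norm_def Z_def by (intro sum_mono) (simp add: mult_left_le less_imp_le)
  qed auto
  finally have sqg: "sq g \<le> exp (- (R\<^sup>2 / (n * gap_const * real N))) * Z" .
  \<comment> \<open>A single term of the weighted norm; dividing by its weight, which is not too
    small compared with \<open>Z\<close>, gives the pointwise bound.\<close>
  have "bw \<sigma> * (g \<sigma>)\<^sup>2 \<le> sq g"
    unfolding sq_norm_def by (rule member_le_sum) (use \<sigma> in \<open>auto simp: less_imp_le\<close>)
  also note sqg
  also have "Z \<le> 2 ^ N * (exp (2 * \<beta> * (real N * K + M)) * bw \<sigma>)"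
  proof -
    have "Z \<le> (\<Sum>\<tau>\<in>C.C. exp (2 * \<beta> * (real N * K + M)) * bw \<sigma>)"
      unfolding Z_def by (intro sum_mono energy_spread[OF \<omega> \<sigma>])
    also have "\<dots> = real (card C.C) * (exp (2 * \<beta> * (real N * K + M)) * bw \<sigma>)" by simp
    also have "\<dots> \<le> 2 ^ N * (exp (2 * \<beta> * (real N * K + M)) * bw \<sigma>)"
    proof (rule mult_right_mono)
      have "card C.C \<le> card (spins N)" using finite_spins
        by (intro card_mono) (auto simp: subcube_def)
      also have "\<dots> = 2 ^ N" by (simp add: spins_def card_PiE numeral_2_eq_2)
      finally show "real (card C.C) \<le> 2 ^ N" by (metis of_nat_le_iff of_nat_numeral of_nat_power)
    qed (simp add: less_imp_le)
    finally show ?thesis .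
  qed
  finally have "bw \<sigma> * (g \<sigma>)\<^sup>2 \<le> exp (- (R\<^sup>2 / (n * gap_const * real N))) *
      (2 ^ N * (exp (2 * \<beta> * (real N * K + M)) * bw \<sigma>))" by simp
  then have "bw \<sigma> * (g \<sigma>)\<^sup>2 \<le> bw \<sigma> *
      (2 ^ N * exp (2 * \<beta> * (real N * K + M)) * exp (- (R\<^sup>2 / (n * gap_const * real N))))"
    by (simp add: algebra_simps)
  then have "(g \<sigma>)\<^sup>2 \<le> 2 ^ N * exp (2 * \<beta> * (real N * K + M)) * exp (- (R\<^sup>2 / (n * gap_const * real N)))"
    using boltzmann_pos[of \<beta> N J \<sigma>] by (simp only: mult_le_cancel_left_pos)
  then have "\<bar>g \<sigma>\<bar> \<le> mixing_error R n"
    unfolding mixing_error_def by (rule real_le_rsqrt[of "\<bar>g \<sigma>\<bar>", unfolded power2_abs])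
  then show ?thesis
    unfolding g_def R_def m_def by (simp add: foldr_settled_bath_diff_const del: foldr_append)
qed

end

section \<open>Comparison of the heat bath with the settled dynamics\<close>

context separated_couplings begin

definition frozen_error :: real where
  "frozen_error = exp (- (2 * \<beta> * (\<theta> - M)))"

text \<open>Heavy and medium edges are vertex-disjoint, so flipping a frozen spin changes only one
  of them, the heavy edge at \<open>v\<close>, by \<open>2 * \<bar>J e\<bar>\<close>. The small
  couplings make up for at most \<open>2 * M\<close>, being bounded by \<open>M\<close> in either
  configuration.\<close>

lemma frozen_flip_energy:
  assumes \<sigma>: "\<sigma> \<in> spins N" and v: "v \<in> frozen"
  defines "s \<equiv> sgn (J (edge_at v)) * \<sigma> (mate v)"
  shows "H (\<sigma>(v := - s)) \<le> H (\<sigma>(v := s)) - 2 * (\<theta> - M)"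
proof -
  obtain e where e: "e \<in> E" "v = fst e \<or> v = snd e" "edge_at v = e" using frozenE[OF v] .
  have s: "s \<in> {-1, 1}" unfolding s_def by (rule target_spin[OF \<sigma> v])
  have vs: "v \<in> {1..N}" using v frozen_subset by auto
  define good bad where "good = \<sigma>(v := s)" "bad = \<sigma>(v := - s)"
  have gb: "good \<in> spins N" "bad \<in> spins N"
    unfolding good_bad_def using s by (auto intro!: spins_upd[OF \<sigma> vs])
  have mate: "mate v \<in> {1..N}" "mate v \<noteq> v"
    using mate_frozen[OF v] frozen_subset mate_fst[OF e(1)] mate_snd[OF e(1)] edge_neq[OF e(1)] e(2) by auto
  have other: "bond J good e' = bond J bad e'" if "e' \<in> E \<union> D" "e' \<noteq> e" for e'
  proof -
    have "{fst e', snd e'} \<inter> {fst e, snd e} = {}"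
      using vertex_disjointD[OF disjoint_ED, of e' e] that e(1) by auto
    then have "fst e' \<noteq> v" "snd e' \<noteq> v" using e(2) by auto
    then show ?thesis by (simp add: bond_def good_bad_def)
  qed
  have "\<sigma> (mate v) * \<sigma> (mate v) = 1" by (rule spins_square[OF \<sigma> mate(1)])
  then have sm: "s * \<sigma> (mate v) = sgn (J e)" by (simp add: s_def e(3) mult.assoc)
  have "good (fst e) * good (snd e) = s * \<sigma> (mate v) \<and> bad (fst e) * bad (snd e) = - (s * \<sigma> (mate v))"
    using e(2)
  proof
    assume "v = fst e"
    then show ?thesis using mate(2) mate_fst[OF e(1)] by (simp add: good_bad_def)
  next
    assume "v = snd e"
    then show ?thesis using mate(2) mate_snd[OF e(1)] by (simp add: good_bad_def)
  qed
  then have bg: "bond J good e = \<bar>J e\<bar>" and bb: "bond J bad e = - \<bar>J e\<bar>"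
    unfolding sm by (simp_all add: bond_def abs_sgn)
  have ED_eq: "(\<Sum>e'\<in>D. bond J good e') = (\<Sum>e'\<in>D. bond J bad e')"
    by (intro sum.cong refl other) (use ED e(1) in auto)
  have "(\<Sum>e'\<in>E. bond J good e') = bond J good e + (\<Sum>e'\<in>E - {e}. bond J good e')"
    using finite_E e(1) by (rule sum.remove)
  also have "(\<Sum>e'\<in>E - {e}. bond J good e') = (\<Sum>e'\<in>E - {e}. bond J bad e')"
    by (intro sum.cong refl other) auto
  finally have "(\<Sum>e'\<in>E. bond J good e') = 2 * \<bar>J e\<bar> + (\<Sum>e'\<in>E. bond J bad e')"
    using sum.remove[OF finite_E e(1), of "bond J bad"] bg bb by simp
  then have "H good \<ge> H bad + 2 * \<bar>J e\<bar> - 2 * M"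
    using small_part[OF gb(1)] small_part[OF gb(2)] ED_eq
      hamiltonian_split[of good] hamiltonian_split[of bad] by linarith
  moreover have "y \<le> x - 2 * (t - m)" if "x \<ge> y + 2 * c - 2 * m" "c \<ge> t" for x y t m c :: real
    using that by simp
  ultimately show ?thesis using heavy[OF e(1)] unfolding good_bad_def by blast
qed

lemma frozen_flip_prob:
  assumes \<sigma>: "\<sigma> \<in> spins N" and v: "v \<in> frozen" and f: "\<And>\<sigma>. 0 \<le> f \<sigma> \<and> f \<sigma> \<le> 1"
  shows "\<bar>heat_bath bw v f \<sigma> - f (settle v \<sigma>)\<bar> \<le> frozen_error"
proof -
  define s where "s = sgn (J (edge_at v)) * \<sigma> (mate v)"
  have s: "s \<in> {-1, 1}" unfolding s_def by (rule target_spin[OF \<sigma> v])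
  define a b where "a = bw (\<sigma>(v := s))" "b = bw (\<sigma>(v := - s))"
  have ab: "a > 0" "b > 0" by (auto simp: a_b_def)
  have "\<beta> * H (\<sigma>(v := - s)) \<le> \<beta> * (H (\<sigma>(v := s)) - 2 * (\<theta> - M))"
    using frozen_flip_energy[OF \<sigma> v] beta unfolding s_def by (intro mult_left_mono) auto
  then have "b \<le> a * frozen_error"
    unfolding a_b_def boltzmann_def frozen_error_def exp_add[symmetric] exp_le_cancel_iff
    by (simp add: algebra_simps)
  define x y where "x = f (\<sigma>(v := s))" "y = f (\<sigma>(v := - s))"
  have hb: "heat_bath bw v f \<sigma> = (a * x + b * y) / (a + b)"
    using s by (auto simp: heat_bath_def a_b_def x_y_def add.commute)
  have "heat_bath bw v f \<sigma> - x = b * (y - x) / (a + b)"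
    using ab unfolding hb by (simp add: field_simps)
  then have "\<bar>heat_bath bw v f \<sigma> - x\<bar> = b * \<bar>y - x\<bar> / (a + b)"
    using ab by (simp add: abs_mult)
  also have "\<dots> \<le> b * 1 / a"
    using ab f[of "\<sigma>(v := s)"] f[of "\<sigma>(v := - s)"]
    by (intro frac_le mult_left_mono) (auto simp: x_y_def abs_if)
  also have "\<dots> \<le> frozen_error"
    using \<open>b \<le> a * frozen_error\<close> ab by (simp add: divide_le_eq mult.commute)
  finally show ?thesis using v by (simp add: x_y_def settle_def s_def)
qed

lemma frozen_error_nonneg: "frozen_error \<ge> 0"
  by (simp add: frozen_error_def)

lemma foldr_heat_bath_range:
  "(\<And>\<sigma>. 0 \<le> f \<sigma> \<and> f \<sigma> \<le> 1) \<Longrightarrow> 0 \<le> foldr (heat_bath bw) l f \<sigma> \<and> foldr (heat_bath bw) l f \<sigma> \<le> 1"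
proof (induction l arbitrary: \<sigma>)
  case (Cons v l)
  then show ?case by (auto simp: heat_bath_range)
qed simp

text \<open>The updates are replaced one at a time. A heat bath is an average and does not increase
  the supremum distance, and each replacement at a frozen site adds at most
  \<open>frozen_error\<close>.\<close>

lemma foldr_heat_bath_error:
  assumes f: "\<And>\<sigma>. 0 \<le> f \<sigma> \<and> f \<sigma> \<le> 1" and g: "\<And>\<sigma>. 0 \<le> g \<sigma> \<and> g \<sigma> \<le> 1"
    and fg: "\<And>\<sigma>. \<sigma> \<in> spins N \<Longrightarrow> \<bar>f \<sigma> - g \<sigma>\<bar> \<le> d"
  shows "set l \<subseteq> sites \<Longrightarrow> \<sigma> \<in> spins N \<Longrightarrow>
    \<bar>foldr (heat_bath bw) l f \<sigma> - foldr settled_bath l g \<sigma>\<bar> \<le> d + real (length l) * frozen_error"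
proof (induction l arbitrary: \<sigma>)
  case Nil
  then show ?case using fg by simp
next
  case (Cons v l)
  define F where "F = foldr (heat_bath bw) l f"
  define G where "G = foldr settled_bath l g"
  define b where "b = d + real (length l) * frozen_error"
  have IH: "\<bar>F \<tau> - G \<tau>\<bar> \<le> b" if "\<tau> \<in> spins N" for \<tau>
    using Cons that by (auto simp: F_def G_def b_def)
  have v: "v \<in> {1..N}" using Cons by auto
  have up: "\<sigma>(v := 1) \<in> spins N" "\<sigma>(v := -1) \<in> spins N"
    by (rule spins_upd[OF Cons.prems(2) v], simp)+
  have 1: "\<bar>heat_bath bw v F \<sigma> - heat_bath bw v G \<sigma>\<bar> \<le> b"
    using heat_bath_near[of bw "\<lambda>x. F x - G x" \<sigma> v 0 b] IH[OF up(1)] IH[OF up(2)]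
    by (simp add: heat_bath_diff)
  have 2: "\<bar>heat_bath bw v G \<sigma> - settled_bath v G \<sigma>\<bar> \<le> frozen_error"
  proof (cases "v \<in> frozen")
    case True
    then show ?thesis
      using frozen_flip_prob[OF Cons.prems(2) True, of G] foldr_settled_bath_range[of g l] g
      by (simp add: settled_bath_def G_def)
  qed (simp add: settled_bath_def frozen_error_nonneg)
  show ?case using 1 2 by (simp add: F_def[symmetric] G_def[symmetric] b_def algebra_simps)
qed

definition edge_ok :: "(nat \<Rightarrow> real) \<Rightarrow> nat \<times> nat \<Rightarrow> bool" where
  "edge_ok \<sigma> e \<longleftrightarrow> \<sigma> (fst e) * \<sigma> (snd e) = sgn (J e)"

lemma settle_edge_ok:
  assumes \<sigma>: "\<sigma> \<in> spins N" and e: "e \<in> E" "v = fst e \<or> v = snd e"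
  shows "edge_ok (settle v \<sigma>) e"
proof -
  have v: "v \<in> frozen" using e frozen_edge[OF e(1)] by auto
  have "mate v \<in> {1..N}" using mate_frozen[OF v] frozen_subset by auto
  then have "\<sigma> (mate v) * \<sigma> (mate v) = 1" by (rule spins_square[OF \<sigma>])
  then show ?thesis using e v edge_neq[OF e(1)] edge_at_eq[OF e] mate_fst[OF e(1)] mate_snd[OF e(1)]
    by (auto simp: edge_ok_def settle_def)
qed

lemma settle_keeps_edge_ok:
  assumes \<sigma>: "\<sigma> \<in> spins N" and e: "e \<in> E" and ok: "edge_ok \<sigma> e"
  shows "edge_ok (settle v \<sigma>) e"
proof (cases "v = fst e \<or> v = snd e")
  case True
  then show ?thesis by (rule settle_edge_ok[OF \<sigma> e])
next
  case False
  then show ?thesis using ok by (simp add: settle_def edge_ok_def)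
qed

lemma fold_settle_keeps: "\<sigma> \<in> spins N \<Longrightarrow> e \<in> E \<Longrightarrow> edge_ok \<sigma> e \<Longrightarrow> edge_ok (fold settle l \<sigma>) e"
  by (induction l arbitrary: \<sigma>) (auto simp: settle_spins settle_keeps_edge_ok)

text \<open>One visit to an endpoint satisfies its edge, and no later settling step can violate it
  again.\<close>

lemma fold_settle_ground:
  assumes "\<sigma> \<in> spins N" "frozen \<subseteq> set l"
  shows "fold settle l \<sigma> \<in> ground"
  unfolding ground_iff
proof (intro conjI ballI fold_settle_spins assms(1))
  fix e assume e: "e \<in> E"
  then have "fst e \<in> set l" using frozen_edge[OF e] assms(2) by auto
  then obtain l1 l2 where l: "l = l1 @ fst e # l2" by (meson split_list)
  have "edge_ok (settle (fst e) (fold settle l1 \<sigma>)) e"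
    by (rule settle_edge_ok[OF fold_settle_spins[OF assms(1)] e]) simp
  then have "edge_ok (fold settle l2 (settle (fst e) (fold settle l1 \<sigma>))) e"
    by (intro fold_settle_keeps settle_spins fold_settle_spins assms(1) e)
  then show "fold settle l \<sigma> (fst e) * fold settle l \<sigma> (snd e) = sgn (J e)"
    by (simp add: l edge_ok_def)
qed

text \<open>Frozen spins evolve autonomously, since a frozen site looks only at its mate. This makes
  the well that is reached a deterministic function of the initial configuration.\<close>

lemma fold_settle_cong:
  "(\<And>u. u \<in> frozen \<Longrightarrow> \<sigma> u = \<tau> u) \<Longrightarrow> u \<in> frozen \<Longrightarrow> fold settle l \<sigma> u = fold settle l \<tau> u"
proof (induction l arbitrary: \<sigma> \<tau>)
  case (Cons v l)
  have "fold settle l (settle v \<sigma>) u = fold settle l (settle v \<tau>) u"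
  proof (rule Cons.IH)
    fix u assume "u \<in> frozen"
    then show "settle v \<sigma> u = settle v \<tau> u"
      using Cons.prems(1)[of u] Cons.prems(1)[OF mate_frozen, of v] by (simp add: settle_def)
  qed (rule Cons.prems(2))
  then show ?case by simp
qed simp

lemma foldr_settled_bath_near:
  assumes "set l \<subseteq> sites" "\<sigma> \<in> spins N"
    "\<And>\<tau>. \<tau> \<in> spins N \<Longrightarrow> (\<And>u. u \<in> frozen \<Longrightarrow> \<tau> u = fold settle l \<sigma> u) \<Longrightarrow> \<bar>h \<tau> - c\<bar> \<le> d"
  shows "\<bar>foldr settled_bath l h \<sigma> - c\<bar> \<le> d"
  using assms
proof (induction l arbitrary: \<sigma>)
  case Nil
  then show ?case by simp
next
  case (Cons v l)
  show ?case
  proof (cases "v \<in> frozen")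
    case True
    then show ?thesis
      using Cons.IH[of "settle v \<sigma>"] Cons.prems settle_spins by (simp add: settled_bath_def)
  next
    case False
    have v: "v \<in> {1..N}" using Cons.prems by auto
    \<comment> \<open>Both outcomes of a free update lead to the same frozen spins later, so the
      induction hypothesis applies to each.\<close>
    have "\<bar>foldr settled_bath l h (\<sigma>(v := x)) - c\<bar> \<le> d" if "x \<in> {-1, 1}" for x
    proof (rule Cons.IH)
      show "set l \<subseteq> sites" using Cons.prems by auto
      show "\<sigma>(v := x) \<in> spins N" by (rule spins_upd[OF Cons.prems(2) v that])
      fix \<tau> assume \<tau>: "\<tau> \<in> spins N" "\<And>u. u \<in> frozen \<Longrightarrow> \<tau> u = fold settle l (\<sigma>(v := x)) u"
      have "\<tau> u = fold settle (v # l) \<sigma> u" if "u \<in> frozen" for u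
        using \<tau>(2)[OF that] fold_settle_cong[of "\<sigma>(v := x)" \<sigma> u l] False that
        by (simp add: settle_def) (metis fun_upd_other)
      then show "\<bar>h \<tau> - c\<bar> \<le> d" using Cons.prems(3) \<tau>(1) by blast
    qed
    then have "\<bar>heat_bath bw v (foldr settled_bath l h) \<sigma> - c\<bar> \<le> d"
      by (intro heat_bath_near) auto
    then show ?thesis using False by (simp add: settled_bath_def[of v])
  qed
qed

lemma settle_gauge:
  assumes "\<And>e. e \<in> E \<Longrightarrow> \<epsilon> (fst e) = \<epsilon> (snd e)"
  shows "settle v (\<lambda>u. \<epsilon> u * \<sigma> u) = (\<lambda>u. \<epsilon> u * settle v \<sigma> u)"
proof (cases "v \<in> frozen")
  case True
  then obtain e where e: "e \<in> E" "v = fst e \<or> v = snd e" "edge_at v = e" by (rule frozenE)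
  have "\<epsilon> (mate v) = \<epsilon> v" using e mate_fst mate_snd assms by metis
  then show ?thesis using True by (auto simp: settle_def fun_eq_iff)
qed (simp add: settle_def)

lemma fold_settle_gauge:
  assumes "\<And>e. e \<in> E \<Longrightarrow> \<epsilon> (fst e) = \<epsilon> (snd e)"
  shows "fold settle l (\<lambda>u. \<epsilon> u * \<sigma> u) = (\<lambda>u. \<epsilon> u * fold settle l \<sigma> u)"
  by (induction l arbitrary: \<sigma>) (simp_all add: settle_gauge[OF assms])

lemma subcube_eq_iff:
  assumes "\<omega> \<in> spins N" "\<omega>' \<in> spins N"
  shows "subcube N free \<omega> = subcube N free \<omega>' \<longleftrightarrow> (\<forall>u\<in>frozen. \<omega> u = \<omega>' u)"
proof
  assume "subcube N free \<omega> = subcube N free \<omega>'"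
  then have "\<omega> \<in> subcube N free \<omega>'" using assms(1) by (auto simp: subcube_def)
  then show "\<forall>u\<in>frozen. \<omega> u = \<omega>' u" using frozen_subset by (auto simp: subcube_def)
qed (use frozen_subset in \<open>auto simp: subcube_def\<close>)

text \<open>Multiplying a configuration by \<open>\<omega>\<^sub>1 \<omega>\<^sub>2\<close> on the frozen sites commutes with settling, so every
  well is reached from the same number of initial configurations.\<close>

lemma card_settling:
  assumes "\<omega>1 \<in> ground" "\<omega>2 \<in> ground"
  shows "card {\<sigma> \<in> spins N. subcube N free (fold settle l \<sigma>) = subcube N free \<omega>1} \<le>
    card {\<sigma> \<in> spins N. subcube N free (fold settle l \<sigma>) = subcube N free \<omega>2}"
proof -
  define \<epsilon> where "\<epsilon> u = (if u \<in> frozen then \<omega>1 u * \<omega>2 u else 1)" for u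
  define g where "g \<sigma> = (\<lambda>u. \<epsilon> u * \<sigma> u)" for \<sigma> :: "nat \<Rightarrow> real"
  have sp: "\<omega>1 \<in> spins N" "\<omega>2 \<in> spins N" using assms by (auto simp: ground_iff)
  have eps: "\<epsilon> u \<in> {-1, 1}" for u
  proof (cases "u \<in> frozen")
    case True
    then have "u \<in> {1..N}" using frozen_subset by blast
    from spins_values[OF sp(1) this] spins_values[OF sp(2) this] show ?thesis by (auto simp: \<epsilon>_def)
  qed (simp add: \<epsilon>_def)
  \<comment> \<open>Both ground configurations satisfy \<open>e\<close>, so their products over its
    two ends agree; hence \<omega>1 \<omega>2 takes the same value at both ends.\<close>
  have comm: "\<epsilon> (fst e) = \<epsilon> (snd e)" if e: "e \<in> E" for e
  proof -
    have "fst e \<in> {1..N}" "snd e \<in> {1..N}" using e E by (auto simp: pairs_def)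
    then have "\<omega>1 (fst e) \<in> {-1, 1}" "\<omega>1 (snd e) \<in> {-1, 1}" "\<omega>2 (fst e) \<in> {-1, 1}" "\<omega>2 (snd e) \<in> {-1, 1}"
      using spins_values[OF sp(1)] spins_values[OF sp(2)] by auto
    moreover have "\<omega>1 (fst e) * \<omega>1 (snd e) = \<omega>2 (fst e) * \<omega>2 (snd e)"
      using assms e by (simp add: ground_iff)
    ultimately show ?thesis using frozen_edge[OF e] by (auto simp: \<epsilon>_def)
  qed
  have gg: "g (g \<sigma>) = \<sigma>" for \<sigma>
  proof
    fix u show "g (g \<sigma>) u = \<sigma> u" using eps[of u] by (auto simp: g_def)
  qed
  have gs: "g \<sigma> \<in> spins N" if "\<sigma> \<in> spins N" for \<sigma>
    unfolding spins_def
  proof (rule PiE_I)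
    fix u assume "u \<in> {1..N}"
    then show "g \<sigma> u \<in> {-1, 1}" using eps[of u] spins_values[OF that] by (fastforce simp: g_def)
  next
    fix u assume "u \<notin> {1..N}"
    then show "g \<sigma> u = undefined"
      using that frozen_subset by (auto simp: g_def \<epsilon>_def spins_def PiE_iff extensional_def)
  qed
  have "g ` {\<sigma> \<in> spins N. subcube N free (fold settle l \<sigma>) = subcube N free \<omega>1}
      \<subseteq> {\<sigma> \<in> spins N. subcube N free (fold settle l \<sigma>) = subcube N free \<omega>2}"
  proof clarify
    fix \<sigma> assume \<sigma>: "\<sigma> \<in> spins N" and eq: "subcube N free (fold settle l \<sigma>) = subcube N free \<omega>1"
    have "\<forall>u\<in>frozen. fold settle l \<sigma> u = \<omega>1 u"
      using eq subcube_eq_iff[OF fold_settle_spins[OF \<sigma>] sp(1)] by simp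
    moreover have "fold settle l (g \<sigma>) = (\<lambda>u. \<epsilon> u * fold settle l \<sigma> u)"
      unfolding g_def by (rule fold_settle_gauge) (rule comm)
    ultimately have "\<forall>u\<in>frozen. fold settle l (g \<sigma>) u = \<epsilon> u * \<omega>1 u" by simp
    also have "\<epsilon> u * \<omega>1 u = \<omega>2 u" if "u \<in> frozen" for u
      using spins_square[OF sp(1) subsetD[OF frozen_subset that]] that by (simp add: \<epsilon>_def)
    then have "(\<forall>u\<in>frozen. fold settle l (g \<sigma>) u = \<epsilon> u * \<omega>1 u) =
        (\<forall>u\<in>frozen. fold settle l (g \<sigma>) u = \<omega>2 u)" by simp
    finally show "g \<sigma> \<in> spins N \<and> subcube N free (fold settle l (g \<sigma>)) = subcube N free \<omega>2"
      using subcube_eq_iff[OF fold_settle_spins[OF gs[OF \<sigma>]] sp(2)] gs[OF \<sigma>] by simp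
  qed
  then show ?thesis
    using finite_spins by (intro card_inj_on_le[of g]) (auto intro!: inj_onI dest: arg_cong[of _ _ g] simp: gg)
qed

lemma finite_bottoms: "finite bottoms"
  unfolding bottoms_def ground_def using finite_spins by auto

text \<open>Applying \<open>card_settling\<close> in both directions shows that the map from initial
  configurations to wells has fibres of one common size \<open>m\<close>.\<close>

lemma average_over_wells:
  fixes G :: "(nat \<Rightarrow> real) set \<Rightarrow> real"
  assumes l: "frozen \<subseteq> set l"
  shows "(\<Sum>\<sigma>\<in>spins N. G (subcube N free (fold settle l \<sigma>))) / real (card (spins N))
    = (\<Sum>C\<in>bottoms. G C) / real (card bottoms)"
proof -
  define \<kappa> where "\<kappa> \<sigma> = subcube N free (fold settle l \<sigma>)" for \<sigma>
  have img: "\<kappa> ` spins N \<subseteq> bottoms" using fold_settle_ground[OF _ l] by (auto simp: \<kappa>_def bottoms_def)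
  obtain \<sigma>0 where \<sigma>0: "\<sigma>0 \<in> spins N" using spins_nonempty by auto
  define m where "m = card {\<sigma> \<in> spins N. \<kappa> \<sigma> = \<kappa> \<sigma>0}"
  have m: "card {\<sigma> \<in> spins N. \<kappa> \<sigma> = C} = m" if "C \<in> bottoms" for C
  proof -
    obtain \<omega> where \<omega>: "\<omega> \<in> ground" "C = subcube N free \<omega>" using \<open>C \<in> bottoms\<close> by (auto simp: bottoms_def)
    have "fold settle l \<sigma>0 \<in> ground" by (rule fold_settle_ground[OF \<sigma>0 l])
    then show ?thesis
      using card_settling[OF \<omega>(1), of "fold settle l \<sigma>0" l] card_settling[OF _ \<omega>(1), of "fold settle l \<sigma>0" l]
      by (simp add: m_def \<kappa>_def \<omega>(2))
  qed
  have sumG: "(\<Sum>\<sigma>\<in>spins N. G (\<kappa> \<sigma>)) = real m * (\<Sum>C\<in>bottoms. G C)" for G :: "(nat \<Rightarrow> real) set \<Rightarrow> real"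
  proof -
    have "(\<Sum>\<sigma>\<in>spins N. G (\<kappa> \<sigma>)) = (\<Sum>C\<in>bottoms. \<Sum>\<sigma> | \<sigma> \<in> spins N \<and> \<kappa> \<sigma> = C. G (\<kappa> \<sigma>))"
      by (rule sum.group[symmetric]) (use img finite_spins finite_bottoms in auto)
    also have "\<dots> = (\<Sum>C\<in>bottoms. real m * G C)"
      by (intro sum.cong) (auto simp: m)
    finally show ?thesis by (simp add: sum_distrib_left)
  qed
  have "m > 0" unfolding m_def using \<sigma>0 finite_spins by (simp add: card_gt_0_iff) blast
  \<comment> \<open>The instance with constant \<open>1\<close> counts all configurations as
    \<open>m\<close> times the number of wells, so \<open>m\<close> cancels in the quotient.\<close>
  then show ?thesis
    using sumG[of G] sumG[of "\<lambda>_. 1"] by (simp add: \<kappa>_def)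
qed

lemma mean_near:
  assumes \<omega>: "\<omega> \<in> ground" and "\<And>\<sigma>. \<sigma> \<in> subcube N free \<omega> \<Longrightarrow> \<bar>f \<sigma> - g \<sigma>\<bar> \<le> d"
  shows "\<bar>mean (subcube N free \<omega>) f - mean (subcube N free \<omega>) g\<bar> \<le> d"
proof -
  define Z where "Z = (\<Sum>\<sigma>\<in>subcube N free \<omega>. bw \<sigma>)"
  have Z: "Z > 0" unfolding Z_def by (rule sum_bw_pos[OF assms(1)])
  have "\<bar>(\<Sum>\<sigma>\<in>subcube N free \<omega>. bw \<sigma> * f \<sigma>) - (\<Sum>\<sigma>\<in>subcube N free \<omega>. bw \<sigma> * g \<sigma>)\<bar>
      \<le> (\<Sum>\<sigma>\<in>subcube N free \<omega>. \<bar>bw \<sigma> * (f \<sigma> - g \<sigma>)\<bar>)"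
    unfolding sum_subtractf[symmetric] right_diff_distrib[symmetric] by (rule sum_abs)
  also have "\<dots> \<le> (\<Sum>\<sigma>\<in>subcube N free \<omega>. bw \<sigma> * d)"
    using assms(2) by (intro sum_mono) (simp add: abs_mult abs_of_pos mult_left_mono less_imp_le)
  also have "\<dots> = Z * d" by (simp add: Z_def sum_distrib_right)
  finally show ?thesis
    using Z unfolding mean_def Z_def[symmetric] diff_divide_distrib[symmetric]
    by (simp add: abs_divide divide_le_eq mult.commute)
qed

text \<open>The sweep \<open>a\<close> selects the well, \<open>ls1\<close> mixes inside it before
  the first time, and \<open>ls2\<close> mixes again between the two times. In \<open>F x\<close>
  the state \<open>x\<close> at the first time stays a parameter while the second argument
  evolves.\<close>

lemma two_time_bound:
  fixes F :: "(nat \<Rightarrow> real) \<Rightarrow> (nat \<Rightarrow> real) \<Rightarrow> real"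
  assumes N: "N > 0" and F: "\<And>\<sigma> \<tau>. 0 \<le> F \<sigma> \<tau> \<and> F \<sigma> \<tau> \<le> 1"
    and a: "set a = sites"
    and b1: "\<And>l. l \<in> set ls1 \<Longrightarrow> set l = sites" "ls1 \<noteq> []" and r1: "set r1 \<subseteq> sites"
    and b2: "\<And>l. l \<in> set ls2 \<Longrightarrow> set l = sites" "ls2 \<noteq> []" and r2: "set r2 \<subseteq> sites"
    and n: "real (length (a @ concat ls1 @ r1) + length (concat ls2 @ r2)) \<le> n"
  shows "\<bar>(\<Sum>\<sigma>\<in>spins N. foldr (heat_bath bw) (a @ concat ls1 @ r1)
        (\<lambda>x. foldr (heat_bath bw) (concat ls2 @ r2) (F x) x) \<sigma>) / real (card (spins N))
      - (\<Sum>C\<in>bottoms. mean C (\<lambda>x. mean C (F x))) / real (card bottoms)\<bar>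
    \<le> n * frozen_error + mixing_error (real (length ls1)) n + mixing_error (real (length ls2)) n"
proof -
  define l1 l2 where "l1 = a @ concat ls1 @ r1" "l2 = concat ls2 @ r2"
  \<comment> \<open>The expectation of the observable given the state at the first time, for the
    settled dynamics.\<close>
  define h where "h x = foldr settled_bath l2 (F x) x" for x
  define d1 d2 where "d1 = mixing_error (real (length ls1)) n" "d2 = mixing_error (real (length ls2)) n"
  have l: "set l1 \<subseteq> sites" "set l2 \<subseteq> sites" using a b1 b2 r1 r2 by (auto simp: l1_l2_def)
  have hr: "0 \<le> h x \<and> h x \<le> 1" for x
    unfolding h_def by (rule foldr_settled_bath_range) (rule F)
  have step1: "\<bar>foldr (heat_bath bw) l1 (\<lambda>x. foldr (heat_bath bw) l2 (F x) x) \<sigma> - foldr settled_bath l1 h \<sigma>\<bar>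
      \<le> n * frozen_error" if \<sigma>: "\<sigma> \<in> spins N" for \<sigma>
  proof -
    have "\<bar>foldr (heat_bath bw) l1 (\<lambda>x. foldr (heat_bath bw) l2 (F x) x) \<sigma> - foldr settled_bath l1 h \<sigma>\<bar>
      \<le> real (length l2) * frozen_error + real (length l1) * frozen_error"
    proof (rule foldr_heat_bath_error[OF _ _ _ l(1) \<sigma>])
      show "\<bar>foldr (heat_bath bw) l2 (F \<tau>) \<tau> - h \<tau>\<bar> \<le> real (length l2) * frozen_error"
        if "\<tau> \<in> spins N" for \<tau>
        unfolding h_def using foldr_heat_bath_error[of "F \<tau>" "F \<tau>" 0, OF F F _ l(2) that] by simp
      show "0 \<le> foldr (heat_bath bw) l2 (F \<tau>) \<tau> \<and> foldr (heat_bath bw) l2 (F \<tau>) \<tau> \<le> 1" for \<tau>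
        by (rule foldr_heat_bath_range) (rule F)
    qed (rule hr)
    also have "\<dots> = real (length l1 + length l2) * frozen_error" by (simp add: algebra_simps)
    also have "\<dots> \<le> n * frozen_error"
      using n frozen_error_nonneg by (intro mult_right_mono) (auto simp: l1_l2_def)
    finally show ?thesis .
  qed
  have step2: "\<bar>foldr settled_bath l1 h \<sigma> -
      mean (subcube N free (fold settle a \<sigma>)) (\<lambda>x. mean (subcube N free (fold settle a \<sigma>)) (F x))\<bar>
      \<le> d1 + d2" if \<sigma>: "\<sigma> \<in> spins N" for \<sigma>
  proof -
    define \<omega> where "\<omega> = fold settle a \<sigma>"
    have \<omega>: "\<omega> \<in> ground" unfolding \<omega>_def using a frozen_subset by (intro fold_settle_ground \<sigma>) auto
    define C where "C = subcube N free \<omega>"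
    have h: "\<bar>h x - mean C (F x)\<bar> \<le> d2" if "x \<in> C" for x
      unfolding h_def l1_l2_def d1_d2_def C_def
      by (rule mixing[OF \<omega> N F b2 r2]) (use n that in \<open>auto simp: C_def\<close>)
    have "\<bar>foldr settled_bath (concat ls1 @ r1) h x - mean C h\<bar> \<le> d1" if "x \<in> C" for x
      unfolding d1_d2_def C_def
      by (rule mixing[OF \<omega> N hr b1 r1]) (use n that in \<open>auto simp: C_def\<close>)
    \<comment> \<open>On the well, \<open>h\<close> itself is already close to the constant-in-time
      average of \<open>F x\<close>, so averaging over the first state adds another
      \<open>d2\<close> to the mixing error \<open>d1\<close>.\<close>
    moreover have "\<bar>mean C h - mean C (\<lambda>x. mean C (F x))\<bar> \<le> d2"
      unfolding C_def by (rule mean_near[OF \<omega>]) (use h C_def in auto)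
    ultimately have near: "\<bar>foldr settled_bath (concat ls1 @ r1) h x - mean C (\<lambda>x. mean C (F x))\<bar> \<le> d1 + d2"
      if "x \<in> C" for x using that by fastforce
    have "\<bar>foldr settled_bath a (foldr settled_bath (concat ls1 @ r1) h) \<sigma> - mean C (\<lambda>x. mean C (F x))\<bar> \<le> d1 + d2"
      if "\<And>\<tau>. \<tau> \<in> spins N \<Longrightarrow> (\<And>u. u \<in> frozen \<Longrightarrow> \<tau> u = fold settle a \<sigma> u) \<Longrightarrow> \<tau> \<in> C"
      by (rule foldr_settled_bath_near[OF _ \<sigma>], use a in simp, rule near, rule that)
    moreover have "\<tau> \<in> C" if "\<tau> \<in> spins N" "\<And>u. u \<in> frozen \<Longrightarrow> \<tau> u = fold settle a \<sigma> u" for \<tau>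
      using that by (auto simp: C_def subcube_def \<omega>_def)
    ultimately have "\<bar>foldr settled_bath a (foldr settled_bath (concat ls1 @ r1) h) \<sigma> - mean C (\<lambda>x. mean C (F x))\<bar> \<le> d1 + d2"
      by blast
    then show ?thesis by (simp add: l1_l2_def C_def \<omega>_def)
  qed
  define P where "P = foldr (heat_bath bw) l1 (\<lambda>x. foldr (heat_bath bw) l2 (F x) x)"
  define Q where "Q C = mean C (\<lambda>x. mean C (F x))" for C
  have avg: "(\<Sum>C\<in>bottoms. Q C) / real (card bottoms) =
      (\<Sum>\<sigma>\<in>spins N. Q (subcube N free (fold settle a \<sigma>))) / real (card (spins N))"
    using average_over_wells[of a Q] a frozen_subset by simp
  define c where "c = real (card (spins N))"
  have c: "c > 0" using finite_spins spins_nonempty by (simp add: c_def card_gt_0_iff)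
  have "\<bar>(\<Sum>\<sigma>\<in>spins N. P \<sigma>) - (\<Sum>\<sigma>\<in>spins N. Q (subcube N free (fold settle a \<sigma>)))\<bar>
      \<le> (\<Sum>\<sigma>\<in>spins N. \<bar>P \<sigma> - Q (subcube N free (fold settle a \<sigma>))\<bar>)"
    unfolding sum_subtractf[symmetric] by (rule sum_abs)
  also have "\<dots> \<le> (\<Sum>\<sigma>\<in>spins N. n * frozen_error + d1 + d2)"
  proof (rule sum_mono)
    fix \<sigma> assume "\<sigma> \<in> spins N"
    from step1[OF this] step2[OF this]
    show "\<bar>P \<sigma> - Q (subcube N free (fold settle a \<sigma>))\<bar> \<le> n * frozen_error + d1 + d2"
      unfolding P_def Q_def by linarith
  qed
  also have "\<dots> = c * (n * frozen_error + d1 + d2)" by (simp add: c_def)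
  finally show ?thesis
    using c unfolding P_def[symmetric, unfolded l1_l2_def] Q_def[symmetric] avg d1_d2_def[symmetric]
      c_def[symmetric] diff_divide_distrib[symmetric]
    by (simp add: abs_divide divide_le_eq mult.commute)
qed

text \<open>Flipping one frozen spin while its mate stays violates their heavy edge, so a path
  inside \<open>ground\<close> never changes frozen spins. Conversely, free spins can be corrected
  one at a time without leaving \<open>ground\<close>.\<close>

lemma hypercube_components_ground: "hypercube_components N ground = bottoms"
proof -
  define r where "r = {(\<sigma>, \<tau>). \<sigma> \<in> ground \<and> \<tau> \<in> ground \<and> card {v \<in> {1..N}. \<sigma> v \<noteq> \<tau> v} = 1}"
  have frozen_const: "\<sigma> u = \<tau> u" if st: "(\<sigma>, \<tau>) \<in> r" and uf: "u \<in> frozen" for \<sigma> \<tau> u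
  proof (rule ccontr)
    assume ne: "\<sigma> u \<noteq> \<tau> u"
    obtain e where e: "e \<in> E" "u = fst e \<or> u = snd e" using frozenE[OF uf] by metis
    have "card {v \<in> {1..N}. \<sigma> v \<noteq> \<tau> v} = 1" using st by (simp add: r_def)
    then obtain x where x: "{v \<in> {1..N}. \<sigma> v \<noteq> \<tau> v} = {x}" by (rule card_1_singletonE)
    have u: "u \<in> {1..N}" using uf frozen_subset by auto
    have "u \<in> {v \<in> {1..N}. \<sigma> v \<noteq> \<tau> v}" using u ne by blast
    then have "x = u" unfolding x by simp
    have m: "mate u \<noteq> u" "mate u \<in> {1..N}"
      using mate_frozen[OF uf] frozen_subset mate_fst[OF e(1)] mate_snd[OF e(1)] edge_neq[OF e(1)] e(2)
      by auto
    then have "mate u \<notin> {v \<in> {1..N}. \<sigma> v \<noteq> \<tau> v}" unfolding x \<open>x = u\<close> by simp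
    then have same: "\<sigma> (mate u) = \<tau> (mate u)" using m(2) by blast
    have "\<sigma> (mate u) * \<sigma> u = \<tau> (mate u) * \<tau> u"
      using st e mate_fst[OF e(1)] mate_snd[OF e(1)] by (auto simp: r_def ground_iff mult.commute)
    moreover have "\<sigma> (mate u) \<noteq> 0" using st spins_values[of \<sigma> N "mate u"] m(2) by (auto simp: r_def ground_iff)
    ultimately show False using same ne by simp
  qed
  have cls: "r\<^sup>* `` {\<omega>} = subcube N free \<omega>" if \<omega>: "\<omega> \<in> ground" for \<omega>
  proof
    have "\<tau> \<in> subcube N free \<omega>" if "(\<omega>, \<tau>) \<in> r\<^sup>*" for \<tau>
      using that
    proof (induction rule: rtrancl_induct)
        case base
        then show ?case by (rule ground_in_subcube[OF \<omega>])
      next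
        case (step \<rho> \<tau>)
        have "\<tau> \<in> spins N" using step.hyps(2) by (auto simp: r_def ground_iff)
        moreover have "\<tau> v = \<omega> v" if "v \<in> {1..N} - free" for v
        proof -
          have "\<rho> v = \<tau> v" by (rule frozen_const[OF step.hyps(2)]) (use that in blast)
          moreover have "\<rho> v = \<omega> v" using step.IH that unfolding subcube_def by blast
          ultimately show ?thesis by simp
        qed
        ultimately show ?case by (simp only: subcube_def mem_Collect_eq) blast
    qed
    then show "r\<^sup>* `` {\<omega>} \<subseteq> subcube N free \<omega>"
      by (intro subsetI) (simp only: Image_singleton_iff)
    have "(\<omega>', \<tau>) \<in> r\<^sup>*" if "\<omega>' \<in> ground" "\<tau> \<in> subcube N free \<omega>'" for \<omega>' \<tau>
      using that
    proof (induction "card {v \<in> {1..N}. \<omega>' v \<noteq> \<tau> v}" arbitrary: \<omega>')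
      case 0
      then have "\<omega>' = \<tau>" by (intro spins_ext[of _ N]) (auto simp: subcube_def ground_iff)
      then show ?case by simp
    next
      case (Suc n)
      define X where "X = {v \<in> {1..N}. \<omega>' v \<noteq> \<tau> v}"
      have cX: "Suc n = card X" using Suc.hyps(2) unfolding X_def .
      then have "X \<noteq> {}" by auto
      then obtain u where u: "u \<in> X" by auto
      have uf: "u \<in> free" using u Suc.prems(2) by (auto simp: X_def subcube_def)
      define \<rho> where "\<rho> = \<omega>'(u := \<tau> u)"
      have \<tau>u: "\<tau> u \<in> {-1, 1}" using spins_values[of \<tau> N u] u Suc.prems(2) by (auto simp: X_def subcube_def)
      have \<rho>C: "\<rho> \<in> subcube N free \<omega>'"
        unfolding \<rho>_def by (rule subcube_upd[OF _ ground_in_subcube[OF Suc.prems(1)] uf \<tau>u]) auto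
      have \<rho>: "\<rho> \<in> ground" by (rule subcube_ground[OF Suc.prems(1) \<rho>C])
      have "{v \<in> {1..N}. \<omega>' v \<noteq> \<rho> v} = {u}" using u by (auto simp: \<rho>_def X_def)
      then have edge: "(\<omega>', \<rho>) \<in> r" using Suc.prems(1) \<rho> by (simp add: r_def)
      have "{v \<in> {1..N}. \<rho> v \<noteq> \<tau> v} = X - {u}" by (auto simp: \<rho>_def X_def)
      then have cn: "n = card {v \<in> {1..N}. \<rho> v \<noteq> \<tau> v}"
        using cX u by (simp add: card_Diff_singleton)
      have "\<tau> \<in> subcube N free \<rho>" using Suc.prems(2) \<rho>C by (auto simp: subcube_def)
      then have "(\<rho>, \<tau>) \<in> r\<^sup>*" by (rule Suc.hyps(1)[OF cn \<rho>])
      with edge show ?case by (rule converse_rtrancl_into_rtrancl)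
    qed
    from this[OF \<omega>] show "subcube N free \<omega> \<subseteq> r\<^sup>* `` {\<omega>}"
      by (intro subsetI) (simp only: Image_singleton_iff)
  qed
  show ?thesis
    unfolding hypercube_components_def r_def[symmetric] bottoms_def quotient_def
    by (simp add: cls UNION_singleton_eq_range cong: image_cong)
qed

end

section \<open>Clocks and the Glauber dynamics\<close>

definition up_prob :: "real \<Rightarrow> nat \<Rightarrow> (nat \<times> nat \<Rightarrow> real) \<Rightarrow> nat \<Rightarrow> (nat \<Rightarrow> real) \<Rightarrow> real" where
  "up_prob \<beta> N J v \<sigma> = measure_pmf.prob
     (cond_pmf (gibbs \<beta> N J) {\<tau>. \<forall>w\<in>{1..N} - {v}. \<tau> w = \<sigma> w}) {\<tau>. \<tau> v = 1}"

lemma resample_eq: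
  "resample \<beta> N J v u \<sigma> = (if u \<le> up_prob \<beta> N J v \<sigma> then \<sigma>(v := 1) else \<sigma>(v := -1))"
  by (simp add: resample_def up_prob_def)

lemma set_gibbs: "set_pmf (gibbs \<beta> N J) = spins N"
proof -
  have "(\<Sum>\<tau>\<in>spins N. exp (\<beta> * hamiltonian N J \<tau>)) > 0"
    by (intro sum_pos finite_spins spins_nonempty) auto
  then show ?thesis by (auto simp: set_pmf_eq pmf_gibbs)
qed

lemma measure_gibbs:
  "measure (measure_pmf (gibbs \<beta> N J)) A =
    (\<Sum>\<sigma>\<in>A \<inter> spins N. boltzmann \<beta> N J \<sigma>) / (\<Sum>\<tau>\<in>spins N. boltzmann \<beta> N J \<tau>)"
proof -
  have "measure (measure_pmf (gibbs \<beta> N J)) A = measure (measure_pmf (gibbs \<beta> N J)) (A \<inter> spins N)"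
    using measure_Int_set_pmf[of "gibbs \<beta> N J" A] by (simp add: set_gibbs)
  also have "\<dots> = (\<Sum>\<sigma>\<in>A \<inter> spins N. pmf (gibbs \<beta> N J) \<sigma>)"
    by (intro measure_measure_pmf_finite) (simp add: finite_spins)
  finally show ?thesis
    by (simp add: pmf_gibbs boltzmann_def sum_divide_distrib)
qed

lemma measure_cond_pmf:
  assumes "set_pmf p \<inter> A \<noteq> {}"
  shows "measure (measure_pmf (cond_pmf p A)) B = measure (measure_pmf p) (A \<inter> B) / measure (measure_pmf p) A"
proof -
  have "emeasure (measure_pmf p) A \<noteq> 0"
    using assms by (simp add: measure_pmf.emeasure_eq_measure measure_pmf_zero_iff)
  then show ?thesis
    unfolding cond_pmf.rep_eq[OF assms] by (intro measure_uniform_measure) auto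
qed

lemma up_prob_eq:
  fixes \<beta> :: real and J :: "nat \<times> nat \<Rightarrow> real"
  assumes \<sigma>: "\<sigma> \<in> spins N" and v: "v \<in> {1..N}"
  defines "w \<equiv> boltzmann \<beta> N J"
  shows "up_prob \<beta> N J v \<sigma> = w (\<sigma>(v := 1)) / (w (\<sigma>(v := 1)) + w (\<sigma>(v := -1)))"
proof -
  define A where "A = {\<tau>. \<forall>w\<in>{1..N} - {v}. \<tau> w = \<sigma> w}"
  have A: "A \<inter> spins N = {\<sigma>(v := 1), \<sigma>(v := -1)}"
  proof
    show "A \<inter> spins N \<subseteq> {\<sigma>(v := 1), \<sigma>(v := -1)}"
    proof
      fix \<tau> assume \<tau>: "\<tau> \<in> A \<inter> spins N"
      then have "\<tau> v = -1 \<or> \<tau> v = 1" using spins_values v by blast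
      moreover have "\<tau> = \<sigma>(v := \<tau> v)"
        using \<tau> v by (intro spins_ext[of \<tau> N] spins_upd \<sigma>)
          (use calculation in \<open>auto simp: A_def\<close>)
      ultimately show "\<tau> \<in> {\<sigma>(v := 1), \<sigma>(v := -1)}" by auto
    qed
    show "{\<sigma>(v := 1), \<sigma>(v := -1)} \<subseteq> A \<inter> spins N"
      using spins_upd[OF \<sigma> v, of 1] spins_upd[OF \<sigma> v, of "-1"] by (auto simp: A_def)
  qed
  have ne: "\<sigma>(v := 1) \<noteq> \<sigma>(v := -1)" by (auto dest: fun_cong[of _ _ v])
  have A1: "(A \<inter> {\<tau>. \<tau> v = 1}) \<inter> spins N = {\<sigma>(v := 1)}"
  proof -
    have "(A \<inter> {\<tau>. \<tau> v = 1}) \<inter> spins N = {\<sigma>(v := 1), \<sigma>(v := -1)} \<inter> {\<tau>. \<tau> v = 1}"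
      using A by auto
    also have "\<dots> = {\<sigma>(v := 1)}" by auto
    finally show ?thesis .
  qed
  have "set_pmf (gibbs \<beta> N J) \<inter> A \<noteq> {}"
    unfolding set_gibbs using A by (simp add: Int_commute)
  then have "up_prob \<beta> N J v \<sigma> = measure (measure_pmf (gibbs \<beta> N J)) (A \<inter> {\<tau>. \<tau> v = 1})
      / measure (measure_pmf (gibbs \<beta> N J)) A"
    unfolding up_prob_def A_def[symmetric] by (rule measure_cond_pmf)
  moreover have "(\<Sum>\<tau>\<in>spins N. w \<tau>) > 0"
    unfolding w_def by (intro sum_pos finite_spins spins_nonempty) auto
  ultimately show ?thesis
    unfolding measure_gibbs A1 A using ne by (simp add: w_def)
qed

section \<open>Integrating out the resampling variables\<close>

definition uniform01 :: "real measure" where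
  "uniform01 = uniform_measure lborel {0..1}"

lemma prob_space_uniform01: "prob_space uniform01"
  unfolding uniform01_def by (rule prob_space_uniform_measure) auto

lemma sets_uniform01 [simp, measurable_cong]: "sets uniform01 = sets borel"
  by (simp add: uniform01_def)

lemma integral_uniform01_threshold:
  assumes "0 \<le> q" "q \<le> 1"
  shows "(\<integral>u. (if u \<le> q then x else y) \<partial>uniform01) = q * x + (1 - q) * (y::real)"
proof -
  interpret prob_space uniform01 by (rule prob_space_uniform01)
  have "measure uniform01 {..q} = q"
  proof -
    have "{0..1} \<inter> {..q} = {0..q}" using assms by auto
    then show ?thesis unfolding uniform01_def using assms by simp
  qed
  then have "(\<integral>u. (x - y) * indicator {..q} u + y \<partial>uniform01) = (x - y) * q + y"
    using prob_space by (simp add: emeasure_eq_measure)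
  moreover have "(\<lambda>u. if u \<le> q then x else y) = (\<lambda>u. (x - y) * indicator {..q} u + y)"
    by (auto simp: indicator_def)
  ultimately show ?thesis by (simp add: algebra_simps)
qed

lemma integral_resample:
  assumes \<sigma>: "\<sigma> \<in> spins N" and v: "v \<in> {1..N}"
  shows "(\<integral>u. f (resample \<beta> N J v u \<sigma>) \<partial>uniform01) = heat_bath (boltzmann \<beta> N J) v f \<sigma>"
proof -
  define a b where "a = boltzmann \<beta> N J (\<sigma>(v := 1))" "b = boltzmann \<beta> N J (\<sigma>(v := -1))"
  have ab: "a > 0" "b > 0" by (auto simp: a_b_def)
  define q where "q = up_prob \<beta> N J v \<sigma>"
  have q: "q = a / (a + b)" unfolding q_def a_b_def by (rule up_prob_eq[OF \<sigma> v])
  have "(\<integral>u. f (resample \<beta> N J v u \<sigma>) \<partial>uniform01) =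
      (\<integral>u. (if u \<le> q then f (\<sigma>(v := 1)) else f (\<sigma>(v := -1))) \<partial>uniform01)"
    by (intro Bochner_Integration.integral_cong) (auto simp: resample_eq q_def)
  also have "\<dots> = q * f (\<sigma>(v := 1)) + (1 - q) * f (\<sigma>(v := -1))"
    by (rule integral_uniform01_threshold) (use ab q in auto)
  also have "\<dots> = heat_bath (boltzmann \<beta> N J) v f \<sigma>"
  proof -
    have "1 - q = b / (a + b)" using ab q by (simp add: field_simps)
    then show ?thesis
      unfolding heat_bath_def a_b_def[symmetric] q by (simp add: add_divide_distrib)
  qed
  finally show ?thesis .
qed

lemma measurable_PiM_upd:
  assumes "i \<in> I"
  shows "(\<lambda>(x, X). X(i := x)) \<in> (M i \<Otimes>\<^sub>M PiM I M) \<rightarrow>\<^sub>M PiM I M"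
  using measurable_fun_upd[of "insert i I" I i "\<lambda>p. snd p" "M i \<Otimes>\<^sub>M PiM I M" M fst] assms
  by (simp add: case_prod_beta insert_absorb)

text \<open>Redrawing one coordinate leaves a product measure invariant. In this form independence
  can be used for one coordinate at a time without splitting the infinite product.\<close>

lemma integral_PiM_redraw:
  fixes F :: "('i \<Rightarrow> 'a) \<Rightarrow> real"
  assumes M: "\<And>i. prob_space (M i)" and i: "i \<in> I" and F[measurable]: "F \<in> borel_measurable (PiM I M)"
    and bound: "\<And>X. \<bar>F X\<bar> \<le> B"
  shows "(\<integral>X. F X \<partial>PiM I M) = (\<integral>u. (\<integral>X. F (X(i := u)) \<partial>PiM I M) \<partial>M i)"
proof -
  interpret P: product_prob_space M I by (rule product_prob_spaceI) (rule M)
  interpret Mi: prob_space "M i" by (rule M)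
  interpret pair: pair_prob_space "M i" "PiM I M" ..
  have ins: "insert i I = I" using i by auto
  have D: "distr (M i \<Otimes>\<^sub>M PiM I M) (PiM I M) (\<lambda>(x, X). X(i := x)) = PiM I M"
    using distr_pair_PiM_eq_PiM[of I M i] M ins by simp
  note [measurable] = measurable_PiM_upd[OF i, of M]
  have "(\<integral>X. F X \<partial>PiM I M) = (\<integral>p. F ((\<lambda>(x, X). X(i := x)) p) \<partial>(M i \<Otimes>\<^sub>M PiM I M))"
    by (subst D[symmetric]) (rule integral_distr, measurable)
  also have "\<dots> = (\<integral>u. (\<integral>X. F (X(i := u)) \<partial>PiM I M) \<partial>M i)"
  proof -
    have "(\<lambda>p. F ((\<lambda>(x, X). X(i := x)) p)) \<in> borel_measurable (M i \<Otimes>\<^sub>M PiM I M)"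
      by (rule measurable_compose[OF measurable_PiM_upd[OF i] F])
    then have "integrable (M i \<Otimes>\<^sub>M PiM I M) (\<lambda>p. F ((\<lambda>(x, X). X(i := x)) p))"
      using bound by (intro pair.integrable_const_bound[where B = B]) (auto intro!: AE_I2)
    from pair.integral_fst'[OF this] show ?thesis by simp
  qed
  finally show ?thesis .
qed

abbreviation labels :: "nat \<Rightarrow> (nat \<times> nat) set" where
  "labels N \<equiv> {1..N} \<times> UNIV"

definition uniforms :: "nat \<Rightarrow> (nat \<times> nat \<Rightarrow> real) measure" where
  "uniforms N = (\<Pi>\<^sub>M vk\<in>labels N. uniform01)"

definition run :: "real \<Rightarrow> nat \<Rightarrow> (nat \<times> nat \<Rightarrow> real) \<Rightarrow> (nat \<times> nat) list \<Rightarrow>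
    (nat \<times> nat \<Rightarrow> real) \<Rightarrow> (nat \<Rightarrow> real) \<Rightarrow> nat \<Rightarrow> real" where
  "run \<beta> N J ls U = fold (\<lambda>(v, k). resample \<beta> N J v (U (v, k))) ls"

lemma prob_space_uniforms: "prob_space (uniforms N)"
  unfolding uniforms_def by (intro prob_space_PiM prob_space_uniform01)

lemma run_append: "run \<beta> N J (ls @ ls') U \<sigma> = run \<beta> N J ls' U (run \<beta> N J ls U \<sigma>)"
  by (simp add: run_def)

lemma run_cong: "(\<And>x. x \<in> set ls \<Longrightarrow> U x = U' x) \<Longrightarrow> run \<beta> N J ls U \<sigma> = run \<beta> N J ls U' \<sigma>"
  by (induction ls arbitrary: \<sigma>) (auto simp: run_def)

lemma measurable_coordinate:
  "(\<lambda>U. U x) \<in> borel_measurable (uniforms N)"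
proof (cases "x \<in> labels N")
  case True
  then show ?thesis
    using measurable_component_singleton[of x "labels N" "\<lambda>_. uniform01"]
    by (simp add: uniforms_def cong: measurable_cong_sets)
next
  case False
  then have "U x = undefined" if "U \<in> space (uniforms N)" for U
    using that by (cases x) (auto simp: uniforms_def space_PiM PiE_iff extensional_def)
  then have "(\<lambda>U. U x) \<in> borel_measurable (uniforms N) \<longleftrightarrow> (\<lambda>_. undefined :: real) \<in> borel_measurable (uniforms N)"
    by (rule measurable_cong)
  then show ?thesis by simp
qed

text \<open>Each update compares one uniform variable with a threshold, so a run from a fixed
  configuration is a finite decision tree and is measurable even into the discrete space.\<close>

lemma measurable_run: "(\<lambda>U. run \<beta> N J ls U \<sigma>) \<in> uniforms N \<rightarrow>\<^sub>M count_space UNIV"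
proof (induction ls arbitrary: \<sigma>)
  case Nil
  then show ?case by (simp add: run_def)
next
  case (Cons x ls)
  obtain v k where x: "x = (v, k)" by force
  have [measurable]: "(\<lambda>U. U x) \<in> borel_measurable (uniforms N)" by (rule measurable_coordinate)
  note [measurable] = Cons.IH
  have "run \<beta> N J (x # ls) U \<sigma> = (if U x \<le> up_prob \<beta> N J v \<sigma>
      then run \<beta> N J ls U (\<sigma>(v := 1)) else run \<beta> N J ls U (\<sigma>(v := -1)))" for U
    by (simp add: run_def x resample_eq)
  then show ?case by simp
qed

lemma resample_spins:
  "\<sigma> \<in> spins N \<Longrightarrow> v \<in> {1..N} \<Longrightarrow> resample \<beta> N J v u \<sigma> \<in> spins N"
  using spins_upd[of \<sigma> N v] by (simp add: resample_eq)

lemma run_spins: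
  "\<sigma> \<in> spins N \<Longrightarrow> set ls \<subseteq> labels N \<Longrightarrow> run \<beta> N J ls U \<sigma> \<in> spins N"
  by (induction ls arbitrary: \<sigma>) (auto simp: run_def resample_spins)

text \<open>The uniform variable of the first update is redrawn; it occurs neither later in the run
  nor in \<Phi>. The observable may depend on the other variables, so that a later run can be placed
  inside \<Phi>.\<close>

lemma integral_run:
  fixes \<Phi> :: "(nat \<times> nat \<Rightarrow> real) \<Rightarrow> (nat \<Rightarrow> real) \<Rightarrow> real"
  assumes \<Phi>: "\<And>x. (\<lambda>U. \<Phi> U x) \<in> borel_measurable (uniforms N)"
    and bound: "\<And>U x. \<bar>\<Phi> U x\<bar> \<le> B"
  shows "distinct ls \<Longrightarrow> set ls \<subseteq> labels N \<Longrightarrow> \<sigma> \<in> spins N \<Longrightarrow>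
    (\<And>U i u x. i \<in> set ls \<Longrightarrow> \<Phi> (U(i := u)) x = \<Phi> U x) \<Longrightarrow>
    (\<integral>U. \<Phi> U (run \<beta> N J ls U \<sigma>) \<partial>uniforms N) =
    foldr (heat_bath (boltzmann \<beta> N J)) (map fst ls) (\<lambda>x. \<integral>U. \<Phi> U x \<partial>uniforms N) \<sigma>"
proof (induction ls arbitrary: \<sigma>)
  case Nil
  then show ?case by (simp add: run_def)
next
  case (Cons i ls)
  obtain v k where i: "i = (v, k)" by force
  have v: "v \<in> {1..N}" and il: "i \<in> labels N" using Cons.prems i by auto
  define F where "F U = \<Phi> U (run \<beta> N J (i # ls) U \<sigma>)" for U
  have F[measurable]: "F \<in> borel_measurable (uniforms N)"
    unfolding F_def
  proof (rule measurable_compose_countable'[where I = "spins N" and f = "\<lambda>x U. \<Phi> U x"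
        and g = "\<lambda>U. run \<beta> N J (i # ls) U \<sigma>"])
    show "(\<lambda>U. run \<beta> N J (i # ls) U \<sigma>) \<in> uniforms N \<rightarrow>\<^sub>M count_space (spins N)"
      by (rule measurable_count_space_extend[of _ UNIV])
         (use Cons.prems run_spins measurable_run in auto)
  qed (use \<Phi> finite_spins countable_finite in auto)
  have F_bound: "\<bar>F U\<bar> \<le> B" for U by (simp add: F_def bound)
  have F_upd: "F (U(i := u)) = \<Phi> U (run \<beta> N J ls U (resample \<beta> N J v u \<sigma>))" for U u
  proof -
    have "run \<beta> N J (i # ls) (U(i := u)) \<sigma> = run \<beta> N J ls (U(i := u)) (resample \<beta> N J v u \<sigma>)"
      by (simp add: run_def i)
    also have "\<dots> = run \<beta> N J ls U (resample \<beta> N J v u \<sigma>)"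
      by (rule run_cong) (use Cons.prems(1) in auto)
    finally show ?thesis unfolding F_def by (simp only: Cons.prems(4)[OF list.set_intros(1)])
  qed
  have "(\<integral>U. F U \<partial>uniforms N) = (\<integral>u. (\<integral>U. F (U(i := u)) \<partial>uniforms N) \<partial>uniform01)"
    unfolding uniforms_def
    by (rule integral_PiM_redraw[OF _ il, where B = B])
       (use prob_space_uniform01 F F_bound in \<open>auto simp: uniforms_def\<close>)
  also have "\<dots> = (\<integral>u. foldr (heat_bath (boltzmann \<beta> N J)) (map fst ls)
      (\<lambda>x. \<integral>U. \<Phi> U x \<partial>uniforms N) (resample \<beta> N J v u \<sigma>) \<partial>uniform01)"
    unfolding F_upd
    by (intro Bochner_Integration.integral_cong refl Cons.IH resample_spins v)
       (use Cons.prems in auto)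
  also have "\<dots> = heat_bath (boltzmann \<beta> N J) v (foldr (heat_bath (boltzmann \<beta> N J)) (map fst ls)
      (\<lambda>x. \<integral>U. \<Phi> U x \<partial>uniforms N)) \<sigma>"
    by (rule integral_resample[OF Cons.prems(3) v])
  finally show ?case by (simp add: F_def i)
qed

lemma integral_two_runs:
  assumes G: "\<And>x y. 0 \<le> G x y \<and> G x y \<le> (1::real)"
    and ls: "distinct (ls1 @ ls2)" "set (ls1 @ ls2) \<subseteq> labels N" and \<sigma>: "\<sigma> \<in> spins N"
  shows "(\<integral>U. G (run \<beta> N J ls1 U \<sigma>) (run \<beta> N J (ls1 @ ls2) U \<sigma>) \<partial>uniforms N) =
    foldr (heat_bath (boltzmann \<beta> N J)) (map fst ls1)
      (\<lambda>x. foldr (heat_bath (boltzmann \<beta> N J)) (map fst ls2) (G x) x) \<sigma>"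
proof -
  interpret prob_space "uniforms N" by (rule prob_space_uniforms)
  define \<Phi> where "\<Phi> U x = G x (run \<beta> N J ls2 U x)" for U x
  have "(\<integral>U. \<Phi> U (run \<beta> N J ls1 U \<sigma>) \<partial>uniforms N) =
    foldr (heat_bath (boltzmann \<beta> N J)) (map fst ls1) (\<lambda>x. \<integral>U. \<Phi> U x \<partial>uniforms N) \<sigma>"
  proof (rule integral_run[where B = 1])
    show "(\<lambda>U. \<Phi> U x) \<in> borel_measurable (uniforms N)" for x
      unfolding \<Phi>_def by (rule measurable_compose[OF measurable_run]) simp
    show "\<bar>\<Phi> U x\<bar> \<le> 1" for U x
      using G[of x "run \<beta> N J ls2 U x"] by (auto simp: \<Phi>_def abs_if)
    show "\<Phi> (U(i := u)) x = \<Phi> U x" if "i \<in> set ls1" for U i u x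
    proof -
      have "run \<beta> N J ls2 (U(i := u)) x = run \<beta> N J ls2 U x"
        by (rule run_cong) (use that ls in auto)
      then show ?thesis by (simp add: \<Phi>_def)
    qed
  qed (use ls \<sigma> in auto)
  also have "\<dots> = foldr (heat_bath (boltzmann \<beta> N J)) (map fst ls1)
      (\<lambda>x. foldr (heat_bath (boltzmann \<beta> N J)) (map fst ls2) (G x) x) \<sigma>"
  proof -
    have int2: "(\<integral>U. \<Phi> U x \<partial>uniforms N) = foldr (heat_bath (boltzmann \<beta> N J)) (map fst ls2) (G x) x"
      if "x \<in> spins N" for x
    proof -
      have "(\<integral>U. G x (run \<beta> N J ls2 U x) \<partial>uniforms N) =
        foldr (heat_bath (boltzmann \<beta> N J)) (map fst ls2) (\<lambda>y. \<integral>U. G x y \<partial>uniforms N) x"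
        by (rule integral_run[where \<Phi> = "\<lambda>U. G x" and B = 1])
           (use ls that G[of x] in \<open>auto simp: abs_le_iff intro: order.trans[of _ 0]\<close>)
      then show ?thesis by (simp add: \<Phi>_def prob_space)
    qed
    \<comment> \<open>The identity \<open>int2\<close> is available on \<open>spins N\<close> only.
      The induction carries it through the heat baths, which evaluate their argument at spin
      configurations alone.\<close>
    have "set ls1 \<subseteq> labels N" using ls by auto
    then show ?thesis using \<sigma>
    proof (induction ls1 arbitrary: \<sigma>)
      case Nil
      then show ?case using int2 by simp
    next
      case (Cons i ls1)
      have "fst i \<in> {1..N}" using Cons.prems by auto
      then have "\<sigma>(fst i := 1) \<in> spins N" "\<sigma>(fst i := -1) \<in> spins N"
        using spins_upd[OF Cons.prems(2)] by auto
      then show ?case using Cons by (simp add: heat_bath_def)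
    qed
  qed
  finally show ?thesis by (simp add: \<Phi>_def run_append)
qed

section \<open>Chronological ordering of the rings\<close>

lemma insort_key_cong_order:
  assumes "\<And>x y. x \<in> A \<Longrightarrow> y \<in> A \<Longrightarrow> f x \<le> f y \<longleftrightarrow> g x \<le> g y" "x \<in> A" "set ys \<subseteq> A"
  shows "insort_key f x ys = insort_key g x (ys :: 'a list)"
  using assms(3) by (induction ys) (use assms(1,2) in auto)

lemma sorted_key_list_of_set_fold:
  "sorted_key_list_of_set f A = Finite_Set.fold (insort_key f) [] A"
proof -
  \<comment> \<open>On the empty carrier commutation is vacuous, so the defining equation is
    obtained for all keys and all sets, including tied keys and infinite sets.\<close>
  have "folding_on {} (insort_key f)" by unfold_locales auto
  then show ?thesis unfolding sorted_key_list_of_set_def by (rule folding_on.eq_fold)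
qed

text \<open>This also covers the case of ties, in which the list is an unspecified value.\<close>

lemma sorted_key_list_of_set_cong_order:
  assumes "\<And>x y. x \<in> A \<Longrightarrow> y \<in> A \<Longrightarrow> f x \<le> f y \<longleftrightarrow> g x \<le> g y"
  shows "sorted_key_list_of_set f A = sorted_key_list_of_set g (A :: 'a set)"
  unfolding sorted_key_list_of_set_fold
proof (rule fold_closed_eq[where B = "{ys. set ys \<subseteq> A}"])
  show "insort_key f x ys = insort_key g x ys" if "x \<in> A" "ys \<in> {ys. set ys \<subseteq> A}" for x ys
    using that by (intro insort_key_cong_order[OF assms]) auto
qed (auto simp: set_insort_key)

lemma sorted_key_list_of_set_infinite: "infinite A \<Longrightarrow> sorted_key_list_of_set f A = []"
  by (simp add: sorted_key_list_of_set_fold)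

text \<open>This lemma and the next identify the constants parametrised by an order, for which
  \<open>folding_insort_key\<close> states its facts, with those of the type class.\<close>

lemma insort_key_class: "linorder.insort_key (\<le>) f x ys = insort_key f x ys"
  by (induction ys) (simp_all add: linorder.insort_key.simps[OF linorder_class.linorder_axioms])

lemma sorted_key_list_of_set_class:
  "linorder.sorted_key_list_of_set (\<le>) f A = sorted_key_list_of_set f A"
proof -
  have "linorder.insort_key (\<le>) f = insort_key f" by (intro ext insort_key_class)
  then show ?thesis
    unfolding linorder.sorted_key_list_of_set_def[OF linorder_class.linorder_axioms]
      linorder_class.sorted_key_list_of_set_def by simp
qed

lemma
  fixes f :: "'b \<Rightarrow> 'a :: linorder"
  assumes "inj_on f A" "finite A"
  shows set_sorted_keys: "set (sorted_key_list_of_set f A) = A"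
    and length_sorted_keys: "length (sorted_key_list_of_set f A) = card A"
    and strict_sorted_keys: "sorted_wrt (<) (map f (sorted_key_list_of_set f A))"
    and sorted_keys_unique: "sorted_wrt (<) (map f l) \<Longrightarrow> set l = A \<Longrightarrow> length l = card A \<Longrightarrow>
      sorted_key_list_of_set f A = l"
proof -
  interpret folding_insort_key "(\<le>)" "(<)" A f by unfold_locales (rule assms(1))
  show "set (sorted_key_list_of_set f A) = A" "length (sorted_key_list_of_set f A) = card A"
    "sorted_wrt (<) (map f (sorted_key_list_of_set f A))"
    using set_sorted_key_list_of_set[of A] length_sorted_key_list_of_set[of A]
      strict_sorted_key_list_of_set[of A] assms(2)
    unfolding sorted_key_list_of_set_class by auto
  show "sorted_wrt (<) (map f l) \<Longrightarrow> set l = A \<Longrightarrow> length l = card A \<Longrightarrow>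
      sorted_key_list_of_set f A = l"
    using sorted_key_list_of_set_unique[of A l] assms(2)
    unfolding sorted_key_list_of_set_class by auto
qed

lemma sorted_key_list_of_set_Un:
  fixes f :: "'a \<Rightarrow> real"
  assumes "finite A" "finite B" "inj_on f (A \<union> B)" "\<And>a b. a \<in> A \<Longrightarrow> b \<in> B \<Longrightarrow> f a < f b"
  shows "sorted_key_list_of_set f (A \<union> B) = sorted_key_list_of_set f A @ sorted_key_list_of_set f B"
proof -
  have A: "inj_on f A" and B: "inj_on f B" using assms(3) inj_on_subset by blast+
  have "A \<inter> B = {}" using assms(4) by fastforce
  then have len: "length (sorted_key_list_of_set f A @ sorted_key_list_of_set f B) = card (A \<union> B)"
    using assms(1,2) by (simp add: card_Un_disjoint length_sorted_keys A B)
  have sorted: "sorted_wrt (<) (map f (sorted_key_list_of_set f A @ sorted_key_list_of_set f B))"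
    using assms strict_sorted_keys[OF A assms(1)] strict_sorted_keys[OF B assms(2)]
    by (auto simp: sorted_wrt_append set_sorted_keys A B)
  show ?thesis
    by (rule sorted_keys_unique[OF assms(3) _ sorted _ len])
      (use assms(1,2) in \<open>simp_all add: set_sorted_keys A B\<close>)
qed

section \<open>Poisson clocks as sequences of exponential gaps\<close>

definition exp1 :: "real measure" where
  "exp1 = density lborel (\<lambda>x. ennreal (exponential_density 1 x))"

definition clocks :: "nat \<Rightarrow> (nat \<times> nat \<Rightarrow> real) measure" where
  "clocks N = (\<Pi>\<^sub>M vk\<in>labels N. exp1)"

lemma prob_space_exp1: "prob_space exp1"
  unfolding exp1_def by (rule prob_space_exponential_density) simp

lemma sets_exp1 [simp, measurable_cong]: "sets exp1 = sets borel"
  by (simp add: exp1_def)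

lemma space_exp1 [simp]: "space exp1 = UNIV"
  by (simp add: exp1_def)

lemma prob_space_clocks: "prob_space (clocks N)"
  unfolding clocks_def by (intro prob_space_PiM prob_space_exp1)

lemma measurable_gap: "x \<in> labels N \<Longrightarrow> (\<lambda>\<xi>. \<xi> x) \<in> borel_measurable (clocks N)"
  using measurable_component_singleton[of x "labels N" "\<lambda>_. exp1"]
  by (simp add: clocks_def cong: measurable_cong_sets)

lemma measurable_ring_time: "x \<in> labels N \<Longrightarrow> (\<lambda>\<xi>. ring_time \<xi> x) \<in> borel_measurable (clocks N)"
  unfolding ring_time_def by (cases x) (auto intro!: borel_measurable_sum measurable_gap)

definition ring_list :: "nat \<Rightarrow> (nat \<times> nat \<Rightarrow> real) \<Rightarrow> real \<Rightarrow> (nat \<times> nat) list" where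
  "ring_list N \<xi> t = sorted_key_list_of_set (ring_time \<xi>) {vk \<in> labels N. ring_time \<xi> vk \<le> t}"

lemma glauber_run: "glauber \<beta> N J (\<sigma>, \<xi>, U) t = run \<beta> N J (ring_list N \<xi> t) U \<sigma>"
  by (simp add: glauber_def run_def ring_list_def)

text \<open>The sorted list depends on the ring times only through their order pattern on the finite
  set \<open>A\<close>, and there are finitely many patterns. A clock realisation
  \<open>\<xi>'\<close> serves as a representative of each pattern.\<close>

lemma pred_sorted_rings:
  assumes "finite A" "A \<subseteq> labels N"
  shows "Measurable.pred (clocks N) (\<lambda>\<xi>. sorted_key_list_of_set (ring_time \<xi>) A = L)"
proof -
  define pattern where "pattern \<xi> = {p \<in> A \<times> A. ring_time \<xi> (fst p) \<le> ring_time \<xi> (snd p)}" for \<xi>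
  define Q where "Q \<xi> \<longleftrightarrow>
      (\<exists>P\<in>Pow (A \<times> A). (\<forall>p\<in>A \<times> A. ring_time \<xi> (fst p) \<le> ring_time \<xi> (snd p) \<longleftrightarrow> p \<in> P) \<and>
        (\<exists>\<xi>'. pattern \<xi>' = P \<and> sorted_key_list_of_set (ring_time \<xi>') A = L))" for \<xi>
  have eq: "sorted_key_list_of_set (ring_time \<xi>) A = L \<longleftrightarrow> Q \<xi>" for \<xi>
    unfolding Q_def
  proof
    assume L: "sorted_key_list_of_set (ring_time \<xi>) A = L"
    show "\<exists>P\<in>Pow (A \<times> A). (\<forall>p\<in>A \<times> A. ring_time \<xi> (fst p) \<le> ring_time \<xi> (snd p) \<longleftrightarrow> p \<in> P) \<and>
        (\<exists>\<xi>'. pattern \<xi>' = P \<and> sorted_key_list_of_set (ring_time \<xi>') A = L)"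
      by (rule bexI[of _ "pattern \<xi>"]) (use L in \<open>auto simp: pattern_def\<close>)
  next
    assume "\<exists>P\<in>Pow (A \<times> A). (\<forall>p\<in>A \<times> A. ring_time \<xi> (fst p) \<le> ring_time \<xi> (snd p) \<longleftrightarrow> p \<in> P) \<and>
        (\<exists>\<xi>'. pattern \<xi>' = P \<and> sorted_key_list_of_set (ring_time \<xi>') A = L)"
    then obtain P \<xi>' where P: "\<forall>p\<in>A \<times> A. ring_time \<xi> (fst p) \<le> ring_time \<xi> (snd p) \<longleftrightarrow> p \<in> P"
      and \<xi>': "pattern \<xi>' = P" "sorted_key_list_of_set (ring_time \<xi>') A = L" by blast
    have "sorted_key_list_of_set (ring_time \<xi>) A = sorted_key_list_of_set (ring_time \<xi>') A"
    proof (rule sorted_key_list_of_set_cong_order)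
      fix x y assume "x \<in> A" "y \<in> A"
      then show "ring_time \<xi> x \<le> ring_time \<xi> y \<longleftrightarrow> ring_time \<xi>' x \<le> ring_time \<xi>' y"
        using P \<xi>'(1) by (force simp: pattern_def)
    qed
    then show "sorted_key_list_of_set (ring_time \<xi>) A = L" using \<xi>'(2) by simp
  qed
  have fin: "finite (A \<times> A)" "finite (Pow (A \<times> A))" using assms(1) by auto
  have le: "Measurable.pred (clocks N) (\<lambda>\<xi>. ring_time \<xi> (fst p) \<le> ring_time \<xi> (snd p) \<longleftrightarrow> p \<in> P)"
    if "p \<in> A \<times> A" for p P
  proof -
    have [measurable]: "(\<lambda>\<xi>. ring_time \<xi> (fst p)) \<in> borel_measurable (clocks N)"
      "(\<lambda>\<xi>. ring_time \<xi> (snd p)) \<in> borel_measurable (clocks N)"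
      using that assms(2) by (auto intro!: measurable_ring_time)
    have [measurable]: "Measurable.pred (clocks N) (\<lambda>\<xi>. ring_time \<xi> (fst p) \<le> ring_time \<xi> (snd p))"
      unfolding pred_def by (rule borel_measurable_le) fact+
    have [measurable]: "Measurable.pred (clocks N) (\<lambda>\<xi>. p \<in> P)" by (cases "p \<in> P") simp_all
    show ?thesis by (intro pred_intros_logic) fact+
  qed
  \<comment> \<open>For a fixed pattern the existence of a representative \<open>\<xi>'\<close> does
    not involve \<xi>, so it is a constant predicate.\<close>
  have const: "Measurable.pred (clocks N) (\<lambda>\<xi>. c)" for c by (cases c) simp_all
  show ?thesis unfolding eq unfolding Q_def
    by (rule pred_intros_finite(4)[OF fin(2)], rule pred_intros_logic(3),
        rule pred_intros_finite(3)[OF fin(1)], rule le, assumption, rule const)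
qed

text \<open>The clock space is cut into the countably many events that the rings up to
  \<open>t\<close> form a given finite set, enumerated by a list; on each of them
  \<open>pred_sorted_rings\<close> applies.\<close>

lemma measurable_ring_list: "(\<lambda>\<xi>. ring_list N \<xi> t) \<in> clocks N \<rightarrow>\<^sub>M count_space UNIV"
  unfolding measurable_count_space_eq_countable[OF countableI_type]
proof (intro conjI ballI)
  fix L :: "(nat \<times> nat) list"
  define S where "S \<xi> = {vk \<in> labels N. ring_time \<xi> vk \<le> t}" for \<xi>
  define Q where "Q as \<xi> \<longleftrightarrow> (\<forall>x. x \<in> labels N \<longrightarrow> (ring_time \<xi> x \<le> t \<longleftrightarrow> x \<in> set as))" for as \<xi>
  define G where "G as \<xi> \<longleftrightarrow> set as \<subseteq> labels N \<and> Q as \<xi>" for as \<xi>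
  have G: "G as \<xi> \<longleftrightarrow> S \<xi> = set as" for as \<xi>
    by (auto simp: G_def Q_def S_def)
  have [measurable]: "Measurable.pred (clocks N) (Q as)" for as
  proof -
    have "Measurable.pred (clocks N) (\<lambda>\<xi>. x \<in> labels N \<longrightarrow> (ring_time \<xi> x \<le> t \<longleftrightarrow> x \<in> set as))" for x
    proof (cases "x \<in> labels N")
      case True
      have [measurable]: "(\<lambda>\<xi>. ring_time \<xi> x) \<in> borel_measurable (clocks N)"
        by (rule measurable_ring_time[OF True])
      show ?thesis by measurable
    qed simp
    then show ?thesis unfolding Q_def by (intro pred_intros_countable)
  qed
  have [measurable]: "Measurable.pred (clocks N) (G as)" for as
    unfolding G_def by measurable
  have "Measurable.pred (clocks N) (\<lambda>\<xi>. G as \<xi> \<and> sorted_key_list_of_set (ring_time \<xi>) (set as) = L)" for as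
  proof (cases "set as \<subseteq> labels N")
    case True
    note [measurable] = pred_sorted_rings[OF _ True, of L]
    show ?thesis by measurable
  next
    case False
    then show ?thesis by (simp add: G_def)
  qed
  then have ex: "Measurable.pred (clocks N) (\<lambda>\<xi>. \<exists>as. G as \<xi> \<and> sorted_key_list_of_set (ring_time \<xi>) (set as) = L)"
    by (rule pred_intros_countable)
  have "Measurable.pred (clocks N) (\<lambda>\<xi>. \<not> G as \<xi>)" for as by measurable
  then have all: "Measurable.pred (clocks N) (\<lambda>\<xi>. \<forall>as. \<not> G as \<xi>)"
    by (rule pred_intros_countable)
  \<comment> \<open>If no list enumerates the rings up to \<open>t\<close>, there are infinitely
    many of them and the sorted list takes its default value \<open>[]\<close>.\<close>
  have "Measurable.pred (clocks N) (\<lambda>\<xi>. (\<exists>as. G as \<xi> \<and> sorted_key_list_of_set (ring_time \<xi>) (set as) = L) \<or>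
      ((\<forall>as. \<not> G as \<xi>) \<and> L = []))"
    using ex pred_intros_logic(5)[OF ex all] by (cases "L = []") simp_all
  moreover have "ring_list N \<xi> t = L \<longleftrightarrow> (\<exists>as. G as \<xi> \<and> sorted_key_list_of_set (ring_time \<xi>) (set as) = L) \<or>
      ((\<forall>as. \<not> G as \<xi>) \<and> L = [])" for \<xi>
  proof (cases "finite (S \<xi>)")
    case True
    then obtain bs where "S \<xi> = set bs" by (metis finite_list)
    then have "G bs \<xi>" by (simp add: G)
    then have "(\<exists>as. G as \<xi> \<and> sorted_key_list_of_set (ring_time \<xi>) (set as) = L)
        \<longleftrightarrow> sorted_key_list_of_set (ring_time \<xi>) (S \<xi>) = L"
      using G by metis
    then show ?thesis using \<open>G bs \<xi>\<close> unfolding ring_list_def S_def[symmetric] by blast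
  next
    case False
    then have "\<not> G as \<xi>" for as using G by (metis List.finite_set)
    then show ?thesis
      using False unfolding ring_list_def S_def[symmetric] by (auto simp: sorted_key_list_of_set_infinite)
  qed
  ultimately have "Measurable.pred (clocks N) (\<lambda>\<xi>. ring_list N \<xi> t = L)" by simp
  then show "(\<lambda>\<xi>. ring_list N \<xi> t) -` {L} \<inter> space (clocks N) \<in> sets (clocks N)"
    by (simp add: pred_def vimage_def Int_def conj_commute)
qed simp

text \<open>By time \<open>T\<close> only rings number \<open>0\<close> to \<open>m - 1\<close> can
  occur at a site. The gaps are bounded up to number \<open>m\<close> inclusive, because the gap
  that straddles \<open>T\<close> may be the one ending at ring \<open>m\<close>.\<close>

definition regular_clocks :: "nat \<Rightarrow> nat \<Rightarrow> real \<Rightarrow> real \<Rightarrow> (nat \<times> nat \<Rightarrow> real) \<Rightarrow> bool" where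
  "regular_clocks N m L T \<xi> \<longleftrightarrow>
     (\<forall>x\<in>labels N. 0 < \<xi> x) \<and>
     (\<forall>x\<in>labels N. \<forall>y\<in>labels N. x \<noteq> y \<longrightarrow> ring_time \<xi> x \<noteq> ring_time \<xi> y) \<and>
     (\<forall>v\<in>{1..N}. T < ring_time \<xi> (v, m)) \<and>
     (\<forall>v\<in>{1..N}. \<forall>k\<in>{..m}. \<xi> (v, k) \<le> L)"

text \<open>Open on the left and closed on the right, so that consecutive windows neither share nor
  miss a ring.\<close>

definition window :: "nat \<Rightarrow> (nat \<times> nat \<Rightarrow> real) \<Rightarrow> real \<Rightarrow> real \<Rightarrow> (nat \<times> nat) set" where
  "window N \<xi> a b = {x \<in> labels N. a < ring_time \<xi> x \<and> ring_time \<xi> x \<le> b}"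

lemma ring_time_Suc: "ring_time \<xi> (v, Suc k) = ring_time \<xi> (v, k) + \<xi> (v, Suc k)"
  and ring_time_0: "ring_time \<xi> (v, 0) = \<xi> (v, 0)"
  by (simp_all add: ring_time_def)

locale regular =
  fixes N m :: nat and L T :: real and \<xi> :: "nat \<times> nat \<Rightarrow> real"
  assumes regular: "regular_clocks N m L T \<xi>" and L: "L > 0"
begin

lemma gap_pos: "v \<in> {1..N} \<Longrightarrow> 0 < \<xi> (v, k)"
  using regular by (auto simp: regular_clocks_def)

lemma ring_time_mono: "v \<in> {1..N} \<Longrightarrow> k \<le> l \<Longrightarrow> ring_time \<xi> (v, k) \<le> ring_time \<xi> (v, l)"
  using gap_pos[of v] unfolding ring_time_def
  by (simp add: sum_mono2 less_imp_le)

lemma ring_time_pos: "x \<in> labels N \<Longrightarrow> 0 < ring_time \<xi> x"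
  using gap_pos[of "fst x"] unfolding ring_time_def
  by (cases x) (auto intro!: sum_pos)

lemma inj_ring_time: "inj_on (ring_time \<xi>) (labels N)"
  using regular unfolding regular_clocks_def inj_on_def by blast

lemma rings_before: "{x \<in> labels N. ring_time \<xi> x \<le> T} \<subseteq> {1..N} \<times> {..<m}"
proof
  fix x assume x: "x \<in> {x \<in> labels N. ring_time \<xi> x \<le> T}"
  obtain v k where vk: "x = (v, k)" by force
  have v: "v \<in> {1..N}" using x vk by auto
  have "T < ring_time \<xi> (v, m)" using regular v unfolding regular_clocks_def by blast
  then have "k < m" using ring_time_mono[OF v, of m k] x vk by (cases "k < m") auto
  then show "x \<in> {1..N} \<times> {..<m}" using v vk by auto
qed

lemma finite_window: "b \<le> T \<Longrightarrow> finite (window N \<xi> a b)"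
  by (rule finite_subset[of _ "{1..N} \<times> {..<m}"]) (use rings_before in \<open>auto simp: window_def\<close>)

text \<open>The first ring of \<open>v\<close> after time \<open>a\<close> follows a ring, or the
  origin, that is not later than \<open>a\<close>. Its gap is at most \<open>L\<close>, so it comes
  before \<open>a + L\<close>, or at the latest then.\<close>

lemma window_all_sites:
  assumes ab: "0 \<le> a" "a + L \<le> b" "b \<le> T"
  shows "fst ` window N \<xi> a b = {1..N}"
proof
  show "fst ` window N \<xi> a b \<subseteq> {1..N}" by (auto simp: window_def)
  show "{1..N} \<subseteq> fst ` window N \<xi> a b"
  proof
    fix v assume v: "v \<in> {1..N}"
    have Tm: "T < ring_time \<xi> (v, m)" using regular v unfolding regular_clocks_def by blast
    define k where "k = (LEAST k. a < ring_time \<xi> (v, k))"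
    have am: "a < ring_time \<xi> (v, m)" using Tm ab L by linarith
    then have ak: "a < ring_time \<xi> (v, k)" unfolding k_def by (rule LeastI)
    have "k \<le> m" unfolding k_def using am by (rule Least_le)
    then have gap: "\<xi> (v, k) \<le> L" using regular v unfolding regular_clocks_def by auto
    have "ring_time \<xi> (v, k) \<le> a + L"
    proof (cases k)
      case 0
      then show ?thesis using gap ab by (simp add: ring_time_0)
    next
      case (Suc j)
      then have "\<not> a < ring_time \<xi> (v, j)" unfolding k_def by (metis lessI not_less_Least)
      then show ?thesis using gap Suc by (simp add: ring_time_Suc)
    qed
    then have "(v, k) \<in> window N \<xi> a b" using v ak ab by (auto simp: window_def)
    then show "v \<in> fst ` window N \<xi> a b" by force
  qed
qed

definition rings :: "real \<Rightarrow> real \<Rightarrow> (nat \<times> nat) list" where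
  "rings a b = sorted_key_list_of_set (ring_time \<xi>) (window N \<xi> a b)"

lemma set_rings: "b \<le> T \<Longrightarrow> set (rings a b) = window N \<xi> a b"
proof -
  assume "b \<le> T"
  show ?thesis unfolding rings_def
    by (rule set_sorted_keys[OF inj_on_subset[OF inj_ring_time] finite_window[OF \<open>b \<le> T\<close>]])
      (auto simp: window_def)
qed

lemma rings_split:
  assumes "a \<le> c" "c \<le> b" "b \<le> T"
  shows "rings a b = rings a c @ rings c b"
proof -
  have "window N \<xi> a b = window N \<xi> a c \<union> window N \<xi> c b" using assms by (auto simp: window_def)
  then show ?thesis unfolding rings_def
    using assms finite_window
    by (simp, intro sorted_key_list_of_set_Un inj_on_subset[OF inj_ring_time]) (auto simp: window_def)
qed

lemma ring_list_rings: "ring_list N \<xi> t = rings 0 t"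
proof -
  have "{vk \<in> labels N. ring_time \<xi> vk \<le> t} = window N \<xi> 0 t"
    using ring_time_pos by (auto simp: window_def)
  then show ?thesis by (simp add: ring_list_def rings_def)
qed

lemma sites_rings: "b \<le> T \<Longrightarrow> set (map fst (rings a b)) \<subseteq> {1..N}"
  by (auto simp: set_rings window_def)

text \<open>The interval is cut into \<open>R\<close> windows of length \<open>L\<close>, each
  containing a ring of every site; what is left over forms \<open>r\<close>.\<close>

lemma rings_blocks:
  assumes "0 \<le> a" "a + real R * L \<le> b" "b \<le> T"
  shows "\<exists>ls r. map fst (rings a b) = concat ls @ r \<and> length ls = R \<and>
    (\<forall>l\<in>set ls. set l = {1..N}) \<and> set r \<subseteq> {1..N}"
  using assms
proof (induction R arbitrary: a)
  case 0
  then show ?case using sites_rings[of b a] by (intro exI[of _ "[]"] exI[of _ "map fst (rings a b)"]) auto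
next
  case (Suc R)
  have b: "a + L + real R * L \<le> b" using Suc.prems by (simp add: algebra_simps)
  have aL: "a + L \<le> b" using b L by (smt (verit) mult_nonneg_nonneg of_nat_0_le_iff)
  obtain ls r where IH: "map fst (rings (a + L) b) = concat ls @ r" "length ls = R"
    "\<forall>l\<in>set ls. set l = {1..N}" "set r \<subseteq> {1..N}"
    using Suc.IH[of "a + L"] Suc.prems b L by auto
  have "rings a b = rings a (a + L) @ rings (a + L) b"
    using aL L Suc.prems by (intro rings_split) auto
  moreover have "set (map fst (rings a (a + L))) = {1..N}"
    using window_all_sites[of a "a + L"] Suc.prems aL by (simp add: set_rings)
  ultimately show ?case using IH
    by (intro exI[of _ "map fst (rings a (a + L)) # ls"] exI[of _ r]) auto
qed

lemma two_ring_lists: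
  assumes t: "real (Suc R1) * L \<le> t" "t + real R2 * L \<le> T"
  shows "\<exists>a ls1 r1 ls2 r2.
    ring_list N \<xi> T = ring_list N \<xi> t @ rings t T \<and>
    distinct (ring_list N \<xi> T) \<and> set (ring_list N \<xi> T) \<subseteq> labels N \<and>
    length (ring_list N \<xi> T) \<le> N * m \<and>
    map fst (ring_list N \<xi> t) = a @ concat ls1 @ r1 \<and> map fst (rings t T) = concat ls2 @ r2 \<and>
    set a = {1..N} \<and> length ls1 = R1 \<and> (\<forall>l\<in>set ls1. set l = {1..N}) \<and> set r1 \<subseteq> {1..N} \<and>
    length ls2 = R2 \<and> (\<forall>l\<in>set ls2. set l = {1..N}) \<and> set r2 \<subseteq> {1..N}"
proof -
  have tT: "t \<le> T" "0 \<le> t" using t L by (smt (verit) mult_nonneg_nonneg of_nat_0_le_iff)+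
  have split: "ring_list N \<xi> T = ring_list N \<xi> t @ rings t T"
    unfolding ring_list_rings using tT by (intro rings_split) auto
  \<comment> \<open>One window more than \<open>R1\<close>: the first one becomes the sweep
    \<open>a\<close> that selects the well.\<close>
  obtain ls1' r1 where 1: "map fst (rings 0 t) = concat ls1' @ r1" "length ls1' = Suc R1"
    "\<forall>l\<in>set ls1'. set l = {1..N}" "set r1 \<subseteq> {1..N}"
    using rings_blocks[of 0 "Suc R1" t] t tT by auto
  obtain a ls1 where ls1': "ls1' = a # ls1" using 1(2) by (cases ls1') auto
  obtain ls2 r2 where 2: "map fst (rings t T) = concat ls2 @ r2" "length ls2 = R2"
    "\<forall>l\<in>set ls2. set l = {1..N}" "set r2 \<subseteq> {1..N}"
    using rings_blocks[of t R2 T] t tT by auto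
  have sub: "window N \<xi> 0 T \<subseteq> labels N" by (auto simp: window_def)
  note inj = inj_on_subset[OF inj_ring_time sub] and fin = finite_window[OF order.refl, of 0]
  have "distinct (rings 0 T)"
    using strict_sorted_keys[OF inj fin] unfolding rings_def by (simp add: strict_sorted_iff distinct_map)
  moreover have "length (rings 0 T) \<le> N * m"
  proof -
    have "length (rings 0 T) = card (window N \<xi> 0 T)"
      unfolding rings_def by (rule length_sorted_keys[OF inj fin])
    also have "\<dots> \<le> card ({1..N} \<times> {..<m})"
      by (rule card_mono) (use rings_before in \<open>auto simp: window_def\<close>)
    finally show ?thesis by simp
  qed
  moreover have "set (rings 0 T) \<subseteq> labels N" using set_rings[of T 0] sub by simp
  moreover have "map fst (ring_list N \<xi> t) = a @ concat ls1 @ r1"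
    using 1(1) ls1' by (simp add: ring_list_rings)
  moreover have "set a = {1..N}" "length ls1 = R1" "\<forall>l\<in>set ls1. set l = {1..N}"
    using 1 ls1' by auto
  ultimately show ?thesis
    unfolding ring_list_rings[of T] using split[unfolded ring_list_rings[of T]] 1(4) 2
    by (intro exI[of _ a] exI[of _ ls1] exI[of _ r1] exI[of _ ls2] exI[of _ r2]) (simp add: ring_list_rings)
qed

end

text \<open>The order of integration in which the redrawn coordinate is averaged first, with all
  other coordinates held fixed.\<close>

lemma integral_PiM_redraw_inner:
  fixes F :: "('i \<Rightarrow> 'a) \<Rightarrow> real"
  assumes M: "\<And>i. prob_space (M i)" and i: "i \<in> I" and F[measurable]: "F \<in> borel_measurable (PiM I M)"
    and bound: "\<And>X. \<bar>F X\<bar> \<le> B"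
  shows "(\<integral>X. F X \<partial>PiM I M) = (\<integral>X. (\<integral>u. F (X(i := u)) \<partial>M i) \<partial>PiM I M)"
proof -
  interpret P: product_prob_space M I by (rule product_prob_spaceI) (rule M)
  interpret Mi: prob_space "M i" by (rule M)
  interpret pair: pair_prob_space "M i" "PiM I M" ..
  have "(\<lambda>p. F ((\<lambda>(x, X). X(i := x)) p)) \<in> borel_measurable (M i \<Otimes>\<^sub>M PiM I M)"
    by (rule measurable_compose[OF measurable_PiM_upd[OF i] F])
  then have "integrable (M i \<Otimes>\<^sub>M PiM I M) (\<lambda>(u, X). F (X(i := u)))"
    using bound by (intro pair.integrable_const_bound[where B = B]) (auto intro!: AE_I2 simp: case_prod_beta)
  from pair.Fubini_integral[OF this] show ?thesis
    using integral_PiM_redraw[OF M i F bound] by simp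
qed

section \<open>Irregular clocks are unlikely\<close>

lemma exp1_gt: "L \<ge> 0 \<Longrightarrow> measure exp1 {L<..} = exp (- L)"
proof -
  assume L: "L \<ge> 0"
  interpret prob_space exp1 by (rule prob_space_exp1)
  have "distributed exp1 lborel (\<lambda>x. x) (exponential_density 1)"
    unfolding distributed_def
    by (auto simp: exp1_def distr_id2 intro!: distr_id2 exponential_density_nonneg)
  from exponential_distributedD_gt[OF this L] show ?thesis by (simp add: greaterThan_def)
qed

lemma AE_exp1_pos: "AE x in exp1. 0 < x"
proof -
  have "AE x in lborel. x \<noteq> (0::real)" by (rule AE_lborel_singleton)
  then show ?thesis unfolding exp1_def
    by (subst AE_density) (auto simp: exponential_density_def erlang_density_def elim!: eventually_mono)
qed

lemma AE_exp1_neq: "AE x in exp1. x \<noteq> c"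
proof -
  have "AE x in lborel. x \<noteq> (c::real)" by (rule AE_lborel_singleton)
  then show ?thesis unfolding exp1_def
    by (subst AE_density) (auto elim!: eventually_mono)
qed

text \<open>The Laplace transform at 1. The absolute value changes nothing almost surely and keeps
  the integrand bounded by 1 everywhere.\<close>

lemma integral_exp1_exp: "(\<integral>x. exp (- \<bar>x\<bar>) \<partial>exp1) = 1 / 2"
proof -
  have "(\<integral>x. exp (- \<bar>x\<bar>) \<partial>exp1) = (\<integral>x. exponential_density 1 x * exp (- \<bar>x\<bar>) \<partial>lborel)"
    unfolding exp1_def by (subst integral_density) (auto intro!: AE_I2 exponential_density_nonneg)
  also have "\<dots> = (\<integral>x. (1 / 2) * exponential_density 2 x \<partial>lborel)"
    by (intro Bochner_Integration.integral_cong)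
       (auto simp: exponential_density_def erlang_density_def exp_add[symmetric])
  also have "\<dots> = (1 / 2) * (\<integral>x. exponential_density 2 x * 1 \<partial>lborel)" by simp
  also have "(\<integral>x. exponential_density 2 x * 1 \<partial>lborel) = (\<integral>x. 1 \<partial>density lborel (\<lambda>x. ennreal (exponential_density 2 x)))"
    by (subst integral_density) (auto intro!: AE_I2 exponential_density_nonneg)
  also have "\<dots> = 1"
    using prob_space.prob_space[OF prob_space_exponential_density[of 2]] by simp
  finally show ?thesis by simp
qed

lemma AE_clocks_component: "x \<in> labels N \<Longrightarrow> AE u in exp1. P u \<Longrightarrow> AE \<xi> in clocks N. P (\<xi> x)"
  unfolding clocks_def using prob_space_exp1 by (intro AE_PiM_component) auto

lemma prob_gap_gt:
  assumes "x \<in> labels N" "L \<ge> 0"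
  shows "measure (clocks N) {\<xi> \<in> space (clocks N). \<xi> x > L} = exp (- L)"
proof -
  have "distr (clocks N) exp1 (\<lambda>\<xi>. \<xi> x) = exp1"
    unfolding clocks_def using assms(1) prob_space_exp1 by (intro distr_PiM_component) auto
  then have "measure exp1 {L<..} = measure (distr (clocks N) exp1 (\<lambda>\<xi>. \<xi> x)) {L<..}" by simp
  also have "\<dots> = measure (clocks N) ((\<lambda>\<xi>. \<xi> x) -` {L<..} \<inter> space (clocks N))"
    by (rule measure_distr) (use measurable_gap[OF assms(1)] in \<open>auto cong: measurable_cong_sets\<close>)
  finally show ?thesis using exp1_gt[OF assms(2)] by (simp add: vimage_def Int_def conj_commute)
qed

lemma expectation_exp_gaps:
  assumes v: "v \<in> {1..N}"
  shows "(\<integral>\<xi>. (\<Prod>l<k. exp (- \<bar>\<xi> (v, l)\<bar>)) \<partial>clocks N) = (1 / 2) ^ k"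
proof (induction k)
  case 0
  interpret prob_space "clocks N" by (rule prob_space_clocks)
  show ?case by (simp add: prob_space)
next
  case (Suc k)
  define F where "F \<xi> = (\<Prod>l<Suc k. exp (- \<bar>\<xi> (v, l)\<bar>))" for \<xi> :: "nat \<times> nat \<Rightarrow> real"
  have [measurable]: "(\<lambda>\<xi>. \<xi> (v, l)) \<in> borel_measurable (clocks N)" for l
    using v by (intro measurable_gap) auto
  have F[measurable]: "F \<in> borel_measurable (clocks N)" unfolding F_def by measurable
  have bound: "\<bar>F \<xi>\<bar> \<le> 1" for \<xi>
    unfolding F_def abs_prod by (rule prod_le_1) auto
  have "(\<integral>\<xi>. F \<xi> \<partial>clocks N) = (\<integral>\<xi>. (\<integral>u. F (\<xi>((v, k) := u)) \<partial>exp1) \<partial>clocks N)"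
    unfolding clocks_def
    by (rule integral_PiM_redraw_inner[where B = 1])
       (use v prob_space_exp1 F bound in \<open>auto simp: clocks_def\<close>)
  also have "\<dots> = (\<integral>\<xi>. (\<Prod>l<k. exp (- \<bar>\<xi> (v, l)\<bar>)) * (1 / 2) \<partial>clocks N)"
  proof (intro Bochner_Integration.integral_cong refl)
    fix \<xi> :: "nat \<times> nat \<Rightarrow> real"
    have "F (\<xi>((v, k) := u)) = (\<Prod>l<k. exp (- \<bar>\<xi> (v, l)\<bar>)) * exp (- \<bar>u\<bar>)" for u
      unfolding F_def prod.lessThan_Suc by (intro arg_cong2[where f = "(*)"] prod.cong) auto
    then show "(\<integral>u. F (\<xi>((v, k) := u)) \<partial>exp1) = (\<Prod>l<k. exp (- \<bar>\<xi> (v, l)\<bar>)) * (1 / 2)"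
      by (simp add: integral_exp1_exp)
  qed
  also have "\<dots> = (1 / 2) ^ Suc k" using Suc by simp
  finally show ?case by (simp add: F_def)
qed

text \<open>The first gap at the site of \<open>x\<close> enters the ring time of \<open>x\<close>
  with coefficient one and that of \<open>y\<close> not at all. When it is redrawn, a tie requires
  it to hit one prescribed value.\<close>

lemma AE_ring_times_distinct:
  assumes x: "x \<in> labels N" and y: "y \<in> labels N" and ne: "fst x \<noteq> fst y"
  shows "AE \<xi> in clocks N. ring_time \<xi> x \<noteq> ring_time \<xi> y"
proof -
  interpret prob_space "clocks N" by (rule prob_space_clocks)
  have [measurable]: "(\<lambda>\<xi>. ring_time \<xi> x) \<in> borel_measurable (clocks N)"
    "(\<lambda>\<xi>. ring_time \<xi> y) \<in> borel_measurable (clocks N)"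
    using x y by (auto intro: measurable_ring_time)
  define A where "A = {\<xi> \<in> space (clocks N). ring_time \<xi> x = ring_time \<xi> y}"
  have A[measurable]: "A \<in> sets (clocks N)" unfolding A_def by measurable
  obtain v k w l where xy: "x = (v, k)" "y = (w, l)" by fastforce
  define i where "i = (v, 0::nat)"
  have i: "i \<in> labels N" using x xy by (auto simp: i_def)
  have rx: "ring_time (\<xi>(i := u)) x = u + (ring_time \<xi> x - \<xi> i)" for \<xi> u
  proof -
    have "{..k} = insert 0 {1..k}" by auto
    then have "ring_time \<xi>' x = \<xi>' i + (\<Sum>j\<in>{1..k}. \<xi>' (v, j))" for \<xi>'
      by (simp add: ring_time_def xy i_def)
    moreover have "(\<Sum>j\<in>{1..k}. (\<xi>(i := u)) (v, j)) = (\<Sum>j\<in>{1..k}. \<xi> (v, j))"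
      by (intro sum.cong) (auto simp: i_def)
    ultimately show ?thesis by simp
  qed
  have ry: "ring_time (\<xi>(i := u)) y = ring_time \<xi> y" for \<xi> u
    using ne xy by (simp add: ring_time_def i_def)
  have "(\<integral>\<xi>. indicator A \<xi> \<partial>clocks N) = (\<integral>\<xi>. (\<integral>u. (indicator A (\<xi>(i := u)) :: real) \<partial>exp1) \<partial>clocks N)"
    unfolding clocks_def
    by (rule integral_PiM_redraw_inner[where B = 1 and F = "indicator A" and M = "\<lambda>_. exp1"])
       (use i prob_space_exp1 A in \<open>auto simp: clocks_def indicator_def\<close>)
  also have "\<dots> = (\<integral>\<xi>. 0 \<partial>clocks N)"
  proof (intro Bochner_Integration.integral_cong refl)
    fix \<xi>
    have "AE u in exp1. u \<noteq> ring_time \<xi> y - (ring_time \<xi> x - \<xi> i)" by (rule AE_exp1_neq)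
    then have "AE u in exp1. indicator A (\<xi>(i := u)) = (0::real)"
      by eventually_elim (auto simp: A_def rx ry indicator_def)
    then show "(\<integral>u. indicator A (\<xi>(i := u)) \<partial>exp1) = (0::real)" by (rule integral_eq_zero_AE)
  qed
  finally have "prob A = 0" by simp
  then have "AE \<xi> in clocks N. \<xi> \<notin> A" by (simp add: prob_eq_0 A)
  then show ?thesis using AE_space by eventually_elim (auto simp: A_def)
qed

text \<open>The Chernoff bound with parameter 1 for the event that ring number \<open>m\<close>
  comes by time \<open>T\<close>. Positivity of the gaps is part of the event so that the absolute
  values in \<open>expectation_exp_gaps\<close> can be removed.\<close>

lemma prob_few_rings:
  assumes v: "v \<in> {1..N}"
  shows "measure (clocks N) {\<xi> \<in> space (clocks N). (\<forall>l\<in>{..m}. 0 < \<xi> (v, l)) \<and> ring_time \<xi> (v, m) \<le> T}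
    \<le> exp T * (1 / 2) ^ Suc m"
proof -
  interpret prob_space "clocks N" by (rule prob_space_clocks)
  have [measurable]: "(\<lambda>\<xi>. \<xi> (v, l)) \<in> borel_measurable (clocks N)" for l
    using v by (intro measurable_gap) auto
  have [measurable]: "(\<lambda>\<xi>. ring_time \<xi> (v, m)) \<in> borel_measurable (clocks N)"
    using v by (intro measurable_ring_time) auto
  define F where "F \<xi> = (\<Prod>l<Suc m. exp (- \<bar>\<xi> (v, l)\<bar>))" for \<xi> :: "nat \<times> nat \<Rightarrow> real"
  have F[measurable]: "F \<in> borel_measurable (clocks N)" unfolding F_def by measurable
  have bound: "\<bar>F \<xi>\<bar> \<le> 1" for \<xi>
    unfolding F_def abs_prod by (rule prod_le_1) auto
  have intF: "integrable (clocks N) F"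
    by (rule integrable_const_bound[where B = 1]) (use bound F in auto)
  have Fpos: "F \<xi> \<ge> 0" for \<xi> unfolding F_def by (intro prod_nonneg) auto
  define A where "A = {\<xi> \<in> space (clocks N). (\<forall>l\<in>{..m}. 0 < \<xi> (v, l)) \<and> ring_time \<xi> (v, m) \<le> T}"
  have A[measurable]: "A \<in> sets (clocks N)" unfolding A_def by measurable
  have "prob A = (\<integral>\<xi>. indicator A \<xi> \<partial>clocks N)" by simp
  also have "\<dots> \<le> (\<integral>\<xi>. exp T * F \<xi> \<partial>clocks N)"
  proof (rule integral_mono)
    show "indicator A \<xi> \<le> exp T * F \<xi>" if "\<xi> \<in> space (clocks N)" for \<xi>
    proof (cases "\<xi> \<in> A")
      case True
      then have "F \<xi> = (\<Prod>l<Suc m. exp (- \<xi> (v, l)))"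
        unfolding F_def by (intro prod.cong) (auto simp: A_def less_Suc_eq_le abs_of_pos)
      also have "\<dots> = exp (- ring_time \<xi> (v, m))"
        by (simp add: exp_sum[symmetric] ring_time_def sum_negf lessThan_Suc_atMost)
      finally have "exp T * F \<xi> = exp (T - ring_time \<xi> (v, m))" by (simp add: exp_diff exp_minus field_simps)
      also have "\<dots> \<ge> 1" using True by (simp add: A_def)
      finally show ?thesis using True by simp
    qed (use Fpos in simp)
  qed (use intF in \<open>auto simp: integrable_real_indicator emeasure_eq_measure\<close>)
  also have "\<dots> = exp T * (1 / 2) ^ Suc m"
    using expectation_exp_gaps[OF v, of "Suc m"] by (simp add: F_def del: prod.lessThan_Suc)
  finally show ?thesis unfolding A_def .
qed

lemma pred_regular_clocks: "Measurable.pred (clocks N) (regular_clocks N m L T)"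
proof -
  have p1: "Measurable.pred (clocks N) (\<lambda>\<xi>. 0 < \<xi> x)" if "x \<in> labels N" for x
    using measurable_gap[OF that] by measurable
  have p2: "Measurable.pred (clocks N) (\<lambda>\<xi>. x \<noteq> y \<longrightarrow> ring_time \<xi> x \<noteq> ring_time \<xi> y)"
    if "x \<in> labels N" "y \<in> labels N" for x y
  proof (cases "x = y")
    case False
    then show ?thesis
      using borel_measurable_neq[OF measurable_ring_time[OF that(1)] measurable_ring_time[OF that(2)]]
      by (simp add: pred_def)
  qed simp
  have p3: "Measurable.pred (clocks N) (\<lambda>\<xi>. T < ring_time \<xi> (v, m))" if "v \<in> {1..N}" for v
  proof -
    have [measurable]: "(\<lambda>\<xi>. ring_time \<xi> (v, m)) \<in> borel_measurable (clocks N)"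
      by (rule measurable_ring_time) (use that in simp)
    show ?thesis by measurable
  qed
  have p4: "Measurable.pred (clocks N) (\<lambda>\<xi>. \<xi> (v, k) \<le> L)" if "v \<in> {1..N}" for v k
  proof -
    have [measurable]: "(\<lambda>\<xi>. \<xi> (v, k)) \<in> borel_measurable (clocks N)"
      by (rule measurable_gap) (use that in simp)
    show ?thesis by measurable
  qed
  note ball = pred_intros_countable_bounded(3)
  have 1: "Measurable.pred (clocks N) (\<lambda>\<xi>. \<forall>x\<in>labels N. 0 < \<xi> x)"
    by (rule ball, rule p1)
  have 2: "Measurable.pred (clocks N) (\<lambda>\<xi>. \<forall>x\<in>labels N. \<forall>y\<in>labels N. x \<noteq> y \<longrightarrow> ring_time \<xi> x \<noteq> ring_time \<xi> y)"
    by (rule ball, rule ball, rule p2)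
  have 3: "Measurable.pred (clocks N) (\<lambda>\<xi>. \<forall>v\<in>{1..N}. T < ring_time \<xi> (v, m))"
    by (rule ball, rule p3)
  have 4: "Measurable.pred (clocks N) (\<lambda>\<xi>. \<forall>v\<in>{1..N}. \<forall>k\<in>{..m}. \<xi> (v, k) \<le> L)"
    by (rule ball, rule ball, rule p4)
  show ?thesis unfolding regular_clocks_def[abs_def]
    by (rule pred_intros_logic(3)[OF 1 pred_intros_logic(3)[OF 2 pred_intros_logic(3)[OF 3 4]]])
qed

lemma prob_irregular_clocks:
  assumes "L \<ge> 0"
  shows "measure (clocks N) {\<xi> \<in> space (clocks N). \<not> regular_clocks N m L T \<xi>}
    \<le> real N * (exp T * (1 / 2) ^ Suc m) + real N * (real m + 1) * exp (- L)"
proof -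
  interpret prob_space "clocks N" by (rule prob_space_clocks)
  have [measurable]: "x \<in> labels N \<Longrightarrow> (\<lambda>\<xi>. ring_time \<xi> x) \<in> borel_measurable (clocks N)"
    "x \<in> labels N \<Longrightarrow> (\<lambda>\<xi>. \<xi> x) \<in> borel_measurable (clocks N)" for x
    using measurable_ring_time measurable_gap by auto
  define A where "A v = {\<xi> \<in> space (clocks N). (\<forall>l\<in>{..m}. 0 < \<xi> (v, l)) \<and> ring_time \<xi> (v, m) \<le> T}" for v
  define B where "B v k = {\<xi> \<in> space (clocks N). \<xi> (v, k) > L}" for v k
  have A: "A v \<in> sets (clocks N)" if "v \<in> {1..N}" for v
  proof -
    have [measurable]: "(\<lambda>\<xi>. \<xi> (v, l)) \<in> borel_measurable (clocks N)" for l
      using that by (intro measurable_gap) auto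
    have [measurable]: "(\<lambda>\<xi>. ring_time \<xi> (v, m)) \<in> borel_measurable (clocks N)"
      using that by (intro measurable_ring_time) auto
    show ?thesis unfolding A_def by measurable
  qed
  have B: "B v k \<in> sets (clocks N)" if "v \<in> {1..N}" for v k
  proof -
    have [measurable]: "(\<lambda>\<xi>. \<xi> (v, k)) \<in> borel_measurable (clocks N)"
      using that by (intro measurable_gap) auto
    show ?thesis unfolding B_def by measurable
  qed
  define BB where "BB v = (\<Union>k\<in>{..m}. B v k)" for v
  have BB: "BB v \<in> sets (clocks N)" if "v \<in> {1..N}" for v
    unfolding BB_def using B[OF that] by auto
  have pos: "AE \<xi> in clocks N. \<forall>x\<in>labels N. 0 < \<xi> x"
    by (rule AE_ball_countable'[OF AE_clocks_component[OF _ AE_exp1_pos]]) auto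
  have dist: "AE \<xi> in clocks N. \<forall>x\<in>labels N. \<forall>y\<in>labels N. fst x \<noteq> fst y \<longrightarrow> ring_time \<xi> x \<noteq> ring_time \<xi> y"
  proof (rule AE_ball_countable', rule AE_ball_countable')
    fix x y :: "nat \<times> nat" assume "x \<in> labels N" "y \<in> labels N"
    then show "AE \<xi> in clocks N. fst x \<noteq> fst y \<longrightarrow> ring_time \<xi> x \<noteq> ring_time \<xi> y"
      using AE_ring_times_distinct[of x N y] by (cases "fst x = fst y") auto
  qed auto
  have "AE \<xi> in clocks N. \<xi> \<in> {\<xi> \<in> space (clocks N). \<not> regular_clocks N m L T \<xi>} \<longrightarrow>
      \<xi> \<in> (\<Union>v\<in>{1..N}. A v) \<union> (\<Union>v\<in>{1..N}. BB v)"
    using pos dist AE_space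
  proof eventually_elim
    case (elim \<xi>)
    show ?case
    proof (rule impI, rule ccontr)
      assume bad: "\<xi> \<in> {\<xi> \<in> space (clocks N). \<not> regular_clocks N m L T \<xi>}"
        and "\<xi> \<notin> (\<Union>v\<in>{1..N}. A v) \<union> (\<Union>v\<in>{1..N}. BB v)"
      then have good: "\<And>v. v \<in> {1..N} \<Longrightarrow> \<xi> \<notin> A v" "\<And>v k. v \<in> {1..N} \<Longrightarrow> k \<in> {..m} \<Longrightarrow> \<xi> \<notin> B v k"
        by (auto simp: BB_def)
      have gp: "0 < \<xi> (v, k)" if "v \<in> {1..N}" for v k using elim(1) that by auto
      have mono: "ring_time \<xi> (v, k) < ring_time \<xi> (v, l)" if "v \<in> {1..N}" "k < l" for v k l
        using that(2) by (induction rule: less_Suc_induct) (auto simp: ring_time_Suc gp[OF that(1)])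
      \<comment> \<open>Rings of one site are strictly ordered because the gaps are positive; ties
        between different sites are excluded almost surely by \<open>dist\<close>.\<close>
      have c2: "ring_time \<xi> x \<noteq> ring_time \<xi> y" if "x \<in> labels N" "y \<in> labels N" "x \<noteq> y" for x y
      proof (cases "fst x = fst y")
        case True
        then have "snd x \<noteq> snd y" using that(3) by (simp add: prod_eq_iff)
        then consider "snd x < snd y" | "snd y < snd x" by linarith
        then show ?thesis
          using mono[of "fst x" "snd x" "snd y"] mono[of "fst x" "snd y" "snd x"] that(1) True
          by cases (auto simp: prod_eq_iff split: prod.splits)
      next
        case False
        then show ?thesis using elim(2) that by blast
      qed
      have c3: "T < ring_time \<xi> (v, m)" if "v \<in> {1..N}" for v
        using good(1)[OF that] gp[OF that] elim(3) by (auto simp: A_def not_le)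
      have c4: "\<xi> (v, k) \<le> L" if "v \<in> {1..N}" "k \<in> {..m}" for v k
        using good(2)[OF that] elim(3) by (auto simp: B_def not_less)
      have "regular_clocks N m L T \<xi>"
        unfolding regular_clocks_def
        by (intro conjI elim(1) ballI impI; (rule c2 c3 c4; assumption)?)
      then show False using bad by simp
    qed
  qed
  then have "prob {\<xi> \<in> space (clocks N). \<not> regular_clocks N m L T \<xi>}
      \<le> prob ((\<Union>v\<in>{1..N}. A v) \<union> (\<Union>v\<in>{1..N}. BB v))"
    by (rule finite_measure_mono_AE) (use A BB in auto)
  also have "\<dots> \<le> prob (\<Union>v\<in>{1..N}. A v) + prob (\<Union>v\<in>{1..N}. BB v)"
    by (rule measure_Un_le) (use A BB in auto)
  also have "\<dots> \<le> (\<Sum>v\<in>{1..N}. prob (A v)) + (\<Sum>v\<in>{1..N}. prob (BB v))"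
    by (intro add_mono finite_measure_subadditive_finite) (use A BB in auto)
  also have "\<dots> \<le> (\<Sum>v\<in>{1..N}. exp T * (1 / 2) ^ Suc m) + (\<Sum>v\<in>{1..N}. (real m + 1) * exp (- L))"
  proof (intro add_mono sum_mono)
    fix v assume v: "v \<in> {1..N}"
    show "prob (A v) \<le> exp T * (1 / 2) ^ Suc m" unfolding A_def by (rule prob_few_rings[OF v])
    have "prob (BB v) \<le> (\<Sum>k\<in>{..m}. prob (B v k))"
      unfolding BB_def by (intro finite_measure_subadditive_finite) (use B v in auto)
    also have "\<dots> = (\<Sum>k\<in>{..m}. exp (- L))"
      unfolding B_def using v by (intro sum.cong refl prob_gap_gt assms) auto
    finally show "prob (BB v) \<le> (real m + 1) * exp (- L)" by (simp add: algebra_simps)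
  qed
  also have "\<dots> = real N * (exp T * (1 / 2) ^ Suc m) + real N * (real m + 1) * exp (- L)" by simp
  finally show ?thesis .
qed

section \<open>The two overlap laws as averages\<close>

lemma driving_measure_eq:
  "driving_measure N = uniform_count_measure (spins N) \<Otimes>\<^sub>M (clocks N \<Otimes>\<^sub>M uniforms N)"
  by (simp add: driving_measure_def clocks_def uniforms_def exp1_def uniform01_def)

lemma prob_space_spins: "prob_space (uniform_count_measure (spins N))"
  by (intro prob_space_uniform_count_measure finite_spins spins_nonempty)

lemma measurable_overlap_runs:
  "(\<lambda>U. overlap N (run \<beta> N J ls1 U \<sigma>) (run \<beta> N J ls2 U \<sigma>)) \<in> borel_measurable (uniforms N)"
proof -
  have [measurable]: "(\<lambda>U. run \<beta> N J ls U \<sigma> v) \<in> borel_measurable (uniforms N)" for ls v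
    by (rule measurable_compose[OF measurable_run]) simp
  show ?thesis unfolding overlap_def by measurable
qed

definition run_overlap ::
  "real \<Rightarrow> nat \<Rightarrow> (nat \<times> nat \<Rightarrow> real) \<Rightarrow> real \<Rightarrow> real \<Rightarrow> driving \<Rightarrow> real" where
  "run_overlap \<beta> N J t T = (\<lambda>(\<sigma>, \<xi>, U).
     overlap N (run \<beta> N J (ring_list N \<xi> t) U \<sigma>) (run \<beta> N J (ring_list N \<xi> T) U \<sigma>))"

lemma run_overlap_glauber:
  "overlap N (glauber \<beta> N J \<omega> t) (glauber \<beta> N J \<omega> T) = run_overlap \<beta> N J t T \<omega>"
  by (cases \<omega>) (simp add: run_overlap_def glauber_run)

text \<open>The initial configuration takes finitely many values and the ring lists countably many.
  With these fixed, a measurable function of the uniform variables remains.\<close>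

lemma measurable_run_overlap:
  "run_overlap \<beta> N J t T \<in> borel_measurable (driving_measure N)"
proof -
  let ?M = "driving_measure N"
  have s: "fst \<in> ?M \<rightarrow>\<^sub>M count_space (spins N)"
    unfolding driving_measure_eq
    by (rule measurable_compose[OF measurable_fst])
       (simp add: measurable_def space_uniform_count_measure sets_uniform_count_measure)
  have c: "(\<lambda>\<omega>. ring_list N (fst (snd \<omega>)) t) \<in> ?M \<rightarrow>\<^sub>M count_space UNIV" for t
    unfolding driving_measure_eq
    by (rule measurable_compose[OF _ measurable_ring_list]) simp
  have u: "(\<lambda>\<omega>. overlap N (run \<beta> N J ls1 (snd (snd \<omega>)) \<sigma>) (run \<beta> N J ls2 (snd (snd \<omega>)) \<sigma>)) \<in> borel_measurable ?M"
    for ls1 ls2 \<sigma>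
    unfolding driving_measure_eq
    by (rule measurable_compose[OF _ measurable_overlap_runs]) simp
  have "(\<lambda>\<omega>. overlap N (run \<beta> N J (ring_list N (fst (snd \<omega>)) t) (snd (snd \<omega>)) (fst \<omega>))
      (run \<beta> N J (ring_list N (fst (snd \<omega>)) T) (snd (snd \<omega>)) (fst \<omega>))) \<in> borel_measurable ?M"
  proof (rule measurable_compose_countable'[OF _ s])
    fix \<sigma>
    have 1: "(\<lambda>\<omega>. overlap N (run \<beta> N J (ring_list N (fst (snd \<omega>)) t) (snd (snd \<omega>)) \<sigma>)
      (run \<beta> N J ls2 (snd (snd \<omega>)) \<sigma>)) \<in> borel_measurable ?M" for ls2
      by (rule measurable_compose_countable'[OF u c]) simp
    show "(\<lambda>\<omega>. overlap N (run \<beta> N J (ring_list N (fst (snd \<omega>)) t) (snd (snd \<omega>)) \<sigma>)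
      (run \<beta> N J (ring_list N (fst (snd \<omega>)) T) (snd (snd \<omega>)) \<sigma>)) \<in> borel_measurable ?M"
      by (rule measurable_compose_countable'[OF 1 c]) simp
  qed (simp add: finite_spins countable_finite)
  then show ?thesis by (simp add: run_overlap_def case_prod_beta)
qed

lemma correlation_law_eq:
  "correlation_law \<beta> N J t T = distr (driving_measure N) borel (run_overlap \<beta> N J t T)"
  unfolding correlation_law_def run_overlap_glauber ..

lemma prob_space_driving: "prob_space (driving_measure N)"
proof -
  interpret A: prob_space "uniform_count_measure (spins N)" by (rule prob_space_spins)
  interpret B: prob_space "clocks N" by (rule prob_space_clocks)
  interpret C: prob_space "uniforms N" by (rule prob_space_uniforms)
  interpret BC: pair_prob_space "clocks N" "uniforms N" ..
  interpret ABC: pair_prob_space "uniform_count_measure (spins N)" "clocks N \<Otimes>\<^sub>M uniforms N" ..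
  show ?thesis unfolding driving_measure_eq by unfold_locales
qed

text \<open>By Fubini the probability is the average over the clocks of a conditional probability
  \<open>h\<close>. Clocks outside \<open>G\<close> contribute at most their own probability, since
  \<open>h\<close> and \<open>q\<close> lie between 0 and 1.\<close>

lemma measure_correlation_law:
  assumes B: "B \<in> sets borel"
    and q: "0 \<le> q" "q \<le> 1"
    and G: "Measurable.pred (clocks N) G"
    and bound: "\<And>\<xi>. G \<xi> \<Longrightarrow>
      \<bar>(\<Sum>\<sigma>\<in>spins N. \<integral>U. indicator B (run_overlap \<beta> N J t T (\<sigma>, \<xi>, U)) \<partial>uniforms N) / real (card (spins N)) - q\<bar> \<le> e"
    and e: "e \<ge> 0"
  shows "\<bar>measure (correlation_law \<beta> N J t T) B - q\<bar> \<le>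
    e + measure (clocks N) {\<xi> \<in> space (clocks N). \<not> G \<xi>}"
proof -
  interpret A: prob_space "uniform_count_measure (spins N)" by (rule prob_space_spins)
  interpret B: prob_space "clocks N" by (rule prob_space_clocks)
  interpret C: prob_space "uniforms N" by (rule prob_space_uniforms)
  interpret BC: pair_prob_space "clocks N" "uniforms N" ..
  interpret ABC: pair_prob_space "uniform_count_measure (spins N)" "clocks N \<Otimes>\<^sub>M uniforms N" ..
  define f :: "driving \<Rightarrow> real" where "f \<omega> = indicator B (run_overlap \<beta> N J t T \<omega>)" for \<omega>
  have f: "f \<in> borel_measurable (driving_measure N)"
    unfolding f_def by (rule measurable_compose[OF measurable_run_overlap]) (use B in measurable)
  have fb: "0 \<le> f \<omega>" "f \<omega> \<le> 1" for \<omega> by (auto simp: f_def indicator_def)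
  have int: "integrable (driving_measure N) f"
    unfolding driving_measure_eq
    by (rule ABC.integrable_const_bound[where B = 1]) (use f fb in \<open>auto simp: driving_measure_eq\<close>)
  have swap: "(\<Sum>\<sigma>\<in>spins N. \<integral>p. f (\<sigma>, p) \<partial>(clocks N \<Otimes>\<^sub>M uniforms N)) / real (card (spins N)) =
      (\<integral>\<xi>. (\<Sum>\<sigma>\<in>spins N. \<integral>U. f (\<sigma>, \<xi>, U) \<partial>uniforms N) / real (card (spins N)) \<partial>clocks N)"
    and h_int: "integrable (clocks N) (\<lambda>\<xi>. (\<Sum>\<sigma>\<in>spins N. \<integral>U. f (\<sigma>, \<xi>, U) \<partial>uniforms N) / real (card (spins N)))"
  proof -
    have i2: "integrable (clocks N \<Otimes>\<^sub>M uniforms N) (\<lambda>p. f (\<sigma>, p))" if "\<sigma> \<in> spins N" for \<sigma>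
    proof (rule BC.integrable_const_bound[where B = 1])
      have "Pair \<sigma> \<in> (clocks N \<Otimes>\<^sub>M uniforms N) \<rightarrow>\<^sub>M driving_measure N"
        unfolding driving_measure_eq using that
        by (intro measurable_Pair1') (simp add: space_uniform_count_measure)
      from measurable_compose[OF this f]
      show "(\<lambda>p. f (\<sigma>, p)) \<in> borel_measurable (clocks N \<Otimes>\<^sub>M uniforms N)" .
    qed (use fb in auto)
    have eq: "(\<integral>p. f (\<sigma>, p) \<partial>(clocks N \<Otimes>\<^sub>M uniforms N)) = (\<integral>\<xi>. (\<integral>U. f (\<sigma>, \<xi>, U) \<partial>uniforms N) \<partial>clocks N)"
      if "\<sigma> \<in> spins N" for \<sigma>
      using BC.integral_fst'[OF i2[OF that]] by simp
    have i1: "integrable (clocks N) (\<lambda>\<xi>. \<integral>U. f (\<sigma>, \<xi>, U) \<partial>uniforms N)" if "\<sigma> \<in> spins N" for \<sigma>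
      using BC.integrable_fst'[OF i2[OF that]] by simp
    show "integrable (clocks N) (\<lambda>\<xi>. (\<Sum>\<sigma>\<in>spins N. \<integral>U. f (\<sigma>, \<xi>, U) \<partial>uniforms N) / real (card (spins N)))"
      by (intro Bochner_Integration.integrable_divide Bochner_Integration.integrable_sum i1)
    show "(\<Sum>\<sigma>\<in>spins N. \<integral>p. f (\<sigma>, p) \<partial>(clocks N \<Otimes>\<^sub>M uniforms N)) / real (card (spins N)) =
      (\<integral>\<xi>. (\<Sum>\<sigma>\<in>spins N. \<integral>U. f (\<sigma>, \<xi>, U) \<partial>uniforms N) / real (card (spins N)) \<partial>clocks N)"
      by (simp add: eq i1 Bochner_Integration.integral_sum)
  qed
  have "measure (correlation_law \<beta> N J t T) B = measure (driving_measure N) (run_overlap \<beta> N J t T -` B \<inter> space (driving_measure N))"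
    unfolding correlation_law_eq by (rule measure_distr[OF measurable_run_overlap B])
  also have "\<dots> = (\<integral>\<omega>. f \<omega> \<partial>driving_measure N)"
  proof -
    have "(\<integral>\<omega>. f \<omega> \<partial>driving_measure N) =
        (\<integral>\<omega>. indicator (run_overlap \<beta> N J t T -` B \<inter> space (driving_measure N)) \<omega> \<partial>driving_measure N)"
      by (intro Bochner_Integration.integral_cong) (auto simp: f_def indicator_def)
    then show ?thesis by simp
  qed
  also have "\<dots> = (\<integral>\<sigma>. (\<integral>p. f (\<sigma>, p) \<partial>(clocks N \<Otimes>\<^sub>M uniforms N)) \<partial>uniform_count_measure (spins N))"
    using ABC.integral_fst'[of f] int unfolding driving_measure_eq by simp
  also have "\<dots> = (\<Sum>\<sigma>\<in>spins N. \<integral>p. f (\<sigma>, p) \<partial>(clocks N \<Otimes>\<^sub>M uniforms N)) / real (card (spins N))"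
    by (rule integral_uniform_count_measure[OF finite_spins])
  also note swap
  finally have P: "measure (correlation_law \<beta> N J t T) B =
    (\<integral>\<xi>. (\<Sum>\<sigma>\<in>spins N. \<integral>U. f (\<sigma>, \<xi>, U) \<partial>uniforms N) / real (card (spins N)) \<partial>clocks N)" .
  define h where "h \<xi> = (\<Sum>\<sigma>\<in>spins N. \<integral>U. f (\<sigma>, \<xi>, U) \<partial>uniforms N) / real (card (spins N))" for \<xi>
  have card: "real (card (spins N)) > 0" using finite_spins spins_nonempty by (simp add: card_gt_0_iff)
  have h01: "0 \<le> h \<xi>" "h \<xi> \<le> 1" for \<xi>
  proof -
    have a: "0 \<le> (\<integral>U. f (\<sigma>, \<xi>, U) \<partial>uniforms N)" for \<sigma> using fb by simp
    have b: "(\<integral>U. f (\<sigma>, \<xi>, U) \<partial>uniforms N) \<le> 1" for \<sigma>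
    \<comment> \<open>The bound is wanted for every \<xi>, and a non-integrable section has integral
      0 by convention.\<close>
    proof (cases "integrable (uniforms N) (\<lambda>U. f (\<sigma>, \<xi>, U))")
      case True
      have "(\<integral>U. f (\<sigma>, \<xi>, U) \<partial>uniforms N) \<le> (\<integral>U. 1 \<partial>uniforms N)"
        by (intro integral_mono True) (use fb in auto)
      then show ?thesis using C.prob_space by simp
    qed (simp add: not_integrable_integral_eq)
    show "0 \<le> h \<xi>" unfolding h_def using a by (intro divide_nonneg_nonneg sum_nonneg) auto
    have "(\<Sum>\<sigma>\<in>spins N. \<integral>U. f (\<sigma>, \<xi>, U) \<partial>uniforms N) \<le> (\<Sum>\<sigma>\<in>spins N. 1)"
      by (intro sum_mono b)
    then show "h \<xi> \<le> 1" unfolding h_def using card by (simp add: divide_le_eq)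
  qed
  have hint: "integrable (clocks N) h" using h_int by (simp add: h_def[abs_def])
  define X where "X = {\<xi> \<in> space (clocks N). \<not> G \<xi>}"
  have X: "X \<in> sets (clocks N)" unfolding X_def using G by measurable
  have "measure (correlation_law \<beta> N J t T) B - q = (\<integral>\<xi>. h \<xi> - q \<partial>clocks N)"
    using P hint B.prob_space by (simp add: h_def[abs_def])
  also have "\<bar>\<dots>\<bar> \<le> (\<integral>\<xi>. \<bar>h \<xi> - q\<bar> \<partial>clocks N)" by (rule integral_abs_bound)
  also have "\<dots> \<le> (\<integral>\<xi>. e + indicator X \<xi> \<partial>clocks N)"
  proof (rule integral_mono)
    show "\<bar>h \<xi> - q\<bar> \<le> e + indicator X \<xi>" if "\<xi> \<in> space (clocks N)" for \<xi>
    proof (cases "G \<xi>")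
      case True
      then show ?thesis using bound[OF True] by (simp add: h_def f_def X_def)
    next
      case False
      then have "\<xi> \<in> X" using that by (simp add: X_def)
      then show ?thesis using h01[of \<xi>] q e by (auto simp: abs_if)
    qed
  qed (use hint X in \<open>auto simp: B.emeasure_eq_measure\<close>)
  also have "\<dots> = e + measure (clocks N) X"
    using X B.prob_space by (simp add: B.emeasure_eq_measure)
  finally show ?thesis by (simp add: X_def)
qed

lemma expectation_cond_gibbs:
  assumes "C \<subseteq> spins N" "C \<noteq> {}"
  shows "measure_pmf.expectation (cond_pmf (gibbs \<beta> N J) C) (f :: _ \<Rightarrow> real) =
    (\<Sum>\<sigma>\<in>C. boltzmann \<beta> N J \<sigma> * f \<sigma>) / (\<Sum>\<sigma>\<in>C. boltzmann \<beta> N J \<sigma>)"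
proof -
  have fin: "finite C" using assms finite_spins finite_subset by blast
  have ne: "set_pmf (gibbs \<beta> N J) \<inter> C \<noteq> {}" using assms by (auto simp: set_gibbs)
  have Z: "(\<Sum>\<tau>\<in>spins N. boltzmann \<beta> N J \<tau>) > 0"
    by (intro sum_pos finite_spins spins_nonempty) auto
  have Int: "C \<inter> spins N = C" using assms by auto
  have "measure_pmf.expectation (cond_pmf (gibbs \<beta> N J) C) f = (\<Sum>\<sigma>\<in>C. f \<sigma> * pmf (cond_pmf (gibbs \<beta> N J) C) \<sigma>)"
    by (rule integral_measure_pmf_real[OF fin]) (use ne in \<open>auto simp: set_cond_pmf\<close>)
  also have "\<dots> = (\<Sum>\<sigma>\<in>C. boltzmann \<beta> N J \<sigma> * f \<sigma> / (\<Sum>\<sigma>\<in>C. boltzmann \<beta> N J \<sigma>))"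
  proof (rule sum.cong)
    fix \<sigma> assume "\<sigma> \<in> C"
    then have "pmf (cond_pmf (gibbs \<beta> N J) C) \<sigma> = boltzmann \<beta> N J \<sigma> / (\<Sum>\<sigma>\<in>C. boltzmann \<beta> N J \<sigma>)"
      using Z assms(1) by (auto simp: pmf_cond[OF ne] measure_gibbs Int pmf_gibbs boltzmann_def[symmetric] subset_iff)
    then show "f \<sigma> * pmf (cond_pmf (gibbs \<beta> N J) C) \<sigma> = boltzmann \<beta> N J \<sigma> * f \<sigma> / (\<Sum>\<sigma>\<in>C. boltzmann \<beta> N J \<sigma>)"
      by simp
  qed simp
  finally show ?thesis by (simp add: sum_divide_distrib)
qed

section \<open>Total variation bound for fixed couplings\<close>

context separated_couplings begin

lemma measure_well_overlap_law:
  assumes E_eq: "E = heavy_edges \<beta> a \<gamma> N J" and B: "B \<in> sets borel"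
  defines "F \<equiv> \<lambda>x y. indicator B (overlap N x y) :: real"
  shows "measure (well_overlap_law \<beta> a \<gamma> N J) B =
    (\<Sum>C\<in>bottoms. mean C (\<lambda>x. mean C (F x))) / real (card bottoms)"
proof -
  have wells: "wells \<beta> a \<gamma> N J = bottoms"
    unfolding wells_def E_eq[symmetric] ground_def[symmetric] by (rule hypercube_components_ground)
  have C: "C \<subseteq> spins N" "C \<noteq> {}" "finite C" if Cb: "C \<in> bottoms" for C
  proof -
    obtain \<omega> where \<omega>: "\<omega> \<in> ground" "C = subcube N free \<omega>" using Cb by (auto simp: bottoms_def)
    show "C \<noteq> {}" using ground_in_subcube[OF \<omega>(1)] \<omega>(2) by blast
    show "C \<subseteq> spins N" "finite C" unfolding \<omega>(2) by (auto simp: subcube_def finite_spins)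
  qed
  have bne: "bottoms \<noteq> {}"
    using fold_settle_ground[of _ "[1..<Suc N]"] spins_nonempty[of N] frozen_subset
    by (force simp: bottoms_def)
  have ne: "set_pmf (gibbs \<beta> N J) \<inter> C \<noteq> {}" if "C \<in> bottoms" for C
    using C[OF that] by (auto simp: set_gibbs)
  define P where "P C = cond_pmf (gibbs \<beta> N J) C" for C
  have setP: "set_pmf (P C) = C" if "C \<in> bottoms" for C
    using C[OF that] set_cond_pmf[OF ne[OF that]] by (auto simp: P_def set_gibbs)
  have EP: "measure_pmf.expectation (P C) f = mean C f" if "C \<in> bottoms" for C and f :: "_ \<Rightarrow> real"
    unfolding P_def mean_def by (rule expectation_cond_gibbs[OF C(1,2)[OF that]])
  define G where "G p = (case p of (x, y) \<Rightarrow> F x y)" for p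
  define Q where "Q = bind_pmf (pmf_of_set bottoms) (\<lambda>C. pair_pmf (P C) (P C))"
  have "measure (well_overlap_law \<beta> a \<gamma> N J) B = measure (measure_pmf Q) ((\<lambda>(\<sigma>, \<sigma>'). overlap N \<sigma> \<sigma>') -` B)"
    unfolding well_overlap_law_def wells Q_def P_def by (subst measure_distr) (use B in auto)
  also have "\<dots> = measure_pmf.expectation Q (\<lambda>p. indicator ((\<lambda>(\<sigma>, \<sigma>'). overlap N \<sigma> \<sigma>') -` B) p)"
    by simp
  also have "\<dots> = measure_pmf.expectation Q G"
    by (intro Bochner_Integration.integral_cong) (auto simp: G_def F_def indicator_def)
  also have "\<dots> = (\<Sum>C\<in>bottoms. pmf (pmf_of_set bottoms) C *\<^sub>R measure_pmf.expectation (pair_pmf (P C) (P C)) G)"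
    unfolding Q_def
    by (rule pmf_expectation_bind) (use finite_bottoms bne setP C in auto)
  also have "\<dots> = (\<Sum>C\<in>bottoms. mean C (\<lambda>x. mean C (F x)) / real (card bottoms))"
  proof (rule sum.cong)
    fix Cc assume Cc: "Cc \<in> bottoms"
    have "measure_pmf.expectation (pair_pmf (P Cc) (P Cc)) G =
        measure_pmf.expectation (bind_pmf (P Cc) (\<lambda>x. map_pmf (Pair x) (P Cc))) G"
      by (simp add: pair_pmf_def map_pmf_def)
    also have "\<dots> = (\<Sum>x\<in>Cc. pmf (P Cc) x *\<^sub>R measure_pmf.expectation (map_pmf (Pair x) (P Cc)) G)"
      by (rule pmf_expectation_bind) (use C[OF Cc] setP[OF Cc] in auto)
    also have "\<dots> = (\<Sum>x\<in>Cc. mean Cc (F x) * pmf (P Cc) x)"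
      by (simp add: EP[OF Cc] G_def mult.commute)
    also have "\<dots> = measure_pmf.expectation (P Cc) (\<lambda>x. mean Cc (F x))"
      by (rule integral_measure_pmf_real[symmetric]) (use C[OF Cc] setP[OF Cc] in auto)
    also have "\<dots> = mean Cc (\<lambda>x. mean Cc (F x))" by (rule EP[OF Cc])
    finally show "pmf (pmf_of_set bottoms) Cc *\<^sub>R measure_pmf.expectation (pair_pmf (P Cc) (P Cc)) G =
      mean Cc (\<lambda>x. mean Cc (F x)) / real (card bottoms)"
      using Cc finite_bottoms bne by simp
  qed simp
  finally show ?thesis by (simp add: sum_divide_distrib)
qed

text \<open>For regular clocks \<open>two_time_bound\<close> applies uniformly in the event
  \<open>B\<close>; the remaining clocks cost their probability. Here \<open>m\<close> bounds the
  rings per site, \<open>n\<close> all updates, and \<open>R1\<close> and \<open>R2\<close> count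
  the windows used for mixing before \<open>t\<close> and between \<open>t\<close> and
  \<open>T\<close>.\<close>

lemma tv_bound:
  fixes m :: nat
  assumes E_eq: "E = heavy_edges \<beta> a \<gamma> N J" and N: "N > 0" and L: "L > 0"
    and t: "real (Suc R1) * L \<le> t" "t + real R2 * L \<le> T" and R: "R1 > 0" "R2 > 0"
  defines "n \<equiv> real (N * m)"
  shows "tv_dist (correlation_law \<beta> N J t T) (well_overlap_law \<beta> a \<gamma> N J) \<le>
    n * frozen_error + mixing_error (real R1) n + mixing_error (real R2) n +
    (real N * (exp T * (1 / 2) ^ Suc m) + real N * (real m + 1) * exp (- L))"
    (is "_ \<le> ?b")
proof -
  have sets: "sets (correlation_law \<beta> N J t T) = sets borel" by (simp add: correlation_law_def)
  have "\<bar>measure (correlation_law \<beta> N J t T) B - measure (well_overlap_law \<beta> a \<gamma> N J) B\<bar> \<le> ?b"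
    if B: "B \<in> sets borel" for B
  proof -
    define F where "F = (\<lambda>x y. indicator B (overlap N x y) :: real)"
    have F01: "0 \<le> F x y \<and> F x y \<le> 1" for x y by (simp add: F_def indicator_def)
    define q where "q = measure (well_overlap_law \<beta> a \<gamma> N J) B"
    have q: "q = (\<Sum>C\<in>bottoms. mean C (\<lambda>x. mean C (F x))) / real (card bottoms)"
      unfolding q_def F_def by (rule measure_well_overlap_law[OF E_eq B])
    have q01: "0 \<le> q" "q \<le> 1"
    proof -
      interpret W: prob_space "well_overlap_law \<beta> a \<gamma> N J"
        unfolding well_overlap_law_def by (intro prob_space.prob_space_distr measure_pmf.prob_space_axioms) auto
      show "0 \<le> q" "q \<le> 1" unfolding q_def by auto
    qed
    define e where "e = n * frozen_error + mixing_error (real R1) n + mixing_error (real R2) n"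
    have e: "e \<ge> 0"
      unfolding e_def n_def mixing_error_def
      by (intro add_nonneg_nonneg mult_nonneg_nonneg frozen_error_nonneg real_sqrt_ge_zero) auto
    have bound: "\<bar>(\<Sum>\<sigma>\<in>spins N. \<integral>U. indicator B (run_overlap \<beta> N J t T (\<sigma>, \<xi>, U)) \<partial>uniforms N)
        / real (card (spins N)) - q\<bar> \<le> e" if reg: "regular_clocks N m L T \<xi>" for \<xi>
    proof -
      interpret regular N m L T \<xi> by unfold_locales (use reg L in auto)
      obtain a ls1 r1 ls2 r2 where l:
        "ring_list N \<xi> T = ring_list N \<xi> t @ rings t T"
        "distinct (ring_list N \<xi> T)" "set (ring_list N \<xi> T) \<subseteq> labels N"
        "length (ring_list N \<xi> T) \<le> N * m"
        "map fst (ring_list N \<xi> t) = a @ concat ls1 @ r1" "map fst (rings t T) = concat ls2 @ r2"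
        "set a = {1..N}" "length ls1 = R1" "\<forall>l\<in>set ls1. set l = {1..N}" "set r1 \<subseteq> {1..N}"
        "length ls2 = R2" "\<forall>l\<in>set ls2. set l = {1..N}" "set r2 \<subseteq> {1..N}"
        using two_ring_lists[OF t] by metis
      have "(\<integral>U. indicator B (run_overlap \<beta> N J t T (\<sigma>, \<xi>, U)) \<partial>uniforms N) =
          foldr (heat_bath bw) (a @ concat ls1 @ r1) (\<lambda>x. foldr (heat_bath bw) (concat ls2 @ r2) (F x) x) \<sigma>"
        if "\<sigma> \<in> spins N" for \<sigma>
        using integral_two_runs[of F "ring_list N \<xi> t" "rings t T" N \<sigma> \<beta> J, OF F01] l(1-6) that
        by (simp add: run_overlap_def F_def)
      then have "(\<Sum>\<sigma>\<in>spins N. \<integral>U. indicator B (run_overlap \<beta> N J t T (\<sigma>, \<xi>, U)) \<partial>uniforms N) =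
          (\<Sum>\<sigma>\<in>spins N. foldr (heat_bath bw) (a @ concat ls1 @ r1)
            (\<lambda>x. foldr (heat_bath bw) (concat ls2 @ r2) (F x) x) \<sigma>)"
        by (intro sum.cong) auto
      moreover have "real (length (a @ concat ls1 @ r1) + length (concat ls2 @ r2)) \<le> n"
      proof -
        have "length (a @ concat ls1 @ r1) + length (concat ls2 @ r2) = length (ring_list N \<xi> T)"
          unfolding l(5,6)[symmetric] l(1) by simp
        then show ?thesis using l(4) unfolding n_def by linarith
      qed
      moreover have "ls1 \<noteq> []" "ls2 \<noteq> []" using l(8,11) R by auto
      ultimately show ?thesis
        unfolding q e_def l(8,11)[symmetric]
        using two_time_bound[OF N F01 l(7), of ls1 r1 ls2 r2 n] l(9,10,12,13) by simp
    qed
    have "\<bar>measure (correlation_law \<beta> N J t T) B - q\<bar> \<le>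
        e + measure (clocks N) {\<xi> \<in> space (clocks N). \<not> regular_clocks N m L T \<xi>}"
      by (rule measure_correlation_law[OF B q01 pred_regular_clocks bound e])
    also have "\<dots> \<le> ?b"
      using prob_irregular_clocks[of L N m T] L by (simp add: e_def)
    finally show ?thesis by (simp add: q_def)
  qed
  then show ?thesis
    unfolding tv_dist_def sets by (intro cSUP_least) auto
qed

end

section \<open>Levy disorder\<close>

definition levy :: "real \<Rightarrow> nat \<Rightarrow> real measure" where
  "levy \<alpha> N = density lborel (\<lambda>x. ennreal (coupling_density \<alpha> N x))"

lemma disorder_levy: "disorder \<alpha> N = (\<Pi>\<^sub>M e\<in>pairs N. levy \<alpha> N)"
  by (simp add: disorder_def levy_def)

lemma sets_levy [simp, measurable_cong]: "sets (levy \<alpha> N) = sets borel"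
  by (simp add: levy_def)

lemma space_levy [simp]: "space (levy \<alpha> N) = UNIV"
  by (simp add: levy_def)

lemma measurable_coupling_density [measurable]: "coupling_density \<alpha> N \<in> borel_measurable borel"
  unfolding coupling_density_def[abs_def] by measurable

lemma coupling_density_minus: "coupling_density \<alpha> N (- x) = coupling_density \<alpha> N x"
  by (simp add: coupling_density_def indicator_def)

text \<open>Restricts integrals of symmetric densities to the half line, where they have elementary
  antiderivatives.\<close>

lemma nn_integral_even:
  fixes f :: "real \<Rightarrow> ennreal"
  assumes [measurable]: "f \<in> borel_measurable borel" and even: "\<And>x. f (- x) = f x"
  shows "(\<integral>\<^sup>+x. f x \<partial>lborel) = 2 * (\<integral>\<^sup>+x. f x * indicator {0<..} x \<partial>lborel)"
proof -
  have neg: "(\<integral>\<^sup>+x. f x * indicator {..<0} x \<partial>lborel) = (\<integral>\<^sup>+x. f x * indicator {0<..} x \<partial>lborel)"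
  proof -
    have "(\<integral>\<^sup>+x. f x * indicator {..<0} x \<partial>lborel) =
        ennreal \<bar>- 1\<bar> * (\<integral>\<^sup>+x. f (0 + (- 1) * x) * indicator {..<0} (0 + (- 1) * x) \<partial>lborel)"
      by (rule nn_integral_real_affine) auto
    also have "\<dots> = (\<integral>\<^sup>+x. f x * indicator {0<..} x \<partial>lborel)"
      by (auto simp: even indicator_def intro!: nn_integral_cong)
    finally show ?thesis .
  qed
  have "(\<integral>\<^sup>+x. f x \<partial>lborel) = (\<integral>\<^sup>+x. f x * indicator {0<..} x + f x * indicator {..<0} x \<partial>lborel)"
    by (rule nn_integral_cong_AE, rule AE_mp[OF AE_lborel_singleton[of 0]])
       (auto simp: indicator_def intro!: AE_I2)
  also have "\<dots> = (\<integral>\<^sup>+x. f x * indicator {0<..} x \<partial>lborel) + (\<integral>\<^sup>+x. f x * indicator {..<0} x \<partial>lborel)"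
    by (rule nn_integral_add) auto
  finally show ?thesis by (simp add: neg mult_2)
qed

context
  fixes \<alpha> :: real and N :: nat
  assumes alpha: "0 < \<alpha>" "\<alpha> < 1" and N: "N > 0"
begin

lemma cutoff_powr: "(real N powr (- 1 / \<alpha>)) powr (- \<alpha>) = real N"
  using alpha N by (simp add: powr_powr)

lemma emeasure_levy_tail:
  assumes y: "y \<ge> real N powr (- 1 / \<alpha>)"
  shows "emeasure (levy \<alpha> N) {x. \<bar>x\<bar> \<ge> y} = ennreal (y powr (- \<alpha>) / real N)"
proof -
  have y0: "y > 0" 
  proof -
    have "real N powr (- 1 / \<alpha>) > 0" using N by simp
    then show ?thesis using y by linarith
  qed
  define F where "F x = - (x powr (- \<alpha>)) / (2 * real N)" for x
  define f where "f x = \<alpha> / (2 * real N) * x powr (- (1 + \<alpha>))" for x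
  have "emeasure (levy \<alpha> N) {x. \<bar>x\<bar> \<ge> y} =
      (\<integral>\<^sup>+x. ennreal (coupling_density \<alpha> N x) * indicator {x. \<bar>x\<bar> \<ge> y} x \<partial>lborel)"
    unfolding levy_def by (rule emeasure_density) auto
  also have "\<dots> = 2 * (\<integral>\<^sup>+x. ennreal (coupling_density \<alpha> N x) * indicator {x. \<bar>x\<bar> \<ge> y} x * indicator {0<..} x \<partial>lborel)"
    by (rule nn_integral_even) (auto simp: coupling_density_minus indicator_def)
  also have "(\<integral>\<^sup>+x. ennreal (coupling_density \<alpha> N x) * indicator {x. \<bar>x\<bar> \<ge> y} x * indicator {0<..} x \<partial>lborel)
      = (\<integral>\<^sup>+x. ennreal (f x) * indicator {y..} x \<partial>lborel)"
    using y y0 by (intro nn_integral_cong) (auto simp: indicator_def coupling_density_def f_def)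
  also have "\<dots> = 0 - F y"
  proof (rule nn_integral_FTC_atLeast)
    show "(F has_real_derivative f x) (at x)" if "y \<le> x" for x
    proof -
      have "x > 0" using that y0 by simp
      then have "((\<lambda>x. - 1 / (2 * real N) * x powr (- \<alpha>)) has_real_derivative
          - 1 / (2 * real N) * (- \<alpha> * x powr (- \<alpha> - 1))) (at x)"
        by (intro DERIV_cmult has_real_derivative_powr)
      moreover have "(\<lambda>x. - 1 / (2 * real N) * x powr (- \<alpha>)) = F" by (simp add: F_def fun_eq_iff)
      moreover have "- 1 / (2 * real N) * (- \<alpha> * x powr (- \<alpha> - 1)) = f x"
      proof -
        have e: "- \<alpha> - 1 = - (1 + \<alpha>)" by simp
        show ?thesis unfolding f_def e by simp
      qed
      ultimately show ?thesis by simp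
    qed
    show "f x \<ge> 0" for x using alpha by (simp add: f_def)
    have "((\<lambda>x. x powr (- \<alpha>)) \<longlongrightarrow> 0) at_top"
      by (rule tendsto_neg_powr[OF _ filterlim_ident]) (use alpha in auto)
    then have "((\<lambda>x. - (x powr (- \<alpha>)) / (2 * real N)) \<longlongrightarrow> - 0 / (2 * real N)) at_top"
      by (intro tendsto_divide tendsto_minus tendsto_const) (use N in auto)
    then show "(F \<longlongrightarrow> 0) at_top" by (simp add: F_def[abs_def])
    show "f \<in> borel_measurable borel" unfolding f_def[abs_def] by measurable
  qed
  also have "2 * ennreal (0 - F y) = ennreal (y powr (- \<alpha>) / real N)"
    by (subst ennreal_numeral[symmetric], subst ennreal_mult[symmetric]) (auto simp: F_def)
  finally show ?thesis .
qed

text \<open>All mass lies beyond the cutoff, and the tail formula evaluated at the cutoff gives N /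
  N.\<close>

lemma prob_space_levy: "prob_space (levy \<alpha> N)"
proof
  let ?c = "real N powr (- 1 / \<alpha>)"
  have "emeasure (levy \<alpha> N) {x. \<bar>x\<bar> < ?c} =
      (\<integral>\<^sup>+x. ennreal (coupling_density \<alpha> N x) * indicator {x. \<bar>x\<bar> < ?c} x \<partial>lborel)"
    unfolding levy_def by (rule emeasure_density) auto
  also have "\<dots> = (\<integral>\<^sup>+x. 0 \<partial>(lborel :: real measure))"
    by (intro nn_integral_cong) (simp add: coupling_density_def indicator_def)
  finally have "{x. \<bar>x\<bar> < ?c} \<in> null_sets (levy \<alpha> N)" by (intro null_setsI) auto
  then have "emeasure (levy \<alpha> N) ({x. \<bar>x\<bar> \<ge> ?c} \<union> {x. \<bar>x\<bar> < ?c}) = emeasure (levy \<alpha> N) {x. \<bar>x\<bar> \<ge> ?c}"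
    by (intro emeasure_Un_null_set) auto
  also have "{x. \<bar>x\<bar> \<ge> ?c} \<union> {x. \<bar>x\<bar> < ?c} = UNIV" by auto
  finally have "emeasure (levy \<alpha> N) UNIV = emeasure (levy \<alpha> N) {x. \<bar>x\<bar> \<ge> ?c}" .
  then show "emeasure (levy \<alpha> N) (space (levy \<alpha> N)) = 1"
    unfolding emeasure_levy_tail[OF order.refl] cutoff_powr using N by simp
qed

text \<open>As \<open>\<alpha> < 1\<close>, the truncated first moment is governed by its upper
  limit; the contribution \<open>F c\<close> of the lower limit only decreases it.\<close>

lemma levy_truncated_moment:
  assumes y: "y \<ge> real N powr (- 1 / \<alpha>)"
  shows "(\<integral>\<^sup>+x. ennreal (\<bar>x\<bar> * indicator {x. \<bar>x\<bar> \<le> y} x) \<partial>levy \<alpha> N)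
    \<le> ennreal (\<alpha> / (1 - \<alpha>) * y powr (1 - \<alpha>) / real N)"
proof -
  define c where "c = real N powr (- 1 / \<alpha>)"
  have c0: "c > 0" using N by (simp add: c_def)
  have cy: "c \<le> y" using y by (simp add: c_def)
  define F where "F x = \<alpha> / (2 * real N * (1 - \<alpha>)) * x powr (1 - \<alpha>)" for x
  define f where "f x = \<alpha> / (2 * real N) * x powr (- \<alpha>)" for x
  have "(\<integral>\<^sup>+x. ennreal (\<bar>x\<bar> * indicator {x. \<bar>x\<bar> \<le> y} x) \<partial>levy \<alpha> N) =
      (\<integral>\<^sup>+x. ennreal (coupling_density \<alpha> N x) * ennreal (\<bar>x\<bar> * indicator {x. \<bar>x\<bar> \<le> y} x) \<partial>lborel)"
    unfolding levy_def by (rule nn_integral_density) auto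
  also have "\<dots> = 2 * (\<integral>\<^sup>+x. ennreal (coupling_density \<alpha> N x) * ennreal (\<bar>x\<bar> * indicator {x. \<bar>x\<bar> \<le> y} x) * indicator {0<..} x \<partial>lborel)"
    by (rule nn_integral_even) (auto simp: coupling_density_minus indicator_def)
  also have "(\<integral>\<^sup>+x. ennreal (coupling_density \<alpha> N x) * ennreal (\<bar>x\<bar> * indicator {x. \<bar>x\<bar> \<le> y} x) * indicator {0<..} x \<partial>lborel)
      = (\<integral>\<^sup>+x. ennreal (f x) * indicator {c..y} x \<partial>lborel)"
  proof (intro nn_integral_cong)
    fix x :: real
    have cd: "coupling_density \<alpha> N x = \<alpha> / (2 * real N) * \<bar>x\<bar> powr (- (1 + \<alpha>)) * indicator {x. c \<le> \<bar>x\<bar>} x"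
      by (simp only: coupling_density_def c_def)
    show "ennreal (coupling_density \<alpha> N x) * ennreal (\<bar>x\<bar> * indicator {x. \<bar>x\<bar> \<le> y} x) * indicator {0<..} x
        = ennreal (f x) * indicator {c..y} x"
    proof (cases "x \<in> {c..y}")
      case True
      then have x: "x > 0" using c0 by simp
      have e: "x * x powr (- (1 + \<alpha>)) = x powr (- \<alpha>)"
        using x powr_mult_base[of x "- (1 + \<alpha>)"] by simp
      have "ennreal (coupling_density \<alpha> N x) * ennreal (\<bar>x\<bar> * indicator {x. \<bar>x\<bar> \<le> y} x) * indicator {0<..} x
          = ennreal (\<alpha> / (2 * real N) * x powr (- (1 + \<alpha>))) * ennreal x"
        unfolding cd using True x by simp
      also have "\<dots> = ennreal (\<alpha> / (2 * real N) * x powr (- (1 + \<alpha>)) * x)"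
        by (rule ennreal_mult[symmetric]) (use alpha x in auto)
      also have "\<alpha> / (2 * real N) * x powr (- (1 + \<alpha>)) * x = \<alpha> / (2 * real N) * (x * x powr (- (1 + \<alpha>)))"
        by simp
      also have "\<dots> = f x" unfolding e f_def ..
      finally show ?thesis using True by simp
    next
      case False
      then consider "x \<le> 0" | "x > 0" "x < c" | "x > 0" "x > y" by fastforce
      then show ?thesis
        using False by cases (simp_all add: cd)
    qed
  qed
  also have "\<dots> = F y - F c"
  proof (rule nn_integral_FTC_Icc)
    show "(F has_real_derivative f x) (at x)" if "x \<in> {c..y}" for x
    proof -
      have "x > 0" using that c0 by simp
      then have "((\<lambda>x. \<alpha> / (2 * real N * (1 - \<alpha>)) * x powr (1 - \<alpha>)) has_real_derivative
          \<alpha> / (2 * real N * (1 - \<alpha>)) * ((1 - \<alpha>) * x powr (1 - \<alpha> - 1))) (at x)"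
        by (intro DERIV_cmult has_real_derivative_powr)
      moreover have "\<alpha> / (2 * real N * (1 - \<alpha>)) * ((1 - \<alpha>) * x powr (1 - \<alpha> - 1)) = f x"
        using alpha by (simp add: f_def)
      ultimately show ?thesis by (simp add: F_def[abs_def])
    qed
    show "f x \<ge> 0" for x using alpha by (simp add: f_def)
    show "f \<in> borel_measurable borel" unfolding f_def[abs_def] by measurable
  qed (use cy in auto)
  also have "2 * ennreal (F y - F c) = ennreal (2 * (F y - F c))"
    by (subst ennreal_numeral[symmetric], subst ennreal_mult'[symmetric]) auto
  also have "\<dots> \<le> ennreal (\<alpha> / (1 - \<alpha>) * y powr (1 - \<alpha>) / real N)"
  proof (rule ennreal_leI)
    have "F c \<ge> 0" using alpha by (simp add: F_def)
    then have "2 * (F y - F c) \<le> 2 * F y" by simp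
    also have "\<dots> = \<alpha> / (1 - \<alpha>) * y powr (1 - \<alpha>) / real N" by (simp add: F_def)
    finally show "2 * (F y - F c) \<le> \<alpha> / (1 - \<alpha>) * y powr (1 - \<alpha>) / real N" .
  qed
  finally show ?thesis .
qed

text \<open>The density is at most its value at the inner radius \<open>\<theta> - G\<close>, and
  the shell consists of two intervals of length \<open>2 * G\<close>.\<close>

lemma levy_shell:
  assumes "0 \<le> G" "G < \<theta>"
  shows "emeasure (levy \<alpha> N) {x. \<bar>\<bar>x\<bar> - \<theta>\<bar> \<le> G} \<le> ennreal (2 * \<alpha> * G / real N * (\<theta> - G) powr (- (1 + \<alpha>)))"
proof -
  define c where "c = \<alpha> / (2 * real N) * (\<theta> - G) powr (- (1 + \<alpha>))"
  have c: "c \<ge> 0" using alpha by (simp add: c_def)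
  define S where "S = {\<theta> - G..\<theta> + G} \<union> {- \<theta> - G..- \<theta> + G}"
  have "emeasure (levy \<alpha> N) {x. \<bar>\<bar>x\<bar> - \<theta>\<bar> \<le> G} =
      (\<integral>\<^sup>+x. ennreal (coupling_density \<alpha> N x) * indicator {x. \<bar>\<bar>x\<bar> - \<theta>\<bar> \<le> G} x \<partial>lborel)"
    unfolding levy_def by (rule emeasure_density) auto
  also have "\<dots> \<le> (\<integral>\<^sup>+x. ennreal c * indicator S x \<partial>lborel)"
  proof (rule nn_integral_mono)
    fix x :: real
    show "ennreal (coupling_density \<alpha> N x) * indicator {x. \<bar>\<bar>x\<bar> - \<theta>\<bar> \<le> G} x \<le> ennreal c * indicator S x"
    proof (cases "\<bar>\<bar>x\<bar> - \<theta>\<bar> \<le> G")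
      case True
      then have xS: "x \<in> S" by (auto simp: S_def abs_if split: if_splits)
      have "\<bar>x\<bar> \<ge> \<theta> - G" using True by (auto simp: abs_if split: if_splits)
      then have "\<bar>x\<bar> powr (- (1 + \<alpha>)) \<le> (\<theta> - G) powr (- (1 + \<alpha>))"
        using assms alpha by (intro powr_mono2') auto
      then have "\<alpha> / (2 * real N) * \<bar>x\<bar> powr (- (1 + \<alpha>)) \<le> c"
        unfolding c_def using alpha by (intro mult_left_mono) auto
      then have "coupling_density \<alpha> N x \<le> c"
        using c by (simp add: coupling_density_def indicator_def)
      then show ?thesis using xS by (simp add: indicator_def ennreal_leI)
    qed simp
  qed
  also have "\<dots> = ennreal c * emeasure lborel S" by (rule nn_integral_cmult_indicator) (simp add: S_def)
  also have "\<dots> \<le> ennreal c * (ennreal (2 * G) + ennreal (2 * G))"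
  proof (rule mult_left_mono)
    have "emeasure lborel S \<le> emeasure lborel {\<theta> - G..\<theta> + G} + emeasure lborel {- \<theta> - G..- \<theta> + G}"
      unfolding S_def by (rule emeasure_subadditive) auto
    then show "emeasure lborel S \<le> ennreal (2 * G) + ennreal (2 * G)" using assms by simp
  qed simp
  also have "\<dots> = ennreal (c * (2 * G + 2 * G))"
  proof -
    have "ennreal (2 * G) + ennreal (2 * G) = ennreal (2 * G + 2 * G)"
      by (rule ennreal_plus[symmetric]) (use assms in auto)
    moreover have "ennreal c * ennreal (2 * G + 2 * G) = ennreal (c * (2 * G + 2 * G))"
      by (rule ennreal_mult[symmetric]) (use c assms in auto)
    ultimately show ?thesis by simp
  qed
  also have "c * (2 * G + 2 * G) = 2 * \<alpha> * G / real N * (\<theta> - G) powr (- (1 + \<alpha>))"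
    by (simp add: c_def)
  finally show ?thesis .
qed

end

section \<open>Typical disorder\<close>

context
  fixes \<alpha> :: real and N :: nat
  assumes alpha: "0 < \<alpha>" "\<alpha> < 1" and N: "N > 0"
begin

interpretation levy: prob_space "levy \<alpha> N" by (rule prob_space_levy[OF alpha N])

lemma prob_space_disorder: "prob_space (disorder \<alpha> N)"
  unfolding disorder_levy by (intro prob_space_PiM levy.prob_space_axioms)

interpretation disorder: prob_space "disorder \<alpha> N" by (rule prob_space_disorder)

lemma measurable_coupling: "e \<in> pairs N \<Longrightarrow> (\<lambda>J. J e) \<in> borel_measurable (disorder \<alpha> N)"
  using measurable_component_singleton[of e "pairs N" "\<lambda>_. levy \<alpha> N"]
  by (simp add: disorder_levy cong: measurable_cong_sets)

lemma distr_coupling: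
  assumes "e \<in> pairs N"
  shows "distr (disorder \<alpha> N) (levy \<alpha> N) (\<lambda>J. J e) = levy \<alpha> N"
  unfolding disorder_levy by (rule distr_PiM_component) (use assms levy.prob_space_axioms in auto)

lemma measurable_coupling_levy: "e \<in> pairs N \<Longrightarrow> (\<lambda>J. J e) \<in> disorder \<alpha> N \<rightarrow>\<^sub>M levy \<alpha> N"
  using measurable_coupling by (simp cong: measurable_cong_sets)

lemma prob_coupling:
  assumes e: "e \<in> pairs N" and S: "S \<in> sets borel"
  shows "measure (disorder \<alpha> N) {J \<in> space (disorder \<alpha> N). J e \<in> S} = measure (levy \<alpha> N) S"
proof -
  have "measure (levy \<alpha> N) S = measure (distr (disorder \<alpha> N) (levy \<alpha> N) (\<lambda>J. J e)) S"
    by (simp add: distr_coupling[OF e])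
  also have "\<dots> = measure (disorder \<alpha> N) ((\<lambda>J. J e) -` S \<inter> space (disorder \<alpha> N))"
    by (rule measure_distr[OF measurable_coupling_levy[OF e]]) (use S in simp)
  finally show ?thesis by (simp add: vimage_def Int_def conj_commute)
qed

lemma prob_two_couplings:
  assumes e: "e \<in> pairs N" "e' \<in> pairs N" "e \<noteq> e'" and S: "S \<in> sets borel"
  shows "measure (disorder \<alpha> N) {J \<in> space (disorder \<alpha> N). J e \<in> S \<and> J e' \<in> S} = (measure (levy \<alpha> N) S)\<^sup>2"
proof -
  define F :: "(nat \<times> nat \<Rightarrow> real) \<Rightarrow> real" where "F J = indicator S (J e) * indicator S (J e')" for J
  have ind: "(\<lambda>J. indicator S (J e) :: real) \<in> borel_measurable (disorder \<alpha> N)" if "e \<in> pairs N" for e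
    by (rule measurable_compose[OF measurable_coupling[OF that]]) (use S in measurable)
  have F: "F \<in> borel_measurable (disorder \<alpha> N)"
    unfolding F_def[abs_def] by (intro borel_measurable_times ind e)
  have F1: "\<bar>F J\<bar> \<le> 1" for J by (simp add: F_def indicator_def)
  have set_eq: "(\<integral>J. indicator S (J e') \<partial>disorder \<alpha> N) = measure (levy \<alpha> N) S"
  proof -
    have "(\<integral>J. (indicator S (J e') :: real) \<partial>disorder \<alpha> N) =
        (\<integral>J. indicator {J \<in> space (disorder \<alpha> N). J e' \<in> S} J \<partial>disorder \<alpha> N)"
      by (intro Bochner_Integration.integral_cong) (auto simp: indicator_def)
    then show ?thesis using prob_coupling[OF e(2) S] by (simp add: Int_absorb2 subset_eq)
  qed
  have "measure (disorder \<alpha> N) {J \<in> space (disorder \<alpha> N). J e \<in> S \<and> J e' \<in> S} =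
      (\<integral>J. indicator {J \<in> space (disorder \<alpha> N). J e \<in> S \<and> J e' \<in> S} J \<partial>disorder \<alpha> N)"
    by (simp add: Int_absorb2 subset_eq)
  also have "\<dots> = (\<integral>J. F J \<partial>disorder \<alpha> N)"
    by (intro Bochner_Integration.integral_cong) (auto simp: indicator_def F_def)
  also have "\<dots> = (\<integral>J. (\<integral>u. F (J(e := u)) \<partial>levy \<alpha> N) \<partial>disorder \<alpha> N)"
    unfolding disorder_levy
    by (rule integral_PiM_redraw_inner[where B = 1 and M = "\<lambda>_. levy \<alpha> N"])
       (use e F F1 levy.prob_space_axioms in \<open>auto simp: disorder_levy\<close>)
  also have "\<dots> = (\<integral>J. measure (levy \<alpha> N) S * indicator S (J e') \<partial>disorder \<alpha> N)"
  proof (intro Bochner_Integration.integral_cong refl)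
    fix J
    have "F (J(e := u)) = indicator S (J e') * indicator S u" for u
      using e(3) by (simp add: F_def)
    then show "(\<integral>u. F (J(e := u)) \<partial>levy \<alpha> N) = measure (levy \<alpha> N) S * indicator S (J e')"
      using S by simp
  qed
  also have "\<dots> = (measure (levy \<alpha> N) S)\<^sup>2" by (simp add: set_eq power2_eq_square)
  finally show ?thesis .
qed

lemma card_pairs: "real (card (pairs N)) \<le> real N ^ 2"
proof -
  have "card (pairs N) \<le> card ({1..N} \<times> {1..N})"
    by (rule card_mono) (auto simp: pairs_def)
  then have "card (pairs N) \<le> N * N" by simp
  then show ?thesis by (metis of_nat_le_iff of_nat_mult power2_eq_square)
qed

definition touching :: "((nat \<times> nat) \<times> nat \<times> nat) set" where
  "touching = {(p, q). p \<in> pairs N \<and> q \<in> pairs N \<and> p \<noteq> q \<and> {fst p, snd p} \<inter> {fst q, snd q} \<noteq> {}}"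

lemma finite_touching: "finite touching"
  by (rule finite_subset[of _ "pairs N \<times> pairs N"]) (auto simp: touching_def)

lemma card_touching: "real (card touching) \<le> 4 * real N ^ 3"
proof -
  define near where "near p = (\<lambda>x. (fst p, x)) ` {1..N} \<union> (\<lambda>x. (x, fst p)) ` {1..N} \<union>
     (\<lambda>x. (snd p, x)) ` {1..N} \<union> (\<lambda>x. (x, snd p)) ` {1..N}" for p :: "nat \<times> nat"
  have near: "card (near p) \<le> 4 * N" for p
  proof -
    have im: "card (f ` {1..N}) \<le> N" for f :: "nat \<Rightarrow> nat \<times> nat"
      using card_image_le[of "{1..N}" f] by simp
    have "card (near p) \<le> card ((\<lambda>x. (fst p, x)) ` {1..N}) + card ((\<lambda>x. (x, fst p)) ` {1..N}) +
       card ((\<lambda>x. (snd p, x)) ` {1..N}) + card ((\<lambda>x. (x, snd p)) ` {1..N})"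
      unfolding near_def by (meson card_Un_le order.trans add_right_mono)
    also have "\<dots> \<le> N + N + N + N" by (intro add_mono im)
    finally show ?thesis by simp
  qed
  have "touching \<subseteq> Sigma (pairs N) near"
    by (auto simp: touching_def near_def pairs_def)
  then have "card touching \<le> card (Sigma (pairs N) near)"
    by (rule card_mono[rotated]) (auto simp: near_def)
  also have "\<dots> = (\<Sum>p\<in>pairs N. card (near p))"
    by (rule card_SigmaI) (auto simp: near_def)
  also have "\<dots> \<le> (\<Sum>p\<in>pairs N. 4 * N)" by (intro sum_mono near)
  also have "\<dots> = card (pairs N) * (4 * N)" by simp
  finally have "real (card touching) \<le> real (card (pairs N)) * (4 * real N)"
    by (metis of_nat_le_iff of_nat_mult of_nat_numeral)
  also have "\<dots> \<le> real N ^ 2 * (4 * real N)" using card_pairs by (intro mult_right_mono) auto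
  finally show ?thesis by (simp add: power2_eq_square power3_eq_cube)
qed

definition large_edges :: "real \<Rightarrow> (nat \<times> nat \<Rightarrow> real) \<Rightarrow> (nat \<times> nat) set" where
  "large_edges y J = {e \<in> pairs N. \<bar>J e\<bar> > y}"

lemma not_vertex_disjoint_large:
  "\<not> vertex_disjoint (large_edges y J) \<Longrightarrow> \<exists>(p, q)\<in>touching. \<bar>J p\<bar> > y \<and> \<bar>J q\<bar> > y"
  using vertex_disjointI[of "large_edges y J"] by (fastforce simp: large_edges_def touching_def)

lemma sets_touching_event:
  "(p, q) \<in> touching \<Longrightarrow> {J \<in> space (disorder \<alpha> N). J p \<in> {x. \<bar>x\<bar> \<ge> y} \<and> J q \<in> {x. \<bar>x\<bar> \<ge> y}} \<in> sets (disorder \<alpha> N)"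
proof -
  assume "(p, q) \<in> touching"
  then have [measurable]: "(\<lambda>J. J p) \<in> borel_measurable (disorder \<alpha> N)" "(\<lambda>J. J q) \<in> borel_measurable (disorder \<alpha> N)"
    by (auto simp: touching_def intro: measurable_coupling)
  show ?thesis by measurable
qed

text \<open>Written as the complement of a finite union over touching pairs, so that measurability
  and the union bound are immediate. The non-strict inequality matches the tail formula and is
  stronger than what \<open>large_edges\<close> demands.\<close>

definition disjoint_event :: "real \<Rightarrow> (nat \<times> nat \<Rightarrow> real) set" where
  "disjoint_event y = {J \<in> space (disorder \<alpha> N). \<forall>(p, q)\<in>touching. \<not> (\<bar>J p\<bar> \<ge> y \<and> \<bar>J q\<bar> \<ge> y)}"

lemma disjoint_event_disjoint: "J \<in> disjoint_event y \<Longrightarrow> vertex_disjoint (large_edges y J)"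
  using not_vertex_disjoint_large[of y J] by (fastforce simp: disjoint_event_def)

lemma disjoint_event_compl:
  "space (disorder \<alpha> N) - disjoint_event y =
    (\<Union>(p, q)\<in>touching. {J \<in> space (disorder \<alpha> N). J p \<in> {x. \<bar>x\<bar> \<ge> y} \<and> J q \<in> {x. \<bar>x\<bar> \<ge> y}})"
  by (auto simp: disjoint_event_def)

lemma sets_disjoint_event: "disjoint_event y \<in> sets (disorder \<alpha> N)"
proof -
  have "space (disorder \<alpha> N) - disjoint_event y \<in> sets (disorder \<alpha> N)"
    unfolding disjoint_event_compl using finite_touching sets_touching_event by (intro sets.finite_UN) auto
  then have "space (disorder \<alpha> N) - (space (disorder \<alpha> N) - disjoint_event y) \<in> sets (disorder \<alpha> N)" by auto
  moreover have "space (disorder \<alpha> N) - (space (disorder \<alpha> N) - disjoint_event y) = disjoint_event y"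
    by (auto simp: disjoint_event_def)
  ultimately show ?thesis by simp
qed

text \<open>There are of order N^3 pairs of touching edges, and both couplings of a pair are large
  with probability (y^(-\<alpha>) / N)^2. For y = N^\<delta> the bound vanishes in the limit when 2
  \<alpha> \<delta> > 1.\<close>

lemma prob_disjoint_event:
  assumes y: "y \<ge> real N powr (- 1 / \<alpha>)"
  shows "measure (disorder \<alpha> N) (space (disorder \<alpha> N) - disjoint_event y) \<le> 4 * real N * (y powr (- \<alpha>))\<^sup>2"
proof -
  define T where "T = {x::real. \<bar>x\<bar> \<ge> y}"
  have T: "T \<in> sets borel" unfolding T_def by measurable
  have mT: "measure (levy \<alpha> N) T = y powr (- \<alpha>) / real N"
    using emeasure_levy_tail[OF alpha N y] by (simp add: measure_def T_def)
  have "measure (disorder \<alpha> N) (space (disorder \<alpha> N) - disjoint_event y)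
      \<le> (\<Sum>pq\<in>touching. measure (disorder \<alpha> N) (case pq of (p, q) \<Rightarrow> {J \<in> space (disorder \<alpha> N). J p \<in> T \<and> J q \<in> T}))"
    unfolding disjoint_event_compl T_def[symmetric]
    by (rule disorder.finite_measure_subadditive_finite[OF finite_touching])
       (use sets_touching_event in \<open>auto simp: T_def\<close>)
  also have "\<dots> = (\<Sum>pq\<in>touching. (y powr (- \<alpha>) / real N)\<^sup>2)"
    by (intro sum.cong refl) (auto simp: touching_def mT[symmetric] intro!: prob_two_couplings T)
  also have "\<dots> = real (card touching) * (y powr (- \<alpha>) / real N)\<^sup>2" by simp
  also have "\<dots> \<le> 4 * real N ^ 3 * (y powr (- \<alpha>) / real N)\<^sup>2"
    by (intro mult_right_mono card_touching) auto
  also have "\<dots> = 4 * real N * (y powr (- \<alpha>))\<^sup>2"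
    using N by (simp add: power_divide power2_eq_square power3_eq_cube)
  finally show ?thesis .
qed

definition small_sum :: "real \<Rightarrow> (nat \<times> nat \<Rightarrow> real) \<Rightarrow> real" where
  "small_sum y J = (\<Sum>e\<in>pairs N. \<bar>J e\<bar> * indicator {x. \<bar>x\<bar> \<le> y} (J e))"

lemma measurable_truncation:
  "e \<in> pairs N \<Longrightarrow> (\<lambda>J. \<bar>J e\<bar> * indicator {x. \<bar>x\<bar> \<le> y} (J e)) \<in> borel_measurable (disorder \<alpha> N)"
  by (rule measurable_compose[OF measurable_coupling]) measurable

lemma expectation_truncation:
  assumes y: "y \<ge> real N powr (- 1 / \<alpha>)" and e: "e \<in> pairs N"
  shows "integrable (disorder \<alpha> N) (\<lambda>J. \<bar>J e\<bar> * indicator {x. \<bar>x\<bar> \<le> y} (J e))"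
    and "(\<integral>J. \<bar>J e\<bar> * indicator {x. \<bar>x\<bar> \<le> y} (J e) \<partial>disorder \<alpha> N) \<le> \<alpha> / (1 - \<alpha>) * y powr (1 - \<alpha>) / real N"
proof -
  have y0: "y \<ge> 0" using y by (rule order.trans[rotated]) simp
  show int: "integrable (disorder \<alpha> N) (\<lambda>J. \<bar>J e\<bar> * indicator {x. \<bar>x\<bar> \<le> y} (J e))"
    by (rule disorder.integrable_const_bound[where B = y])
       (use y0 measurable_truncation[OF e] in \<open>auto simp: indicator_def\<close>)
  have "ennreal (\<integral>J. \<bar>J e\<bar> * indicator {x. \<bar>x\<bar> \<le> y} (J e) \<partial>disorder \<alpha> N) =
      (\<integral>\<^sup>+J. ennreal (\<bar>J e\<bar> * indicator {x. \<bar>x\<bar> \<le> y} (J e)) \<partial>disorder \<alpha> N)"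
    by (rule nn_integral_eq_integral[OF int, symmetric]) auto
  also have "\<dots> = (\<integral>\<^sup>+x. ennreal (\<bar>x\<bar> * indicator {x. \<bar>x\<bar> \<le> y} x) \<partial>distr (disorder \<alpha> N) (levy \<alpha> N) (\<lambda>J. J e))"
    by (rule nn_integral_distr[OF measurable_coupling_levy[OF e], symmetric]) measurable
  also have "\<dots> \<le> ennreal (\<alpha> / (1 - \<alpha>) * y powr (1 - \<alpha>) / real N)"
    unfolding distr_coupling[OF e] by (rule levy_truncated_moment[OF alpha N y])
  finally show "(\<integral>J. \<bar>J e\<bar> * indicator {x. \<bar>x\<bar> \<le> y} (J e) \<partial>disorder \<alpha> N) \<le> \<alpha> / (1 - \<alpha>) * y powr (1 - \<alpha>) / real N"
    using alpha by (subst (asm) ennreal_le_iff) auto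
qed

lemma measurable_small_sum: "small_sum y \<in> borel_measurable (disorder \<alpha> N)"
  unfolding small_sum_def[abs_def] by (intro borel_measurable_sum measurable_truncation)

text \<open>Markov's inequality: at most N^2 couplings, each with truncated mean of order y^(1 -
  \<alpha>) / N. For y = N^\<delta> this allows M = N^\<kappa> as soon as \<kappa> > 1 + \<delta> (1
  - \<alpha>).\<close>

lemma prob_small_sum:
  assumes y: "y \<ge> real N powr (- 1 / \<alpha>)" and M: "M > 0"
  shows "measure (disorder \<alpha> N) {J \<in> space (disorder \<alpha> N). small_sum y J \<ge> M}
    \<le> real N * (\<alpha> / (1 - \<alpha>) * y powr (1 - \<alpha>)) / M"
proof -
  have int: "integrable (disorder \<alpha> N) (small_sum y)"
    unfolding small_sum_def[abs_def] by (intro Bochner_Integration.integrable_sum expectation_truncation(1) y)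
  have "measure (disorder \<alpha> N) {J \<in> space (disorder \<alpha> N). small_sum y J \<ge> M} \<le> (\<integral>J. small_sum y J \<partial>disorder \<alpha> N) / M"
    by (rule integral_Markov_inequality_measure[OF int sets.empty_sets])
       (use M in \<open>auto simp: small_sum_def intro!: AE_I2 sum_nonneg\<close>)
  also have "\<dots> \<le> (real N * (\<alpha> / (1 - \<alpha>) * y powr (1 - \<alpha>))) / M"
  proof (rule divide_right_mono)
    have "(\<integral>J. small_sum y J \<partial>disorder \<alpha> N) =
        (\<Sum>e\<in>pairs N. \<integral>J. \<bar>J e\<bar> * indicator {x. \<bar>x\<bar> \<le> y} (J e) \<partial>disorder \<alpha> N)"
      unfolding small_sum_def by (rule Bochner_Integration.integral_sum) (rule expectation_truncation(1)[OF y])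
    also have "\<dots> \<le> (\<Sum>e\<in>pairs N. \<alpha> / (1 - \<alpha>) * y powr (1 - \<alpha>) / real N)"
      by (intro sum_mono expectation_truncation(2)[OF y])
    also have "\<dots> = real (card (pairs N)) * (\<alpha> / (1 - \<alpha>) * y powr (1 - \<alpha>) / real N)" by simp
    also have "\<dots> \<le> real N ^ 2 * (\<alpha> / (1 - \<alpha>) * y powr (1 - \<alpha>) / real N)"
      using card_pairs alpha by (intro mult_right_mono) auto
    also have "\<dots> = real N * (\<alpha> / (1 - \<alpha>) * y powr (1 - \<alpha>))"
      using N by (simp add: power2_eq_square)
    finally show "(\<integral>J. small_sum y J \<partial>disorder \<alpha> N) \<le> real N * (\<alpha> / (1 - \<alpha>) * y powr (1 - \<alpha>))" .
  qed (use M in simp)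
  finally show ?thesis .
qed

definition shell_event :: "real \<Rightarrow> real \<Rightarrow> (nat \<times> nat \<Rightarrow> real) set" where
  "shell_event \<theta> G = (\<Union>e\<in>pairs N. {J \<in> space (disorder \<alpha> N). J e \<in> {x. \<bar>\<bar>x\<bar> - \<theta>\<bar> \<le> G}})"

lemma sets_shell_event: "shell_event \<theta> G \<in> sets (disorder \<alpha> N)"
  unfolding shell_event_def
proof (rule sets.finite_UN)
  fix e assume "e \<in> pairs N"
  note [measurable] = measurable_coupling[OF this]
  show "{J \<in> space (disorder \<alpha> N). J e \<in> {x. \<bar>\<bar>x\<bar> - \<theta>\<bar> \<le> G}} \<in> sets (disorder \<alpha> N)" by measurable
qed simp

text \<open>A union bound over at most N^2 couplings. For G = N^g and \<theta> of order N^\<gamma>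
  it is of order N^(1 + g - \<gamma> (1 + \<alpha>)).\<close>

lemma prob_shell_event:
  assumes "0 \<le> G" "G < \<theta>"
  shows "measure (disorder \<alpha> N) (shell_event \<theta> G) \<le> real N * (2 * \<alpha> * G * (\<theta> - G) powr (- (1 + \<alpha>)))"
proof -
  define S where "S = {x::real. \<bar>\<bar>x\<bar> - \<theta>\<bar> \<le> G}"
  have S: "S \<in> sets borel" unfolding S_def by measurable
  have mS: "measure (levy \<alpha> N) S \<le> 2 * \<alpha> * G / real N * (\<theta> - G) powr (- (1 + \<alpha>))"
    using levy_shell[OF alpha N assms] alpha assms
    by (simp add: S_def[symmetric] levy.emeasure_eq_measure)
  have ev: "{J \<in> space (disorder \<alpha> N). J e \<in> S} \<in> sets (disorder \<alpha> N)" if "e \<in> pairs N" for e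
    using measurable_sets[OF measurable_coupling[OF that] S] by (simp add: vimage_def Int_def conj_commute)
  have "measure (disorder \<alpha> N) (shell_event \<theta> G) \<le> (\<Sum>e\<in>pairs N. measure (disorder \<alpha> N) {J \<in> space (disorder \<alpha> N). J e \<in> S})"
    unfolding shell_event_def S_def[symmetric]
    by (rule disorder.finite_measure_subadditive_finite) (use ev in auto)
  also have "\<dots> = (\<Sum>e\<in>pairs N. measure (levy \<alpha> N) S)"
    by (intro sum.cong refl prob_coupling S)
  also have "\<dots> \<le> (\<Sum>e\<in>pairs N. 2 * \<alpha> * G / real N * (\<theta> - G) powr (- (1 + \<alpha>)))"
    by (intro sum_mono mS)
  also have "\<dots> = real (card (pairs N)) * (2 * \<alpha> * G / real N * (\<theta> - G) powr (- (1 + \<alpha>)))" by simp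
  also have "\<dots> \<le> real N ^ 2 * (2 * \<alpha> * G / real N * (\<theta> - G) powr (- (1 + \<alpha>)))"
    using card_pairs alpha assms by (intro mult_right_mono) auto
  also have "\<dots> = real N * (2 * \<alpha> * G * (\<theta> - G) powr (- (1 + \<alpha>)))"
    using N by (simp add: power2_eq_square)
  finally show ?thesis .
qed

definition good_disorder :: "real \<Rightarrow> real \<Rightarrow> real \<Rightarrow> real \<Rightarrow> (nat \<times> nat \<Rightarrow> real) set" where
  "good_disorder y M \<theta> G = disjoint_event y \<inter> {J \<in> space (disorder \<alpha> N). \<not> small_sum y J \<ge> M} - shell_event \<theta> G"

lemma sets_good_disorder: "good_disorder y M \<theta> G \<in> sets (disorder \<alpha> N)"
proof -
  note [measurable] = sets_disjoint_event sets_shell_event measurable_small_sum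
  show ?thesis unfolding good_disorder_def by measurable
qed

lemma prob_good_disorder:
  assumes y: "y \<ge> real N powr (- 1 / \<alpha>)" and M: "M > 0" and G: "0 \<le> G" "G < \<theta>"
  shows "measure (disorder \<alpha> N) (good_disorder y M \<theta> G) \<ge>
    1 - (4 * real N * (y powr (- \<alpha>))\<^sup>2 + real N * (\<alpha> / (1 - \<alpha>) * y powr (1 - \<alpha>)) / M
      + real N * (2 * \<alpha> * G * (\<theta> - G) powr (- (1 + \<alpha>))))"
proof -
  let ?P = "measure (disorder \<alpha> N)"
  let ?A = "space (disorder \<alpha> N) - disjoint_event y"
  let ?B = "{J \<in> space (disorder \<alpha> N). small_sum y J \<ge> M}"
  let ?C = "shell_event \<theta> G"
  note [measurable] = measurable_small_sum
  have sets: "?A \<in> sets (disorder \<alpha> N)" "?B \<in> sets (disorder \<alpha> N)" "?C \<in> sets (disorder \<alpha> N)"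
    using sets_disjoint_event sets_shell_event by (auto, measurable)
  have "1 - ?P (good_disorder y M \<theta> G) = ?P (space (disorder \<alpha> N) - good_disorder y M \<theta> G)"
    by (rule disorder.prob_compl[OF sets_good_disorder, symmetric])
  also have "\<dots> \<le> ?P (?A \<union> ?B \<union> ?C)"
    by (rule disorder.finite_measure_mono) (use sets in \<open>auto simp: good_disorder_def\<close>)
  also have "\<dots> \<le> ?P (?A \<union> ?B) + ?P ?C" by (rule measure_Un_le) (use sets in auto)
  also have "\<dots> \<le> ?P ?A + ?P ?B + ?P ?C" by (intro add_right_mono measure_Un_le sets)
  also have "\<dots> \<le> 4 * real N * (y powr (- \<alpha>))\<^sup>2 + real N * (\<alpha> / (1 - \<alpha>) * y powr (1 - \<alpha>)) / M
      + real N * (2 * \<alpha> * G * (\<theta> - G) powr (- (1 + \<alpha>)))"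
    by (intro add_mono prob_disjoint_event prob_small_sum prob_shell_event assms)
  finally show ?thesis by linarith
qed

lemma good_disorderD:
  assumes "J \<in> good_disorder y M \<theta> G"
  shows "vertex_disjoint (large_edges y J)" "small_sum y J \<le> M"
    "\<And>e. e \<in> pairs N \<Longrightarrow> \<bar>J e\<bar> < \<theta> - G \<or> \<bar>J e\<bar> > \<theta> + G"
proof -
  show "vertex_disjoint (large_edges y J)" "small_sum y J \<le> M"
    using assms disjoint_event_disjoint by (auto simp: good_disorder_def)
  fix e assume "e \<in> pairs N"
  then have "\<not> \<bar>\<bar>J e\<bar> - \<theta>\<bar> \<le> G"
    using assms by (auto simp: good_disorder_def shell_event_def)
  then show "\<bar>J e\<bar> < \<theta> - G \<or> \<bar>J e\<bar> > \<theta> + G" by (auto simp: abs_if split: if_splits)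
qed

end

section \<open>Asymptotics\<close>

text \<open>As no coupling lies in the shell, the single threshold \<theta> splits into two: heavy
  couplings exceed \<open>\<theta> + G\<close>, and medium ones stay below
  \<open>\<theta> - G\<close>. The margin \<open>G\<close> on either side is what later outweighs
  \<open>M\<close>.\<close>

lemma separated_good_disorder:
  assumes alpha: "0 < \<alpha>" "\<alpha> < 1" and N: "N > 0" and beta: "\<beta> > 0"
    and J: "J \<in> good_disorder \<alpha> N y M \<theta> G"
    and theta: "\<theta> = a / (2 * \<beta>) * real N powr \<gamma>" and y: "0 \<le> y" "y < \<theta>" and G: "0 \<le> G" "G \<le> \<theta>"
  shows "separated_couplings N \<beta> J (heavy_edges \<beta> a \<gamma> N J)
    (large_edges N y J - heavy_edges \<beta> a \<gamma> N J) (\<theta> + G) (\<theta> - G) M"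
proof -
  note good = good_disorderD[OF alpha N J]
  have heavy: "heavy_edges \<beta> a \<gamma> N J = {e \<in> pairs N. \<bar>J e\<bar> \<ge> \<theta>}"
    unfolding heavy_edges_def theta by auto
  have sub: "heavy_edges \<beta> a \<gamma> N J \<subseteq> large_edges N y J"
    using y unfolding heavy large_edges_def[OF alpha N] by auto
  then have un: "heavy_edges \<beta> a \<gamma> N J \<union> (large_edges N y J - heavy_edges \<beta> a \<gamma> N J) = large_edges N y J"
    by auto
  show ?thesis
  proof
    show "vertex_disjoint (heavy_edges \<beta> a \<gamma> N J \<union> (large_edges N y J - heavy_edges \<beta> a \<gamma> N J))"
      unfolding un by (rule good(1))
    show "\<theta> + G \<le> \<bar>J e\<bar>" if "e \<in> heavy_edges \<beta> a \<gamma> N J" for e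
      using good(3)[of e] that G unfolding heavy by auto
    show "\<bar>J e\<bar> \<le> \<theta> - G" if "e \<in> large_edges N y J - heavy_edges \<beta> a \<gamma> N J" for e
      using good(3)[of e] that G unfolding heavy large_edges_def[OF alpha N] by auto
    have "(\<Sum>e\<in>pairs N - large_edges N y J. \<bar>J e\<bar>) =
        (\<Sum>e\<in>pairs N - large_edges N y J. \<bar>J e\<bar> * indicator {x. \<bar>x\<bar> \<le> y} (J e))"
      by (intro sum.cong) (auto simp: large_edges_def[OF alpha N])
    also have "\<dots> \<le> small_sum N y J"
      unfolding small_sum_def[OF alpha N] by (intro sum_mono2) auto
    finally show "(\<Sum>e\<in>pairs N - (heavy_edges \<beta> a \<gamma> N J \<union> (large_edges N y J - heavy_edges \<beta> a \<gamma> N J)). \<bar>J e\<bar>) \<le> M"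
      unfolding un using good(2) by linarith
  qed (use beta y G in \<open>auto simp: heavy large_edges_def[OF alpha N]\<close>)
qed

text \<open>The terms account, in this order, for a heavy coupling that ceases to be satisfied, for
  incomplete mixing within a well before each of the two times, and for clocks that ring too often
  or pause too long.\<close>

definition tv_error :: "real \<Rightarrow> real \<Rightarrow> real \<Rightarrow> nat \<Rightarrow> real \<Rightarrow> real \<Rightarrow> real" where
  "tv_error \<beta> s X N M h = 5 * s * real N * exp (- h) +
     2 * sqrt (2 ^ N * exp (real N * X + 2 * \<beta> * M) *
       exp (- ((min (1 / 4) ((s - 1) / 2))\<^sup>2 / (80 * s) * (exp h / ((X + real N)\<^sup>2 * real N ^ 3))))) +
     real N * exp (- exp X) + 6 * s * real N * exp (- real N)"

text \<open>The parameters of \<open>tv_bound\<close> are fixed here. As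
  \<open>2 * \<beta> * \<theta>0 = X\<close> and \<open>t = exp X\<close>, the threshold part of the
  violation probability is \<open>1 / t\<close> and that of \<open>gap_const\<close> is
  \<open>t\<close>; only the margin \<open>h\<close> survives in both.\<close>

lemma tv_explicit:
  assumes sep: "separated_couplings N \<beta> J (heavy_edges \<beta> a \<gamma> N J) D (\<theta>0 + G) (\<theta>0 - G) M"
    and N: "N > 0" and theta0: "\<theta>0 = a / (2 * \<beta>) * real N powr \<gamma>" and beta: "\<beta> > 0" and G: "G \<ge> 0"
    and X: "X = a * real N powr \<gamma>" "X \<ge> 0" and s: "s > 1"
    and t: "t = exp X" "4 * (X + real N) \<le> t" "2 * (X + real N) \<le> (s - 1) * t"
  shows "tv_dist (correlation_law \<beta> N J t (s * t)) (well_overlap_law \<beta> a \<gamma> N J)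
    \<le> tv_error \<beta> s X N M (2 * \<beta> * (G - M))"
proof -
  interpret separated_couplings N \<beta> J "heavy_edges \<beta> a \<gamma> N J" D "\<theta>0 + G" "\<theta>0 - G" M by (rule sep)
  define h where "h = 2 * \<beta> * (G - M)"
  \<comment> \<open>A gap exceeds \<open>L\<close> with probability
    \<open>exp (- X) * exp (- real N)\<close>; the first factor compensates the number of gaps per
    site, which is of order \<open>t\<close>.\<close>
  define L where "L = X + real N"
  define \<rho> where "\<rho> = min (1 / 4) ((s - 1) / 2)"
  \<comment> \<open>More than \<open>m\<close> rings at a site have probability at most
    \<open>exp (s * t) * (1 / 2) ^ Suc m\<close>, and \<open>exp (1 / 2) \<le> 2\<close> makes
    \<open>(2::real) ^ m\<close> at least \<open>exp (2 * (s * t))\<close>.\<close>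
  define m where "m = nat \<lceil>4 * s * t\<rceil>"
  \<comment> \<open>The factor 2 uses only half of the interval for mixing windows and leaves room
    for the additional window in \<open>Suc R1\<close>. Halving also absorbs the rounding, giving
    the \<open>1 / 4\<close> in \<rho>.\<close>
  define R1 where "R1 = nat \<lfloor>t / (2 * L)\<rfloor>"
  define R2 where "R2 = nat \<lfloor>(s - 1) * t / L\<rfloor>"
  have L: "L > 0" using X N by (simp add: L_def)
  have t0: "t > 0" "t \<ge> 1" using X t by auto
  have st: "s * t \<ge> 1" using s t0 by (metis less_eq_real_def mult_mono' mult_1 zero_le_one order.trans)
  have \<rho>: "\<rho> > 0" using s by (simp add: \<rho>_def)
  have bX: "2 * \<beta> * \<theta>0 = X" using beta by (simp add: theta0 X)
  have R1_ge: "real R1 \<ge> t / (2 * L) - 1" unfolding R1_def using L t0 by linarith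
  have R2_ge: "real R2 \<ge> (s - 1) * t / L - 1" unfolding R2_def using L t0 s by linarith
  have tL: "t / (4 * L) \<ge> 1" using t(2) L by (simp add: L_def)
  have sL: "(s - 1) * t / (2 * L) \<ge> 1" using t(3) L by (simp add: L_def)
  have \<rho>_le: "\<rho> \<le> 1 / 4" "\<rho> \<le> (s - 1) / 2"
    unfolding \<rho>_def by (rule min.cobounded1, rule min.cobounded2)
  have r1: "real R1 \<ge> \<rho> * t / L"
  proof -
    have "\<rho> * t / L \<le> (1 / 4) * t / L" using L t0 \<rho>_le by (intro divide_right_mono mult_right_mono) auto
    also have "\<dots> = t / (2 * L) - t / (4 * L)" using L by (simp add: field_simps)
    also have "\<dots> \<le> real R1" using R1_ge tL by linarith
    finally show ?thesis .
  qed
  have r2: "real R2 \<ge> \<rho> * t / L"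
  proof -
    have "\<rho> * t / L \<le> ((s - 1) / 2) * t / L" using L t0 \<rho>_le by (intro divide_right_mono mult_right_mono) auto
    also have "\<dots> = (s - 1) * t / L - (s - 1) * t / (2 * L)" using L by (simp add: field_simps)
    also have "\<dots> \<le> real R2" using R2_ge sL by linarith
    finally show ?thesis .
  qed
  have rpos: "\<rho> * t / L > 0" using \<rho> t0 L by simp
  have Rpos: "R1 > 0" "R2 > 0" using r1 r2 rpos by (auto intro: ccontr)
  have R1L: "real (Suc R1) * L \<le> t"
  proof -
    have "real R1 \<le> t / (2 * L)" unfolding R1_def using L t0 by (simp add: floor_le_iff)
    then have "real R1 * L \<le> t / (2 * L) * L" using L by (intro mult_right_mono) auto
    moreover have "t / (2 * L) * L = t / 2" using L by simp
    moreover have "L \<le> t / 2" using t(2) L by (simp add: L_def)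
    ultimately show ?thesis by (simp add: distrib_right)
  qed
  have R2L: "t + real R2 * L \<le> s * t"
  proof -
    have "real R2 \<le> (s - 1) * t / L" unfolding R2_def using L t0 s by simp
    then have "real R2 * L \<le> (s - 1) * t / L * L" using L by (intro mult_right_mono) auto
    moreover have "(s - 1) * t / L * L = (s - 1) * t" using L by simp
    ultimately show ?thesis by (simp add: left_diff_distrib)
  qed
  have m_ge: "real m \<ge> 4 * (s * t)" unfolding m_def by linarith
  have m_le: "real m \<le> 4 * (s * t) + 1" unfolding m_def using st by linarith
  define n where "n = real (N * m)"
  have n_le: "n \<le> 5 * s * t * real N"
  proof -
    have "real m \<le> 5 * (s * t)" using m_le st by linarith
    then have "real N * real m \<le> real N * (5 * (s * t))" by (intro mult_left_mono) auto
    then show ?thesis by (simp add: n_def algebra_simps)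
  qed
  have n_pos: "n > 0"
  proof -
    have "real m > 0" using m_ge st by linarith
    then show ?thesis using N by (simp add: n_def)
  qed
  have tv: "tv_dist (correlation_law \<beta> N J t (s * t)) (well_overlap_law \<beta> a \<gamma> N J) \<le>
    n * frozen_error + mixing_error (real R1) n + mixing_error (real R2) n +
    (real N * (exp (s * t) * (1 / 2) ^ Suc m) + real N * (real m + 1) * exp (- L))"
    unfolding n_def by (rule tv_bound[OF refl N L R1L R2L Rpos])
  have fz: "n * frozen_error \<le> 5 * s * real N * exp (- h)"
  proof -
    have "2 * \<beta> * (\<theta>0 + G - M) = X + h" unfolding bX[symmetric] h_def by (simp add: algebra_simps)
    then have fe: "frozen_error = exp (- X) * exp (- h)"
      unfolding frozen_error_def by (simp add: exp_add[symmetric])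
    have "n * frozen_error \<le> 5 * s * t * real N * frozen_error"
      by (intro mult_right_mono n_le frozen_error_nonneg)
    also have "\<dots> = 5 * s * real N * exp (- h) * (t * exp (- X))" unfolding fe by simp
    also have "t * exp (- X) = 1" using t by (simp add: exp_minus)
    finally show ?thesis by simp
  qed
  have gap: "gap_const = 16 * real N * t * exp (- h)"
  proof -
    have "2 * \<beta> * (M + (\<theta>0 - G)) = X + (- h)" unfolding bX[symmetric] h_def by (simp add: algebra_simps)
    then show ?thesis unfolding gap_const_def by (simp add: exp_diff t(1) exp_minus divide_inverse)
  qed
  \<comment> \<open>The constant 80 is 5 times 16: \<open>n\<close> is at most
    \<open>5 * s * t * real N\<close>, and \<open>gap_const\<close> contributes 16.\<close>
  define A where "A = \<rho>\<^sup>2 / (80 * s) * (exp h / (L\<^sup>2 * real N ^ 3))"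
  have mix: "mixing_error (real R) n \<le> sqrt (2 ^ N * exp (real N * X + 2 * \<beta> * M) * exp (- A))"
    if R: "real R \<ge> \<rho> * t / L" for R
  proof -
    have gp: "n * gap_const * real N > 0" using n_pos gap_const_pos[OF N] N by simp
    have "A = (\<rho> * t / L)\<^sup>2 / (5 * s * t * real N * gap_const * real N)"
      unfolding A_def gap using t0 s N L
      by (simp add: exp_minus field_simps power2_eq_square power3_eq_cube)
    also have "\<dots> \<le> (\<rho> * t / L)\<^sup>2 / (n * gap_const * real N)"
      using n_le gp gap_const_pos[OF N] s t0 by (intro divide_left_mono mult_right_mono mult_pos_pos) (auto simp: zero_less_mult_iff)
    also have "\<dots> \<le> (real R)\<^sup>2 / (n * gap_const * real N)"
      using R rpos gp by (intro divide_right_mono power_mono) auto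
    finally have A: "A \<le> (real R)\<^sup>2 / (n * gap_const * real N)" .
    have "2 * \<beta> * (real N * (\<theta>0 - G) + M) = real N * X - 2 * \<beta> * real N * G + 2 * \<beta> * M"
      unfolding bX[symmetric] by (simp add: algebra_simps)
    also have "\<dots> \<le> real N * X + 2 * \<beta> * M" using beta G by simp
    finally have B: "2 * \<beta> * (real N * (\<theta>0 - G) + M) \<le> real N * X + 2 * \<beta> * M" .
    show ?thesis unfolding mixing_error_def
      using A B by (intro real_sqrt_le_mono mult_mono) auto
  qed
  have c1: "real N * (exp (s * t) * (1 / 2) ^ Suc m) \<le> real N * exp (- t)"
  proof -
    have "(exp (1 / 2 :: real))\<^sup>2 = exp 1" by (simp add: power2_eq_square exp_add[symmetric])
    then have "(exp (1 / 2 :: real))\<^sup>2 \<le> 2\<^sup>2" using exp_le by simp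
    then have e2: "exp (1 / 2 :: real) \<le> 2" by (rule power2_le_imp_le) simp
    have "exp (2 * (s * t)) \<le> (2::real) ^ m"
    proof -
      have "exp (2 * (s * t)) \<le> exp (real m / 2)" using m_ge by simp
      also have "\<dots> = exp (1 / 2) ^ m" using exp_of_nat_mult[of m "1 / 2 :: real"] by simp
      also have "\<dots> \<le> 2 ^ m" by (intro power_mono e2) auto
      finally show ?thesis .
    qed
    then have "exp (s * t) * (1 / 2) ^ m \<le> exp (s * t) * (1 / exp (2 * (s * t)))"
      unfolding power_one_over by (intro mult_left_mono divide_left_mono) auto
    also have "\<dots> = exp (- (s * t))" by (simp add: exp_minus[symmetric] exp_add[symmetric] divide_inverse)
    also have "\<dots> \<le> exp (- t)" using s t0 by simp
    finally have "exp (s * t) * (1 / 2) ^ m \<le> exp (- t)" .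
    moreover have "exp (s * t) * (1 / 2) ^ Suc m \<le> exp (s * t) * (1 / 2) ^ m"
      by (intro mult_left_mono power_decreasing) auto
    ultimately have "exp (s * t) * (1 / 2) ^ Suc m \<le> exp (- t)" by linarith
    then show ?thesis by (rule mult_left_mono) simp
  qed
  have c2: "real N * (real m + 1) * exp (- L) \<le> 6 * s * real N * exp (- real N)"
  proof -
    have eL: "exp (- L) = exp (- X) * exp (- real N)" by (simp add: L_def exp_add[symmetric])
    have "real m + 1 \<le> 6 * s * t" using m_le st by linarith
    then have "real N * (real m + 1) * exp (- L) \<le> real N * (6 * s * t) * exp (- L)"
      by (intro mult_right_mono mult_left_mono) auto
    also have "\<dots> = 6 * s * real N * exp (- real N) * (t * exp (- X))"
      unfolding eL by simp
    also have "t * exp (- X) = 1" using t by (simp add: exp_minus)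
    finally show ?thesis by simp
  qed
  show ?thesis
    using tv fz mix[OF r1] mix[OF r2] c1 c2
    unfolding tv_error_def h_def[symmetric] A_def \<rho>_def L_def t(1) by linarith
qed

lemma poly_exp_decay:
  fixes b g \<kappa> p :: real
  assumes "b > 0" "0 < \<kappa>" "\<kappa> < g"
  shows "(\<lambda>N::nat. real N powr p * exp (- (b * (real N powr g - real N powr \<kappa>)))) \<longlonglongrightarrow> 0"
  using assms by real_asymp

lemma linear_exp_decay: "(\<lambda>N::nat. real N * exp (- real N)) \<longlonglongrightarrow> 0"
  by real_asymp

lemma double_exp_decay:
  fixes a \<gamma> :: real
  assumes "a > 0" "\<gamma> > 0"
  shows "(\<lambda>N::nat. real N * exp (- exp (a * real N powr \<gamma>))) \<longlonglongrightarrow> 0"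
  using assms by real_asymp

lemma time_dominates:
  fixes a \<gamma> c :: real
  assumes "a > 0" "\<gamma> > 0" "c > 0"
  shows "eventually (\<lambda>N::nat. c * (a * real N powr \<gamma> + real N) \<le> exp (a * real N powr \<gamma>)) sequentially"
  using assms by real_asymp

lemma separation_decay:
  fixes b g \<gamma> :: real
  assumes "b > 0" "g < \<gamma>"
  shows "eventually (\<lambda>N::nat. real N powr g \<le> b * real N powr \<gamma>) sequentially"
  using assms by real_asymp

lemma powr_decay: "p > 0 \<Longrightarrow> (\<lambda>N::nat. c * real N powr (- p)) \<longlonglongrightarrow> 0"
  by real_asymp

text \<open>The logarithm \<open>P\<close> of the prefactor under the root and the denominator
  \<open>Q\<close> are bounded by powers of \<open>N\<close>, whereas \<open>exp (h N)\<close>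
  outgrows every power because \<open>\<kappa> < g\<close>.\<close>

lemma tv_error_tendsto:
  fixes a \<beta> \<gamma> g \<kappa> s :: real
  assumes "a > 0" "\<beta> > 0" "\<gamma> > 0" "0 < \<kappa>" "\<kappa> < g" "s > 1"
  shows "(\<lambda>N::nat. tv_error \<beta> s (a * real N powr \<gamma>) N (real N powr \<kappa>)
      (2 * \<beta> * (real N powr g - real N powr \<kappa>))) \<longlonglongrightarrow> 0"
proof -
  define c where "c = (min (1 / 4) ((s - 1) / 2))\<^sup>2 / (80 * s)"
  have "min (1 / 4) ((s - 1) / 2) > 0" using assms by simp
  then have c: "c > 0" unfolding c_def using assms by (intro divide_pos_pos zero_less_power) auto
  define h where "h N = 2 * \<beta> * (real N powr g - real N powr \<kappa>)" for N :: nat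
  \<comment> \<open>An exponent above each of \<open>1\<close>, \<open>\<gamma> + 1\<close> and
    \<kappa>, the exponents occurring in \<open>P\<close>.\<close>
  define q where "q = \<gamma> + 1 + \<kappa>"
  define k where "k = ln 2 + a + 2 * \<beta>"
  define P where "P N = real N * ln 2 + (real N * (a * real N powr \<gamma>) + 2 * \<beta> * real N powr \<kappa>)" for N :: nat
  define Q where "Q N = (a * real N powr \<gamma> + real N)\<^sup>2 * real N ^ 3" for N :: nat
  have decay: "(\<lambda>N. real N powr p * exp (- h N)) \<longlonglongrightarrow> 0" for p
    unfolding h_def using poly_exp_decay[of "2 * \<beta>" \<kappa> g p] assms by simp
  have P: "0 \<le> P N \<and> P N \<le> k * real N powr q" if "N > 0" for N
  proof -
    have N1: "1 \<le> real N" using that by simp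
    have "real N = real N powr 1" using that by simp
    then have 1: "real N \<le> real N powr q"
      using powr_mono[of 1 q "real N"] assms N1 by (simp add: q_def)
    have 2: "real N * real N powr \<gamma> \<le> real N powr q"
      using powr_mono[of "\<gamma> + 1" q "real N"] assms N1 that by (simp add: q_def powr_add mult.commute)
    have 3: "real N powr \<kappa> \<le> real N powr q"
      using powr_mono[of \<kappa> q "real N"] assms N1 by (simp add: q_def)
    have "P N \<le> real N powr q * ln 2 + (a * real N powr q + 2 * \<beta> * real N powr q)"
      unfolding P_def using assms mult_left_mono[OF 2, of a]
      by (intro add_mono mult_right_mono mult_left_mono 1 3) (auto simp: algebra_simps)
    then show ?thesis using assms by (auto simp: P_def k_def algebra_simps intro!: add_nonneg_nonneg)
  qed
  have Q: "0 < Q N \<and> Q N \<le> (a + 1)\<^sup>2 * real N powr (2 * \<gamma> + 5)" if "N > 0" for N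
  proof -
    have N1: "1 \<le> real N" using that by simp
    have 1: "real N powr \<gamma> \<le> real N powr (\<gamma> + 1)" using N1 by (intro powr_mono) auto
    have "real N = real N powr 1" using that by simp
    then have 2: "real N \<le> real N powr (\<gamma> + 1)"
      using powr_mono[of 1 "\<gamma> + 1" "real N"] assms N1 by simp
    have "a * real N powr \<gamma> + real N \<le> a * real N powr (\<gamma> + 1) + real N powr (\<gamma> + 1)"
      using assms by (intro add_mono mult_left_mono 1 2) auto
    also have "\<dots> = (a + 1) * real N powr (\<gamma> + 1)" by (simp add: distrib_right)
    finally have "(a * real N powr \<gamma> + real N)\<^sup>2 \<le> ((a + 1) * real N powr (\<gamma> + 1))\<^sup>2"
      using assms by (intro power_mono) auto
    then have "Q N \<le> ((a + 1) * real N powr (\<gamma> + 1))\<^sup>2 * real N ^ 3"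
      unfolding Q_def by (intro mult_right_mono) auto
    also have "\<dots> = (a + 1)\<^sup>2 * (real N powr (\<gamma> + 1) * real N powr (\<gamma> + 1) * real N powr 3)"
      using that by (simp add: power_mult_distrib power2_eq_square powr_numeral)
    also have "real N powr (\<gamma> + 1) * real N powr (\<gamma> + 1) * real N powr 3 = real N powr (2 * \<gamma> + 5)"
      unfolding powr_add[symmetric] by (rule arg_cong[where f = "\<lambda>x. real N powr x"]) simp
    finally have "Q N \<le> (a + 1)\<^sup>2 * real N powr (2 * \<gamma> + 5)" .
    moreover have "a * real N powr \<gamma> + real N > 0" using assms that by (intro add_nonneg_pos) auto
    then have "Q N > 0" using that by (simp add: Q_def)
    ultimately show ?thesis by simp
  qed
  \<comment> \<open>The exponent of a power that dominates \<open>(P N + real N) * Q N\<close>, to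
    be compared with \<open>exp (h N)\<close>.\<close>
  define p where "p = q + (2 * \<gamma> + 5)"
  have pos: "eventually (\<lambda>N::nat. N > 0) sequentially" by (rule eventually_gt_at_top)
  have expo: "eventually (\<lambda>N. P N - c * (exp (h N) / Q N) \<le> - real N) sequentially"
  proof -
    define C where "C = (k + 1) * (a + 1)\<^sup>2"
    have Cp: "C > 0" using assms by (auto simp: C_def k_def intro!: mult_pos_pos add_pos_pos)
    have "eventually (\<lambda>N. real N powr p * exp (- h N) < c / C) sequentially"
      using order_tendstoD(2)[OF decay[of p], of "c / C"] c Cp by simp
    then show ?thesis using pos
    proof eventually_elim
      case (elim N)
      have Np: "N > 0" by (rule elim(2))
      have N1: "1 \<le> real N" using Np by simp
      have "real N = real N powr 1" using Np by simp
      then have Nq: "real N \<le> real N powr q"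
        using powr_mono[of 1 q "real N"] assms N1 by (simp add: q_def)
      have kp: "k > 0" using assms by (auto simp: k_def intro!: add_pos_pos)
      have "(P N + real N) * Q N \<le> ((k + 1) * real N powr q) * ((a + 1)\<^sup>2 * real N powr (2 * \<gamma> + 5))"
        using P[OF Np] Q[OF Np] Nq kp by (intro mult_mono) (auto simp: distrib_right)
      also have "\<dots> = C * real N powr p" by (simp add: C_def p_def powr_add)
      also have "\<dots> = C * (real N powr p * exp (- h N)) * exp (h N)"
        by (simp add: exp_minus)
      also have "\<dots> \<le> C * (c / C) * exp (h N)"
        using elim(1) Cp by (intro mult_right_mono mult_left_mono) auto
      also have "\<dots> = c * exp (h N)" using Cp by simp
      finally have "P N + real N \<le> c * exp (h N) / Q N"
        using Q[OF Np] by (simp add: le_divide_eq)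
      then show ?case by simp
    qed
  qed
  have lim2: "(\<lambda>N. sqrt (2 ^ N * exp (real N * (a * real N powr \<gamma>) + 2 * \<beta> * real N powr \<kappa>)
      * exp (- (c * (exp (h N) / Q N))))) \<longlonglongrightarrow> 0"
  proof -
    have eq: "2 ^ N * exp (real N * (a * real N powr \<gamma>) + 2 * \<beta> * real N powr \<kappa>) * exp (- (c * (exp (h N) / Q N)))
        = exp (P N - c * (exp (h N) / Q N))" for N
    proof -
      have "(2::real) ^ N = exp (real N * ln 2)" by (simp add: exp_of_nat_mult)
      then show ?thesis unfolding P_def by (simp only: exp_add[symmetric] exp_diff exp_minus) (simp add: exp_add divide_inverse)
    qed
    have "(\<lambda>N::nat. exp (- real N)) \<longlonglongrightarrow> 0" by real_asymp
    then have "(\<lambda>N. exp (P N - c * (exp (h N) / Q N))) \<longlonglongrightarrow> 0"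
      by (rule tendsto_sandwich[OF _ _ tendsto_const, rotated 2])
         (use expo in \<open>auto elim: eventually_mono\<close>)
    then have "(\<lambda>N. sqrt (exp (P N - c * (exp (h N) / Q N)))) \<longlonglongrightarrow> sqrt 0"
      by (rule tendsto_real_sqrt)
    then show ?thesis unfolding eq by simp
  qed
  have lim1: "(\<lambda>N. real N * exp (- h N)) \<longlonglongrightarrow> 0"
    by (rule Lim_transform_eventually[OF decay[of 1]]) (use pos in \<open>auto elim: eventually_mono\<close>)
  have "(\<lambda>N. 5 * s * (real N * exp (- h N)) + 2 * sqrt (2 ^ N * exp (real N * (a * real N powr \<gamma>)
      + 2 * \<beta> * real N powr \<kappa>) * exp (- (c * (exp (h N) / Q N)))) + real N * exp (- exp (a * real N powr \<gamma>))
      + 6 * s * (real N * exp (- real N))) \<longlonglongrightarrow> 5 * s * 0 + 2 * 0 + 0 + 6 * s * 0"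
    using assms by (intro tendsto_add tendsto_mult tendsto_const lim1 lim2 double_exp_decay linear_exp_decay)
  then show ?thesis unfolding tv_error_def c_def[symmetric] h_def[symmetric] Q_def[symmetric]
    by (simp add: mult.assoc)
qed

section \<open>Choice of exponents and conclusion\<close>

lemma tv_dist_le_1:
  assumes "prob_space \<mu>" "prob_space \<nu>"
  shows "tv_dist \<mu> \<nu> \<le> 1"
proof -
  have "\<bar>measure \<mu> B - measure \<nu> B\<bar> \<le> 1" for B
    using prob_space.prob_le_1[OF assms(1), of B] prob_space.prob_le_1[OF assms(2), of B]
      measure_nonneg[of \<mu> B] measure_nonneg[of \<nu> B] by linarith
  then show ?thesis unfolding tv_dist_def by (intro cSUP_least) auto
qed

lemma prob_space_correlation_law: "prob_space (correlation_law \<beta> N J t T)"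
  unfolding correlation_law_eq
  by (intro prob_space.prob_space_distr prob_space_driving measurable_run_overlap)

lemma prob_space_well_overlap_law: "prob_space (well_overlap_law \<beta> a \<gamma> N J)"
  unfolding well_overlap_law_def
  by (intro prob_space.prob_space_distr measure_pmf.prob_space_axioms) auto

text \<open>\<open>\<delta>\<close>, \<open>\<kappa>\<close> and \<open>g\<close> are the exponents of the lower cutoff of the medium couplings, of the sum of the
  small ones, and of the gap around the threshold. With the smallest choice of \<open>\<delta>\<close> and \<open>\<kappa>\<close> and the largest
  of \<open>g\<close>, the condition \<open>\<kappa> < g\<close> becomes \<open>(1 + 3 \<alpha>) / (2 \<alpha>) < \<gamma> (1 + \<alpha>)\<close>, which follows from the bound on \<open>\<gamma>\<close>.\<close>

lemma exponents_exist:
  fixes \<alpha> \<gamma> :: real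
  assumes "0 < \<alpha>" "\<alpha> < 1" "(5 * \<alpha> + 1) / (2 * \<alpha> * (2 * \<alpha> + 1)) < \<gamma>" "\<gamma> < 1 / \<alpha>"
  obtains \<delta> \<kappa> g where "0 < \<delta>" "\<delta> < \<gamma>" "0 < \<kappa>" "\<kappa> < g" "g < \<gamma>"
    "1 < 2 * \<alpha> * \<delta>" "1 + \<delta> * (1 - \<alpha>) < \<kappa>" "1 + g < \<gamma> * (1 + \<alpha>)"
proof -
  define \<Delta> where "\<Delta> = \<gamma> * (1 + \<alpha>) - (1 + 3 * \<alpha>) / (2 * \<alpha>)"
  have base: "\<gamma> * (2 * \<alpha> * (2 * \<alpha> + 1)) > 5 * \<alpha> + 1"
    using assms(1,3) by (simp add: divide_less_eq)
  have D: "\<Delta> > 0"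
  proof -
    \<comment> \<open>Compares the value of \<gamma> at which \<Delta> vanishes with the lower bound
      in the hypothesis: after cross-multiplication they differ by
      \<open>\<alpha> * (1 - \<alpha>)\<close>.\<close>
    have "(1 + 3 * \<alpha>) * (2 * \<alpha> + 1) < (5 * \<alpha> + 1) * (1 + \<alpha>)"
    proof -
      have "(5 * \<alpha> + 1) * (1 + \<alpha>) - (1 + 3 * \<alpha>) * (2 * \<alpha> + 1) = \<alpha> * (1 - \<alpha>)"
        by (simp add: algebra_simps)
      moreover have "\<alpha> * (1 - \<alpha>) > 0" using assms by simp
      ultimately show ?thesis by linarith
    qed
    also have "\<dots> < \<gamma> * (2 * \<alpha> * (2 * \<alpha> + 1)) * (1 + \<alpha>)"
      using base assms by (intro mult_strict_right_mono) auto
    also have "\<dots> = (\<gamma> * (1 + \<alpha>) * (2 * \<alpha>)) * (2 * \<alpha> + 1)" by (simp add: algebra_simps)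
    finally have "1 + 3 * \<alpha> < \<gamma> * (1 + \<alpha>) * (2 * \<alpha>)" using assms by simp
    then show ?thesis using assms by (simp add: \<Delta>_def divide_less_eq)
  qed
  have g2: "1 / (2 * \<alpha>) < \<gamma>"
  proof -
    have "2 * \<alpha> + 1 < 5 * \<alpha> + 1" using assms by simp
    also have "\<dots> < (\<gamma> * (2 * \<alpha>)) * (2 * \<alpha> + 1)" using base by (simp add: algebra_simps)
    finally have "1 * (2 * \<alpha> + 1) < (\<gamma> * (2 * \<alpha>)) * (2 * \<alpha> + 1)" by simp
    then have "1 < \<gamma> * (2 * \<alpha>)" using assms by (simp only: mult_less_cancel_right_pos)
    then show ?thesis using assms by (simp add: divide_less_eq)
  qed
  \<comment> \<open>Adding the slack \<eta> to \<delta> and \<kappa> and subtracting it from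
    \<open>g\<close> costs at most \<open>3 * \<eta>\<close> of \<Delta>, so a quarter of \<Delta>
    suffices. The second bound keeps \<delta> below \<gamma>.\<close>
  define \<eta> where "\<eta> = min (\<Delta> / 4) ((\<gamma> - 1 / (2 * \<alpha>)) / 2)"
  have eta: "\<eta> \<le> \<Delta> / 4" "\<eta> \<le> (\<gamma> - 1 / (2 * \<alpha>)) / 2"
    unfolding \<eta>_def by (rule min.cobounded1, rule min.cobounded2)
  have eta0: "\<eta> > 0" unfolding \<eta>_def using D g2 by simp
  note eta = eta0 eta
  define \<delta> where "\<delta> = 1 / (2 * \<alpha>) + \<eta>"
  define \<kappa> where "\<kappa> = 1 + \<delta> * (1 - \<alpha>) + \<eta>"
  define g where "g = \<gamma> * (1 + \<alpha>) - 1 - \<eta>"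
  have d0: "\<delta> > 0" using assms eta by (simp add: \<delta>_def add_pos_pos)
  have "\<delta> < \<gamma>" using eta g2 by (simp add: \<delta>_def)
  moreover have "\<kappa> > 0" using assms d0 eta by (simp add: \<kappa>_def add_pos_nonneg)
  moreover have "g < \<gamma>"
  proof -
    have "\<gamma> * \<alpha> < 1" using assms by (simp add: less_divide_eq)
    then show ?thesis using eta by (simp add: g_def algebra_simps)
  qed
  moreover have "1 < 2 * \<alpha> * \<delta>" using assms eta by (simp add: \<delta>_def distrib_left)
  moreover have "1 + \<delta> * (1 - \<alpha>) < \<kappa>" using eta by (simp add: \<kappa>_def)
  moreover have "1 + g < \<gamma> * (1 + \<alpha>)" using eta by (simp add: g_def)
  moreover have "\<kappa> < g"
  proof -
    have lin: "1 + x + e < w - 1 - e"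
      if "x = u - 1 / 2 + y" "y \<le> e" "v = u + 3 / 2" "0 < e" "e \<le> (w - v) / 4" for e u v w x y :: real
      using that by (simp add: field_simps)
    have "\<delta> * (1 - \<alpha>) = 1 / (2 * \<alpha>) - 1 / 2 + \<eta> * (1 - \<alpha>)"
      using assms by (simp add: \<delta>_def field_simps)
    moreover have "\<eta> * (1 - \<alpha>) \<le> \<eta>" using assms eta by (simp add: mult_left_le)
    moreover have "(1 + 3 * \<alpha>) / (2 * \<alpha>) = 1 / (2 * \<alpha>) + 3 / 2" using assms by (simp add: field_simps)
    ultimately show ?thesis unfolding \<kappa>_def g_def by (rule lin[OF _ _ _ eta(1) eta(2)[unfolded \<Delta>_def]])
  qed
  ultimately show ?thesis using that d0 by blast
qed

theorem theorem1p5: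
  fixes \<alpha> \<beta> a \<gamma> :: real
  assumes "0 < \<alpha>" and "\<alpha> < 1" and "\<beta> > 0" and "a > 0"
    and "(5 * \<alpha> + 1) / (2 * \<alpha> * (2 * \<alpha> + 1)) < \<gamma>" and "\<gamma> < 1 / \<alpha>"
  shows "\<exists>A :: nat \<Rightarrow> (nat \<times> nat \<Rightarrow> real) set.
    (\<forall>N. A N \<in> sets (disorder \<alpha> N)) \<and>
    (\<forall>N. A N \<subseteq> {J. vertex_disjoint (heavy_edges \<beta> a \<gamma> N J)}) \<and>
    (\<lambda>N. measure (disorder \<alpha> N) (A N)) \<longlonglongrightarrow> 1 \<and>
    (\<forall>s>1. \<exists>\<epsilon> :: nat \<Rightarrow> real. \<epsilon> \<longlonglongrightarrow> 0 \<and>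
      (\<forall>N. \<forall>J\<in>A N.
        tv_dist
          (correlation_law \<beta> N J (time_scale a \<gamma> N) (s * time_scale a \<gamma> N))
          (well_overlap_law \<beta> a \<gamma> N J) \<le> \<epsilon> N))"
proof -
  note alpha = assms(1,2)
  obtain \<delta> \<kappa> g where ex: "0 < \<delta>" "\<delta> < \<gamma>" "0 < \<kappa>" "\<kappa> < g" "g < \<gamma>"
    "1 < 2 * \<alpha> * \<delta>" "1 + \<delta> * (1 - \<alpha>) < \<kappa>" "1 + g < \<gamma> * (1 + \<alpha>)"
    using exponents_exist[OF assms(1,2,5,6)] by blast
  have gamma: "\<gamma> > 0" using ex by linarith
  define \<theta> where "\<theta> N = a / (2 * \<beta>) * real N powr \<gamma>" for N :: nat
  \<comment> \<open>Half the prefactor of the threshold: under \<open>ok N\<close> both the margin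
    and the cutoff are at most half of \<open>\<theta> N\<close>.\<close>
  define b where "b = a / (4 * \<beta>)"
  have b: "b > 0" using assms by (simp add: b_def)
  have theta_b: "\<theta> N = 2 * (b * real N powr \<gamma>)" for N by (simp add: \<theta>_def b_def)
  define ok where "ok N \<longleftrightarrow> N > 0 \<and> real N powr g \<le> b * real N powr \<gamma> \<and> real N powr \<delta> \<le> b * real N powr \<gamma>"
    for N :: nat
  have ev_ok: "eventually ok sequentially"
    unfolding ok_def[abs_def]
    by (intro eventually_conj eventually_gt_at_top separation_decay b ex)
  \<comment> \<open>The set is empty while \<open>ok N\<close> fails, which concerns only finitely
    many \<open>N\<close> and does not affect the limit. It is chosen before \<open>s\<close>, so
    one event serves all \<open>s\<close>.\<close>
  define A where "A N = (if ok N then good_disorder \<alpha> N (real N powr \<delta>) (real N powr \<kappa>) (\<theta> N) (real N powr g) else {})"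
    for N :: nat
  have okD: "N > 0" "0 \<le> real N powr g" "real N powr g < \<theta> N" "0 \<le> real N powr \<delta>" "real N powr \<delta> < \<theta> N"
    "\<theta> N - real N powr g \<ge> b * real N powr \<gamma>" "b * real N powr \<gamma> > 0" if "ok N" for N
  proof -
    have p: "b * real N powr \<gamma> > 0" using that b by (simp add: ok_def)
    then show "N > 0" "0 \<le> real N powr g" "real N powr g < \<theta> N" "0 \<le> real N powr \<delta>" "real N powr \<delta> < \<theta> N"
      "\<theta> N - real N powr g \<ge> b * real N powr \<gamma>" "b * real N powr \<gamma> > 0"
      using that unfolding ok_def theta_b by auto
  qed
  have sep: "separated_couplings N \<beta> J (heavy_edges \<beta> a \<gamma> N J)
      (large_edges N (real N powr \<delta>) J - heavy_edges \<beta> a \<gamma> N J) (\<theta> N + real N powr g) (\<theta> N - real N powr g)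
      (real N powr \<kappa>)" if "J \<in> A N" for N J
  proof -
    have ok: "ok N" using that by (auto simp: A_def split: if_splits)
    show ?thesis
      by (rule separated_good_disorder[OF alpha okD(1)[OF ok] assms(3) _ \<theta>_def])
         (use that ok okD[OF ok] in \<open>auto simp: A_def\<close>)
  qed
  have "(\<lambda>N. measure (disorder \<alpha> N) (A N)) \<longlonglongrightarrow> 1"
  proof -
    define c1 where "c1 = \<alpha> / (1 - \<alpha>)"
    define c2 where "c2 = 2 * \<alpha> * b powr (- (1 + \<alpha>))"
    define err where "err N = 4 * real N powr (- (2 * \<alpha> * \<delta> - 1)) + c1 * real N powr (- (\<kappa> - (1 + \<delta> * (1 - \<alpha>))))
      + c2 * real N powr (- (\<gamma> * (1 + \<alpha>) - (1 + g)))" for N :: nat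
    have "err \<longlonglongrightarrow> 0 + 0 + 0"
      unfolding err_def[abs_def] by (intro tendsto_add powr_decay) (use ex in auto)
    then have lim: "(\<lambda>N. 1 - err N) \<longlonglongrightarrow> 1"
      using tendsto_diff[OF tendsto_const[of 1], of err 0] by simp
    have lower: "eventually (\<lambda>N. 1 - err N \<le> measure (disorder \<alpha> N) (A N)) sequentially"
      using ev_ok
    proof eventually_elim
      case (elim N)
      note d = okD[OF elim]
      have N: "real N > 0" "real N \<ge> 1" using d(1) by auto
      have y: "real N powr \<delta> \<ge> real N powr (- 1 / \<alpha>)"
        using N ex alpha by (intro powr_mono) (auto simp: field_simps intro: order.trans[of _ 0])
      have N1: "real N = real N powr 1" using N by simp
      have t1: "4 * real N * ((real N powr \<delta>) powr (- \<alpha>))\<^sup>2 = 4 * real N powr (- (2 * \<alpha> * \<delta> - 1))"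
      proof -
        have "real N * ((real N powr \<delta>) powr (- \<alpha>))\<^sup>2 = real N powr 1 * (real N powr (- (\<alpha> * \<delta>)) * real N powr (- (\<alpha> * \<delta>)))"
          using N by (simp add: powr_powr power2_eq_square mult.commute)
        also have "\<dots> = real N powr (- (2 * \<alpha> * \<delta> - 1))"
          unfolding powr_add[symmetric] by (rule arg_cong[where f = "\<lambda>x. real N powr x"]) simp
        finally show ?thesis by simp
      qed
      have t2: "real N * (\<alpha> / (1 - \<alpha>) * (real N powr \<delta>) powr (1 - \<alpha>)) / real N powr \<kappa> =
          c1 * real N powr (- (\<kappa> - (1 + \<delta> * (1 - \<alpha>))))"
      proof -
        have "real N * (real N powr \<delta>) powr (1 - \<alpha>) / real N powr \<kappa> =
            real N powr 1 * real N powr (\<delta> * (1 - \<alpha>)) * real N powr (- \<kappa>)"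
          using N by (simp add: powr_powr powr_minus divide_inverse)
        also have "\<dots> = real N powr (- (\<kappa> - (1 + \<delta> * (1 - \<alpha>))))"
          unfolding powr_add[symmetric] by (rule arg_cong[where f = "\<lambda>x. real N powr x"]) simp
        finally have e: "real N * (real N powr \<delta>) powr (1 - \<alpha>) / real N powr \<kappa> =
            real N powr (- (\<kappa> - (1 + \<delta> * (1 - \<alpha>))))" .
        have "real N * (\<alpha> / (1 - \<alpha>) * (real N powr \<delta>) powr (1 - \<alpha>)) / real N powr \<kappa> =
            c1 * (real N * (real N powr \<delta>) powr (1 - \<alpha>) / real N powr \<kappa>)" by (simp add: c1_def)
        then show ?thesis unfolding e .
      qed
      have t3: "real N * (2 * \<alpha> * real N powr g * (\<theta> N - real N powr g) powr (- (1 + \<alpha>))) \<le>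
          c2 * real N powr (- (\<gamma> * (1 + \<alpha>) - (1 + g)))"
      proof -
        have "(\<theta> N - real N powr g) powr (- (1 + \<alpha>)) \<le> (b * real N powr \<gamma>) powr (- (1 + \<alpha>))"
          using d(6,7) alpha by (intro powr_mono2') auto
        also have "\<dots> = b powr (- (1 + \<alpha>)) * real N powr (- (\<gamma> * (1 + \<alpha>)))"
        proof -
          have e: "\<gamma> * (- 1 - \<alpha>) = - (\<gamma> * (1 + \<alpha>))" by (simp add: algebra_simps)
          show ?thesis using b by (simp add: powr_mult powr_powr e)
        qed
        finally have "real N * (2 * \<alpha> * real N powr g * (\<theta> N - real N powr g) powr (- (1 + \<alpha>))) \<le>
            real N * (2 * \<alpha> * real N powr g * (b powr (- (1 + \<alpha>)) * real N powr (- (\<gamma> * (1 + \<alpha>)))))"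
          using alpha by (intro mult_left_mono) auto
        also have "\<dots> = c2 * (real N powr 1 * real N powr g * real N powr (- (\<gamma> * (1 + \<alpha>))))"
          using N by (simp add: c2_def)
        also have "real N powr 1 * real N powr g * real N powr (- (\<gamma> * (1 + \<alpha>))) = real N powr (- (\<gamma> * (1 + \<alpha>) - (1 + g)))"
          unfolding powr_add[symmetric] by (rule arg_cong[where f = "\<lambda>x. real N powr x"]) simp
        finally show ?thesis .
      qed
      have "measure (disorder \<alpha> N) (A N) \<ge> 1 - (4 * real N * ((real N powr \<delta>) powr (- \<alpha>))\<^sup>2 +
          real N * (\<alpha> / (1 - \<alpha>) * (real N powr \<delta>) powr (1 - \<alpha>)) / real N powr \<kappa>
          + real N * (2 * \<alpha> * real N powr g * (\<theta> N - real N powr g) powr (- (1 + \<alpha>))))"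
        using prob_good_disorder[OF alpha d(1) y _ d(2,3), of "real N powr \<kappa>"] N elim by (simp add: A_def)
      then show ?case using t1 t2 t3 unfolding err_def by linarith
    qed
    have upper: "eventually (\<lambda>N. measure (disorder \<alpha> N) (A N) \<le> 1) sequentially"
      using ev_ok
      by eventually_elim (simp add: prob_space.prob_le_1[OF prob_space_disorder[OF alpha okD(1)]])
    show ?thesis by (rule tendsto_sandwich[OF lower upper lim tendsto_const])
  qed
  moreover have "\<forall>N. A N \<in> sets (disorder \<alpha> N)"
    using sets_good_disorder[OF alpha okD(1)] by (simp add: A_def)
  moreover have "\<forall>N. A N \<subseteq> {J. vertex_disjoint (heavy_edges \<beta> a \<gamma> N J)}"
  proof (intro allI subsetI CollectI)
    fix N J assume "J \<in> A N"
    then interpret separated_couplings N \<beta> J "heavy_edges \<beta> a \<gamma> N J"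
      "large_edges N (real N powr \<delta>) J - heavy_edges \<beta> a \<gamma> N J" "\<theta> N + real N powr g" "\<theta> N - real N powr g"
      "real N powr \<kappa>" by (rule sep)
    show "vertex_disjoint (heavy_edges \<beta> a \<gamma> N J)"
      by (rule vertex_disjointI, rule vertex_disjointD[OF disjoint_ED]) auto
  qed
  moreover have "\<exists>\<epsilon> :: nat \<Rightarrow> real. \<epsilon> \<longlonglongrightarrow> 0 \<and>
      (\<forall>N. \<forall>J\<in>A N.
        tv_dist
          (correlation_law \<beta> N J (time_scale a \<gamma> N) (s * time_scale a \<gamma> N))
          (well_overlap_law \<beta> a \<gamma> N J) \<le> \<epsilon> N)" if s: "s > 1" for s
  proof -
    define X where "X N = a * real N powr \<gamma>" for N :: nat
    define large where "large N \<longleftrightarrow> 4 * (X N + real N) \<le> exp (X N) \<and> 2 / (s - 1) * (X N + real N) \<le> exp (X N)"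
      for N :: nat
    \<comment> \<open>Until the time scale dominates the window length, the trivial bound 1 is used;
      how long this lasts depends on \<open>s\<close>, but \<open>\<epsilon>\<close> does not depend
      on the couplings.\<close>
    define \<epsilon> where "\<epsilon> N = (if large N then tv_error \<beta> s (X N) N (real N powr \<kappa>)
      (2 * \<beta> * (real N powr g - real N powr \<kappa>)) else 1)" for N :: nat
    have ev: "eventually large sequentially"
      unfolding large_def[abs_def] X_def using assms gamma s
      by (intro eventually_conj time_dominates) auto
    have "\<epsilon> \<longlonglongrightarrow> 0"
    proof (rule Lim_transform_eventually)
      show "(\<lambda>N. tv_error \<beta> s (X N) N (real N powr \<kappa>) (2 * \<beta> * (real N powr g - real N powr \<kappa>))) \<longlonglongrightarrow> 0"
        unfolding X_def by (rule tv_error_tendsto) (use assms gamma ex s in auto)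
      show "eventually (\<lambda>N. tv_error \<beta> s (X N) N (real N powr \<kappa>) (2 * \<beta> * (real N powr g - real N powr \<kappa>)) = \<epsilon> N) sequentially"
        using ev by eventually_elim (simp add: \<epsilon>_def)
    qed
    moreover have "tv_dist (correlation_law \<beta> N J (time_scale a \<gamma> N) (s * time_scale a \<gamma> N))
        (well_overlap_law \<beta> a \<gamma> N J) \<le> \<epsilon> N" if J: "J \<in> A N" for N J
    proof (cases "large N")
      case True
      have ok: "ok N" using J by (auto simp: A_def split: if_splits)
      have l: "4 * (X N + real N) \<le> exp (X N)" "2 * (X N + real N) \<le> (s - 1) * exp (X N)"
        using True s unfolding large_def by (auto simp: field_simps)
      have "tv_dist (correlation_law \<beta> N J (time_scale a \<gamma> N) (s * time_scale a \<gamma> N))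
        (well_overlap_law \<beta> a \<gamma> N J) \<le> tv_error \<beta> s (X N) N (real N powr \<kappa>) (2 * \<beta> * (real N powr g - real N powr \<kappa>))"
        by (rule tv_explicit[OF sep[OF J] okD(1)[OF ok] \<theta>_def assms(3) okD(2)[OF ok] X_def _ s _ ])
           (use l assms in \<open>auto simp: time_scale_def X_def\<close>)
      then show ?thesis using True by (simp add: \<epsilon>_def)
    next
      case False
      then show ?thesis
        using tv_dist_le_1[OF prob_space_correlation_law prob_space_well_overlap_law] by (simp add: \<epsilon>_def)
    qed
    ultimately show ?thesis by blast
  qed
  ultimately show ?thesis by blast
qed

end
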